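(* Let $\mathcal{E}=\mathrm{Psh}(\mathbb{C})$ be the category of presheaves on a small category $\mathbb{C}$, equipped with a functorial cylinder $I\otimes(-)$ with contractions and connections such that $I\otimes(-)$ has a right adjoint. Assume that (C1) $I\otimes(-)$ preserves pullback squares, and (C2) the natural transformations $\delta^k\otimes(-)\colon\mathrm{Id}\to I\otimes(-)$, $k\in\{0,1\}$, are cartesian. Let $\mathcal{M}$ be a full subcategory of $\mathcal{E}^\to_{\mathrm{cart}}$ such that: (M1) the elements of $\mathcal{M}$ are monomorphisms; (M2) for every $X\in\mathcal{E}$ the unique map $0\to X$ is in $\mathcal{M}$; (M3) the elements of $\mathcal{M}$ are closed under pullback; (M4) the elements of $\mathcal{M}$ are closed under Leibniz product $\delta^k\hat\otimes(-)$ with the endpoint inclusions, $k\in\{0,1\}$; (M5) the category $\mathcal{M}$ has colimits and the inclusion $\mathcal{M}\to\mathcal{E}^\to_{\mathrm{cart}}$ preserves them. Then: (i) A map in $\mathcal{E}$ can be equipped with the structure of a uniform trivial fibration if and only if it is a trivial fibration, i.e. it has the right lifting property with respect to the maps in $\mathcal{M}$. (ii) A map in $\mathcal{E}$ can be equipped with the structure of a uniform fibration if and only if it is a fibration, i.e. it has the right lifting property with respect to the maps $\delta^k\hat\otimes i$ for $k\in\{0,1\}$ and $i\in\mathcal{M}$.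
   Context: $\mathcal{E}^\to$ is the arrow category of $\mathcal{E}$ and $\mathcal{E}^\to_{\mathrm{cart}}$ its subcategory of arrows and pullback squares. A functorial cylinder on $\mathcal{E}$ is an endofunctor $I\otimes(-)$ with natural transformations $\delta^0\otimes(-),\delta^1\otimes(-)\colon \mathrm{Id}\to I\otimes(-)$ (endpoint inclusions). It has contractions if there is a natural transformation $\varepsilon\otimes(-)\colon I\otimes(-)\to\mathrm{Id}$ with $(\varepsilon\otimes X)\circ(\delta^k\otimes X)=\mathrm{id}_X$ for $k=0,1$. It then has connections if for $k\in\{0,1\}$ there is a natural $c^k\otimes(-)\colon I\otimes I\otimes(-)\to I\otimes(-)$ such that $(c^k\otimes X)\circ(\delta^k\otimes I\otimes X)=(\delta^k\otimes X)\circ(\varepsilon\otimes X)=(c^k\otimes X)\circ(I\otimes\delta^k\otimes X)$ and $(c^k\otimes X)\circ(\delta^{1-k}\otimes I\otimes X)=\mathrm{id}_{I\otimes X}=(c^k\otimes X)\circ(I\otimes\delta^{1-k}\otimes X)$; here $\delta^k\otimes I\otimes X$ is the component at $I\otimes X$, and $I\otimes\delta^k\otimes X$ is $I\otimes(-)$ applied to the component at $X$. For $i\colon A\to B$ the Leibniz product $\delta^k\hat\otimes i\colon (I\otimes A)+_A B\to I\otimes B$ is the map out of the pushout of $\delta^k\otimes A$ and $i$ induced by $I\otimes i$ and $\delta^k\otimes B$. For $u\colon\mathcal{J}\to\mathcal{E}^\to$ with values $u_j\colon A_j\to B_j$, a right $\mathcal{J}$-map is a map $f\colon X\to Y$ with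 a function $\phi$ assigning to each $j$ and square $(s,t)\colon u_j\to f$ a diagonal filler $\phi(j,s,t)\colon B_j\to X$, such that for $\sigma\colon j\to j'$ with $u_\sigma=(a,b)$ and $(s,t)\colon u_{j'}\to f$ one has $\phi(j',s,t)\circ b=\phi(j,s\circ a,t\circ b)$. A uniform trivial fibration is a right $\mathcal{M}$-map (for the inclusion $\mathcal{M}\to\mathcal{E}^\to$). Let $u\colon\mathcal{I}\to\mathcal{E}^\to$ be the inclusion of the full subcategory $\mathcal{I}$ of $\mathcal{M}$ spanned by the maps with representable codomain (right $\mathcal{I}$-maps coincide with right $\mathcal{M}$-maps). A uniform fibration is a right $\mathcal{I}_\otimes$-map, where $\mathcal{I}_\otimes=\mathcal{I}+\mathcal{I}$ maps to $\mathcal{E}^\to$ by $i\mapsto\delta^0\hat\otimes u_i$ on the first summand and $i\mapsto\delta^1\hat\otimes u_i$ on the second. *)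

theory Defs
  imports Main "HOL-Library.FuncSet"
begin

section \<open>Categories, functors, natural transformations\<close>

text \<open>Morphisms built from a source, a target and underlying data.\<close>

datatype ('x, 'h) mor = Mor (src: 'x) (tgt: 'x) (und: 'h)

record ('o, 'a) cat =
  Obj :: "'o set"
  Arr :: "'a set"
  Dom :: "'a \<Rightarrow> 'o"
  Cod :: "'a \<Rightarrow> 'o"
  Id :: "'o \<Rightarrow> 'a"
  Comp :: "'a \<Rightarrow> 'a \<Rightarrow> 'a"

abbreviation cat_comp :: "'a \<Rightarrow> ('o, 'a) cat \<Rightarrow> 'a \<Rightarrow> 'a" ("(_ \<cdot>\<^bsub>_\<^esub> _)" [56, 0, 55] 55)
  where "g \<cdot>\<^bsub>C\<^esub> f \<equiv> Comp C g f"

definition hom :: "('o, 'a) cat \<Rightarrow> 'o \<Rightarrow> 'o \<Rightarrow> 'a set" where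
  "hom C x y = {f \<in> Arr C. Dom C f = x \<and> Cod C f = y}"

locale category =
  fixes C :: "('o, 'a) cat"
  assumes Dom_Obj: "f \<in> Arr C \<Longrightarrow> Dom C f \<in> Obj C"
    and Cod_Obj: "f \<in> Arr C \<Longrightarrow> Cod C f \<in> Obj C"
    and Id_hom: "x \<in> Obj C \<Longrightarrow> Id C x \<in> hom C x x"
    and Comp_hom: "\<lbrakk>f \<in> hom C x y; g \<in> hom C y z\<rbrakk> \<Longrightarrow> g \<cdot>\<^bsub>C\<^esub> f \<in> hom C x z"
    and Comp_assoc: "\<lbrakk>f \<in> hom C w x; g \<in> hom C x y; h \<in> hom C y z\<rbrakk>
      \<Longrightarrow> (h \<cdot>\<^bsub>C\<^esub> g) \<cdot>\<^bsub>C\<^esub> f = h \<cdot>\<^bsub>C\<^esub> (g \<cdot>\<^bsub>C\<^esub> f)"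
    and Comp_Id: "f \<in> hom C x y \<Longrightarrow> f \<cdot>\<^bsub>C\<^esub> Id C x = f"
    and Id_Comp: "f \<in> hom C x y \<Longrightarrow> Id C y \<cdot>\<^bsub>C\<^esub> f = f"

record ('o, 'a, 'p, 'b) fctr =
  fobj :: "'o \<Rightarrow> 'p"
  farr :: "'a \<Rightarrow> 'b"

definition is_functor :: "('o, 'a) cat \<Rightarrow> ('p, 'b) cat \<Rightarrow> ('o, 'a, 'p, 'b) fctr \<Rightarrow> bool" where
  "is_functor C D F \<longleftrightarrow>
    (\<forall>x\<in>Obj C. fobj F x \<in> Obj D) \<and>
    (\<forall>f\<in>Arr C. farr F f \<in> hom D (fobj F (Dom C f)) (fobj F (Cod C f))) \<and>
    (\<forall>x\<in>Obj C. farr F (Id C x) = Id D (fobj F x)) \<and>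
    (\<forall>f\<in>Arr C. \<forall>g\<in>Arr C. Cod C f = Dom C g \<longrightarrow>
      farr F (g \<cdot>\<^bsub>C\<^esub> f) = farr F g \<cdot>\<^bsub>D\<^esub> farr F f)"

definition id_functor :: "('o, 'a, 'o, 'a) fctr" where
  "id_functor = \<lparr>fobj = (\<lambda>x. x), farr = (\<lambda>f. f)\<rparr>"

definition fun_comp :: "('p, 'b, 'q, 'c) fctr \<Rightarrow> ('o, 'a, 'p, 'b) fctr \<Rightarrow> ('o, 'a, 'q, 'c) fctr" where
  "fun_comp G F = \<lparr>fobj = (\<lambda>x. fobj G (fobj F x)), farr = (\<lambda>f. farr G (farr F f))\<rparr>"

definition nat_trans ::
  "('o, 'a) cat \<Rightarrow> ('p, 'b) cat \<Rightarrow> ('o, 'a, 'p, 'b) fctr \<Rightarrow> ('o, 'a, 'p, 'b) fctr \<Rightarrow> ('o \<Rightarrow> 'b) \<Rightarrow> bool"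
  where
  "nat_trans C D F G \<tau> \<longleftrightarrow>
    is_functor C D F \<and> is_functor C D G \<and>
    (\<forall>x\<in>Obj C. \<tau> x \<in> hom D (fobj F x) (fobj G x)) \<and>
    (\<forall>f\<in>Arr C. farr G f \<cdot>\<^bsub>D\<^esub> \<tau> (Dom C f) = \<tau> (Cod C f) \<cdot>\<^bsub>D\<^esub> farr F f)"

definition has_right_adjoint ::
  "('o, 'a) cat \<Rightarrow> ('p, 'b) cat \<Rightarrow> ('o, 'a, 'p, 'b) fctr \<Rightarrow> bool" where
  "has_right_adjoint C D F \<longleftrightarrow>
    (\<exists>G \<eta> \<epsilon>.
      nat_trans C C id_functor (fun_comp G F) \<eta> \<and>
      nat_trans D D (fun_comp F G) id_functor \<epsilon> \<and>
      (\<forall>x\<in>Obj C. \<epsilon> (fobj F x) \<cdot>\<^bsub>D\<^esub> farr F (\<eta> x) = Id D (fobj F x)) \<and>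
      (\<forall>y\<in>Obj D. farr G (\<epsilon> y) \<cdot>\<^bsub>C\<^esub> \<eta> (fobj G y) = Id C (fobj G y)) \<and>
      is_functor C D F \<and> is_functor D C G)"

definition op_cat :: "('o, 'a) cat \<Rightarrow> ('o, 'a) cat" where
  "op_cat C = C\<lparr>Dom := Cod C, Cod := Dom C, Comp := (\<lambda>g f. Comp C f g)\<rparr>"

text \<open>Functors and transformations are made extensional here, so that equality of objects and of
  morphisms in the functor category depends only on their values on \<open>C\<close>.\<close>

definition fun_cat :: "('o, 'a) cat \<Rightarrow> ('p, 'b) cat \<Rightarrow>
    (('o, 'a, 'p, 'b) fctr, (('o, 'a, 'p, 'b) fctr, 'o \<Rightarrow> 'b) mor) cat" where
  "fun_cat C D =
    (let Ob = {F. is_functor C D F \<and> fobj F \<in> extensional (Obj C) \<and> farr F \<in> extensional (Arr C)}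
     in \<lparr>Obj = Ob,
         Arr = {\<tau>. src \<tau> \<in> Ob \<and> tgt \<tau> \<in> Ob \<and> nat_trans C D (src \<tau>) (tgt \<tau>) (und \<tau>) \<and>
                   und \<tau> \<in> extensional (Obj C)},
         Dom = src,
         Cod = tgt,
         Id = (\<lambda>F. Mor F F (\<lambda>x\<in>Obj C. Id D (fobj F x))),
         Comp = (\<lambda>\<tau> \<sigma>. Mor (src \<sigma>) (tgt \<tau>) (\<lambda>x\<in>Obj C. und \<tau> x \<cdot>\<^bsub>D\<^esub> und \<sigma> x))\<rparr>)"

definition full_sub :: "('o, 'a) cat \<Rightarrow> 'o set \<Rightarrow> ('o, 'a) cat" where
  "full_sub C S = C\<lparr>Obj := Obj C \<inter> S, Arr := {f \<in> Arr C. Dom C f \<in> S \<and> Cod C f \<in> S}\<rparr>"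

definition sum_cat :: "('o, 'a) cat \<Rightarrow> ('p, 'b) cat \<Rightarrow> ('o + 'p, 'a + 'b) cat" where
  "sum_cat C D =
    \<lparr>Obj = Obj C <+> Obj D,
     Arr = Arr C <+> Arr D,
     Dom = map_sum (Dom C) (Dom D),
     Cod = map_sum (Cod C) (Cod D),
     Id = map_sum (Id C) (Id D),
     Comp = (\<lambda>g f. case (g, f) of
        (Inl g', Inl f') \<Rightarrow> Inl (g' \<cdot>\<^bsub>C\<^esub> f')
      | (Inr g', Inr f') \<Rightarrow> Inr (g' \<cdot>\<^bsub>D\<^esub> f')
      | _ \<Rightarrow> undefined)\<rparr>"

definition copair :: "('o, 'a, 'q, 'c) fctr \<Rightarrow> ('p, 'b, 'q, 'c) fctr \<Rightarrow> ('o + 'p, 'a + 'b, 'q, 'c) fctr"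
  where
  "copair F G = \<lparr>fobj = case_sum (fobj F) (fobj G), farr = case_sum (farr F) (farr G)\<rparr>"


section \<open>Monomorphisms, pullbacks, pushouts, initial objects\<close>

definition mono_arr :: "('o, 'a) cat \<Rightarrow> 'a \<Rightarrow> bool" where
  "mono_arr C m \<longleftrightarrow> m \<in> Arr C \<and>
    (\<forall>f\<in>Arr C. \<forall>g\<in>Arr C. Dom C f = Dom C g \<and> Cod C f = Dom C m \<and> Cod C g = Dom C m \<and>
      m \<cdot>\<^bsub>C\<^esub> f = m \<cdot>\<^bsub>C\<^esub> g \<longrightarrow> f = g)"

definition initial_obj :: "('o, 'a) cat \<Rightarrow> 'o \<Rightarrow> bool" where
  "initial_obj C z \<longleftrightarrow> z \<in> Obj C \<and> (\<forall>x\<in>Obj C. \<exists>!f. f \<in> hom C z x)"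

definition comm_sq :: "('o, 'a) cat \<Rightarrow> 'a \<Rightarrow> 'a \<Rightarrow> 'a \<Rightarrow> 'a \<Rightarrow> bool" where
  "comm_sq C a m n b \<longleftrightarrow>
    m \<in> Arr C \<and> n \<in> Arr C \<and> a \<in> hom C (Dom C m) (Dom C n) \<and> b \<in> hom C (Cod C m) (Cod C n) \<and>
    n \<cdot>\<^bsub>C\<^esub> a = b \<cdot>\<^bsub>C\<^esub> m"

text \<open>In \<open>is_pullback C a m n b\<close> and \<open>comm_sq C a m n b\<close> the arrow \<open>a\<close> is the top, \<open>m\<close> the left,
  \<open>n\<close> the right and \<open>b\<close> the bottom side; the square is also a morphism \<open>(a, b)\<close> from \<open>m\<close> to \<open>n\<close> in
  the arrow category.\<close>

definition is_pullback :: "('o, 'a) cat \<Rightarrow> 'a \<Rightarrow> 'a \<Rightarrow> 'a \<Rightarrow> 'a \<Rightarrow> bool" where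
  "is_pullback C a m n b \<longleftrightarrow> comm_sq C a m n b \<and>
    (\<forall>a' m'. comm_sq C a' m' n b \<longrightarrow>
      (\<exists>!h. h \<in> hom C (Dom C m') (Dom C m) \<and> a \<cdot>\<^bsub>C\<^esub> h = a' \<and> m \<cdot>\<^bsub>C\<^esub> h = m'))"

text \<open>\<open>is_pushout C f g p q\<close>: the cospan \<open>(p, q)\<close> is a pushout of the span \<open>(f, g)\<close>, with
  \<open>p \<circ> f = q \<circ> g\<close>.\<close>

definition is_pushout :: "('o, 'a) cat \<Rightarrow> 'a \<Rightarrow> 'a \<Rightarrow> 'a \<Rightarrow> 'a \<Rightarrow> bool" where
  "is_pushout C f g p q \<longleftrightarrow> comm_sq C f g p q \<and>
    (\<forall>p' q'. comm_sq C f g p' q' \<longrightarrow>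
      (\<exists>!h. h \<in> hom C (Cod C p) (Cod C p') \<and> h \<cdot>\<^bsub>C\<^esub> p = p' \<and> h \<cdot>\<^bsub>C\<^esub> q = q'))"

definition preserves_pullbacks ::
  "('o, 'a) cat \<Rightarrow> ('p, 'b) cat \<Rightarrow> ('o, 'a, 'p, 'b) fctr \<Rightarrow> bool" where
  "preserves_pullbacks C D F \<longleftrightarrow>
    (\<forall>a m n b. is_pullback C a m n b \<longrightarrow>
      is_pullback D (farr F a) (farr F m) (farr F n) (farr F b))"

definition cartesian_nat_trans ::
  "('o, 'a) cat \<Rightarrow> ('p, 'b) cat \<Rightarrow> ('o, 'a, 'p, 'b) fctr \<Rightarrow> ('o, 'a, 'p, 'b) fctr \<Rightarrow> ('o \<Rightarrow> 'b) \<Rightarrow> bool"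
  where
  "cartesian_nat_trans C D F G \<tau> \<longleftrightarrow> nat_trans C D F G \<tau> \<and>
    (\<forall>f\<in>Arr C. is_pullback D (\<tau> (Dom C f)) (farr F f) (farr G f) (\<tau> (Cod C f)))"


section \<open>The arrow category and its cartesian subcategory\<close>

definition arrow_cat :: "('o, 'a) cat \<Rightarrow> ('a, ('a, 'a \<times> 'a) mor) cat" where
  "arrow_cat E =
    \<lparr>Obj = Arr E,
     Arr = {s. comm_sq E (fst (und s)) (src s) (tgt s) (snd (und s))},
     Dom = src,
     Cod = tgt,
     Id = (\<lambda>m. Mor m m (Id E (Dom E m), Id E (Cod E m))),
     Comp = (\<lambda>s r. Mor (src r) (tgt s)
        (fst (und s) \<cdot>\<^bsub>E\<^esub> fst (und r), snd (und s) \<cdot>\<^bsub>E\<^esub> snd (und r)))\<rparr>"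

definition cart_arrow_cat :: "('o, 'a) cat \<Rightarrow> ('a, ('a, 'a \<times> 'a) mor) cat" where
  "cart_arrow_cat E = (arrow_cat E)
    \<lparr>Arr := {s. is_pullback E (fst (und s)) (src s) (tgt s) (snd (und s))}\<rparr>"


section \<open>Smallness, sets and presheaves\<close>

text \<open>The universe of sets is given by a type \<open>'v\<close>: a set (over any type) is small if its
  cardinality is strictly below that of \<open>'v\<close>, and \<open>is_universe\<close> says that the cardinality of \<open>'v\<close>
  is an infinite regular strong limit. For uncountable \<open>'v\<close> this is strong inaccessibility, i.e.
  the small sets form a Grothendieck universe; for countable \<open>'v\<close> they are the finite sets.\<close>

definition small :: "'v itself \<Rightarrow> 'x set \<Rightarrow> bool" where
  "small V A \<longleftrightarrow> (card_of A, card_of (UNIV :: 'v set)) \<in> ordLess"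

definition is_universe :: "'v itself \<Rightarrow> bool" where
  "is_universe V \<longleftrightarrow>
    infinite (UNIV :: 'v set) \<and>
    (\<forall>A :: 'v set. small V A \<longrightarrow> small V (Pow A)) \<and>
    (\<forall>(A :: 'v set) (B :: 'v \<Rightarrow> 'v set).
      small V A \<and> (\<forall>a\<in>A. small V (B a)) \<longrightarrow> small V (\<Union>a\<in>A. B a))"

definition set_cat :: "('v set, ('v set, 'v \<Rightarrow> 'v) mor) cat" where
  "set_cat =
    \<lparr>Obj = {A. small TYPE('v) A},
     Arr = {f. small TYPE('v) (src f) \<and> small TYPE('v) (tgt f) \<and> und f \<in> src f \<rightarrow>\<^sub>E tgt f},
     Dom = src,
     Cod = tgt,
     Id = (\<lambda>A. Mor A A (\<lambda>x\<in>A. x)),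
     Comp = (\<lambda>g f. Mor (src f) (tgt g) (\<lambda>x\<in>src f. und g (und f x)))\<rparr>"

type_synonym ('o, 'm, 'v) psh = "('o, 'm, 'v set, ('v set, 'v \<Rightarrow> 'v) mor) fctr"

type_synonym ('o, 'm, 'v) psh_map =
  "(('o, 'm, 'v) psh, 'o \<Rightarrow> ('v set, 'v \<Rightarrow> 'v) mor) mor"

definition Psh :: "('o, 'm) cat \<Rightarrow> (('o, 'm, 'v) psh, ('o, 'm, 'v) psh_map) cat" where
  "Psh C = fun_cat (op_cat C) set_cat"

text \<open>\<open>\<theta>\<close> is a natural isomorphism from \<open>hom C - c\<close> to \<open>F\<close>; it is spelled out because the
  hom-sets of \<open>C\<close> need not be sets over the type \<open>'v\<close>.\<close>

definition representable :: "('o, 'm) cat \<Rightarrow> ('o, 'm, 'v) psh \<Rightarrow> bool" where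
  "representable C F \<longleftrightarrow> F \<in> Obj (Psh C) \<and>
    (\<exists>c\<in>Obj C. \<exists>\<theta>.
      (\<forall>d\<in>Obj C. bij_betw (\<theta> d) (hom C d c) (fobj F d)) \<and>
      (\<forall>g\<in>Arr C. \<forall>f\<in>hom C (Cod C g) c.
        \<theta> (Dom C g) (f \<cdot>\<^bsub>C\<^esub> g) = und (farr F g) (\<theta> (Cod C g) f)))"


section \<open>Colimits\<close>

definition is_cocone ::
  "('j, 'k) cat \<Rightarrow> ('o, 'a) cat \<Rightarrow> ('j, 'k, 'o, 'a) fctr \<Rightarrow> 'o \<Rightarrow> ('j \<Rightarrow> 'a) \<Rightarrow> bool" where
  "is_cocone J C D x l \<longleftrightarrow> x \<in> Obj C \<and>
    (\<forall>j\<in>Obj J. l j \<in> hom C (fobj D j) x) \<and>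
    (\<forall>s\<in>Arr J. l (Cod J s) \<cdot>\<^bsub>C\<^esub> farr D s = l (Dom J s))"

definition is_colimit ::
  "('j, 'k) cat \<Rightarrow> ('o, 'a) cat \<Rightarrow> ('j, 'k, 'o, 'a) fctr \<Rightarrow> 'o \<Rightarrow> ('j \<Rightarrow> 'a) \<Rightarrow> bool" where
  "is_colimit J C D x l \<longleftrightarrow> is_cocone J C D x l \<and>
    (\<forall>y r. is_cocone J C D y r \<longrightarrow>
      (\<exists>!h. h \<in> hom C x y \<and> (\<forall>j\<in>Obj J. h \<cdot>\<^bsub>C\<^esub> l j = r j)))"

definition small_category :: "'v itself \<Rightarrow> ('o, 'a) cat \<Rightarrow> bool" where
  "small_category V C \<longleftrightarrow> category C \<and> small V (Obj C) \<and> small V (Arr C)"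

text \<open>Index categories with objects and arrows in \<open>'v\<close> suffice, since every small category is
  isomorphic to such a one.\<close>

definition has_colimits :: "'v itself \<Rightarrow> ('o, 'a) cat \<Rightarrow> bool" where
  "has_colimits V C \<longleftrightarrow>
    (\<forall>(J :: ('v, 'v) cat) D. small_category V J \<and> is_functor J C D \<longrightarrow>
      (\<exists>x l. is_colimit J C D x l))"

definition preserves_colimits ::
  "'v itself \<Rightarrow> ('o, 'a) cat \<Rightarrow> ('p, 'b) cat \<Rightarrow> ('o, 'a, 'p, 'b) fctr \<Rightarrow> bool" where
  "preserves_colimits V C C' F \<longleftrightarrow>
    (\<forall>(J :: ('v, 'v) cat) D x l. small_category V J \<and> is_functor J C D \<and> is_colimit J C D x l \<longrightarrow>
      is_colimit J C' (fun_comp F D) (fobj F x) (\<lambda>j. farr F (l j)))"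


section \<open>Functorial cylinders\<close>

text \<open>The endpoint inclusions \<open>\<delta> k\<close> and connections \<open>c k\<close> are indexed by \<open>k \<in> {0, 1}\<close>; other
  indices are irrelevant.\<close>

definition functorial_cylinder ::
  "('o, 'a) cat \<Rightarrow> ('o, 'a, 'o, 'a) fctr \<Rightarrow> (nat \<Rightarrow> 'o \<Rightarrow> 'a) \<Rightarrow> bool" where
  "functorial_cylinder E I \<delta> \<longleftrightarrow>
    is_functor E E I \<and> (\<forall>k\<in>{0, 1}. nat_trans E E id_functor I (\<delta> k))"

definition contractions ::
  "('o, 'a) cat \<Rightarrow> ('o, 'a, 'o, 'a) fctr \<Rightarrow> (nat \<Rightarrow> 'o \<Rightarrow> 'a) \<Rightarrow> ('o \<Rightarrow> 'a) \<Rightarrow> bool" where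
  "contractions E I \<delta> \<epsilon> \<longleftrightarrow>
    nat_trans E E I id_functor \<epsilon> \<and>
    (\<forall>k\<in>{0, 1}. \<forall>X\<in>Obj E. \<epsilon> X \<cdot>\<^bsub>E\<^esub> \<delta> k X = Id E X)"

definition connections ::
  "('o, 'a) cat \<Rightarrow> ('o, 'a, 'o, 'a) fctr \<Rightarrow> (nat \<Rightarrow> 'o \<Rightarrow> 'a) \<Rightarrow> ('o \<Rightarrow> 'a) \<Rightarrow> (nat \<Rightarrow> 'o \<Rightarrow> 'a) \<Rightarrow> bool"
  where
  "connections E I \<delta> \<epsilon> c \<longleftrightarrow>
    (\<forall>k\<in>{0, 1}.
      nat_trans E E (fun_comp I I) I (c k) \<and>
      (\<forall>X\<in>Obj E.
        c k X \<cdot>\<^bsub>E\<^esub> \<delta> k (fobj I X) = \<delta> k X \<cdot>\<^bsub>E\<^esub> \<epsilon> X \<and>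
        c k X \<cdot>\<^bsub>E\<^esub> farr I (\<delta> k X) = \<delta> k X \<cdot>\<^bsub>E\<^esub> \<epsilon> X \<and>
        c k X \<cdot>\<^bsub>E\<^esub> \<delta> (1 - k) (fobj I X) = Id E (fobj I X) \<and>
        c k X \<cdot>\<^bsub>E\<^esub> farr I (\<delta> (1 - k) X) = Id E (fobj I X)))"


section \<open>Leibniz product with an endpoint inclusion\<close>

text \<open>\<open>d\<close> is a natural transformation \<open>Id \<rightarrow> I\<close>. A pushout of \<open>d A\<close> and \<open>i : A \<rightarrow> B\<close> is chosen once
  and for all; \<open>po_cyl\<close> and \<open>po_base\<close> are its coprojections from \<open>I A\<close> and from \<open>B\<close>.\<close>

definition chosen_pushout ::
  "('o, 'a) cat \<Rightarrow> ('o \<Rightarrow> 'a) \<Rightarrow> 'a \<Rightarrow> 'a \<times> 'a" where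
  "chosen_pushout E d i = (SOME (p, q). is_pushout E (d (Dom E i)) i p q)"

definition po_cyl :: "('o, 'a) cat \<Rightarrow> ('o \<Rightarrow> 'a) \<Rightarrow> 'a \<Rightarrow> 'a" where
  "po_cyl E d i = fst (chosen_pushout E d i)"

definition po_base :: "('o, 'a) cat \<Rightarrow> ('o \<Rightarrow> 'a) \<Rightarrow> 'a \<Rightarrow> 'a" where
  "po_base E d i = snd (chosen_pushout E d i)"

definition leibniz ::
  "('o, 'a) cat \<Rightarrow> ('o, 'a, 'o, 'a) fctr \<Rightarrow> ('o \<Rightarrow> 'a) \<Rightarrow> 'a \<Rightarrow> 'a" where
  "leibniz E I d i =
    (THE h. h \<in> hom E (Cod E (po_cyl E d i)) (fobj I (Cod E i)) \<and>
      h \<cdot>\<^bsub>E\<^esub> po_cyl E d i = farr I i \<and>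
      h \<cdot>\<^bsub>E\<^esub> po_base E d i = d (Cod E i))"

definition leibniz_sq ::
  "('o, 'a) cat \<Rightarrow> ('o, 'a, 'o, 'a) fctr \<Rightarrow> ('o \<Rightarrow> 'a) \<Rightarrow> ('a, 'a \<times> 'a) mor \<Rightarrow> ('a, 'a \<times> 'a) mor" where
  "leibniz_sq E I d s =
    (let i = src s; j = tgt s; a = fst (und s); b = snd (und s)
     in Mor (leibniz E I d i) (leibniz E I d j)
       ((THE h. h \<in> hom E (Cod E (po_cyl E d i)) (Cod E (po_cyl E d j)) \<and>
           h \<cdot>\<^bsub>E\<^esub> po_cyl E d i = po_cyl E d j \<cdot>\<^bsub>E\<^esub> farr I a \<and>
           h \<cdot>\<^bsub>E\<^esub> po_base E d i = po_base E d j \<cdot>\<^bsub>E\<^esub> b),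
        farr I b))"

definition leibniz_functor ::
  "('o, 'a) cat \<Rightarrow> ('o, 'a, 'o, 'a) fctr \<Rightarrow> ('o \<Rightarrow> 'a) \<Rightarrow>
    ('a, ('a, 'a \<times> 'a) mor, 'a, ('a, 'a \<times> 'a) mor) fctr" where
  "leibniz_functor E I d = \<lparr>fobj = leibniz E I d, farr = leibniz_sq E I d\<rparr>"


section \<open>Lifting properties and uniform lifting structures\<close>

definition has_rlp :: "('o, 'a) cat \<Rightarrow> 'a \<Rightarrow> 'a \<Rightarrow> bool" where
  "has_rlp E m f \<longleftrightarrow>
    (\<forall>s t. comm_sq E s m f t \<longrightarrow>
      (\<exists>h\<in>hom E (Cod E m) (Dom E f). h \<cdot>\<^bsub>E\<^esub> m = s \<and> f \<cdot>\<^bsub>E\<^esub> h = t))"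

definition right_map_structure ::
  "('o, 'a) cat \<Rightarrow> ('j, 'k) cat \<Rightarrow> ('j, 'k, 'a, ('a, 'a \<times> 'a) mor) fctr \<Rightarrow> 'a \<Rightarrow>
    ('j \<Rightarrow> 'a \<Rightarrow> 'a \<Rightarrow> 'a) \<Rightarrow> bool" where
  "right_map_structure E J u f \<phi> \<longleftrightarrow>
    (\<forall>j\<in>Obj J. \<forall>s t. comm_sq E s (fobj u j) f t \<longrightarrow>
      \<phi> j s t \<in> hom E (Cod E (fobj u j)) (Dom E f) \<and>
      \<phi> j s t \<cdot>\<^bsub>E\<^esub> fobj u j = s \<and>
      f \<cdot>\<^bsub>E\<^esub> \<phi> j s t = t) \<and>
    (\<forall>\<sigma>\<in>Arr J. \<forall>s t a b.
      und (farr u \<sigma>) = (a, b) \<and> comm_sq E s (fobj u (Cod J \<sigma>)) f t \<longrightarrow>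
      \<phi> (Cod J \<sigma>) s t \<cdot>\<^bsub>E\<^esub> b = \<phi> (Dom J \<sigma>) (s \<cdot>\<^bsub>E\<^esub> a) (t \<cdot>\<^bsub>E\<^esub> b))"

definition right_map ::
  "('o, 'a) cat \<Rightarrow> ('j, 'k) cat \<Rightarrow> ('j, 'k, 'a, ('a, 'a \<times> 'a) mor) fctr \<Rightarrow> 'a \<Rightarrow> bool" where
  "right_map E J u f \<longleftrightarrow> f \<in> Arr E \<and> (\<exists>\<phi>. right_map_structure E J u f \<phi>)"


section \<open>(Uniform) trivial fibrations and fibrations\<close>

text \<open>The full subcategory \<open>\<M>\<close> of the cartesian arrow category is given by its set of objects
  \<open>M\<close>; inclusions of subcategories are \<open>id_functor\<close>.\<close>

definition trivial_fibration :: "('o, 'a) cat \<Rightarrow> 'a set \<Rightarrow> 'a \<Rightarrow> bool" where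
  "trivial_fibration E M f \<longleftrightarrow> f \<in> Arr E \<and> (\<forall>m\<in>M. has_rlp E m f)"

definition fibration ::
  "('o, 'a) cat \<Rightarrow> ('o, 'a, 'o, 'a) fctr \<Rightarrow> (nat \<Rightarrow> 'o \<Rightarrow> 'a) \<Rightarrow> 'a set \<Rightarrow> 'a \<Rightarrow> bool" where
  "fibration E I \<delta> M f \<longleftrightarrow>
    f \<in> Arr E \<and> (\<forall>k\<in>{0, 1}. \<forall>i\<in>M. has_rlp E (leibniz E I (\<delta> k) i) f)"

definition uniform_trivial_fibration :: "('o, 'a) cat \<Rightarrow> 'a set \<Rightarrow> 'a \<Rightarrow> bool" where
  "uniform_trivial_fibration E M f \<longleftrightarrow>
    right_map E (full_sub (cart_arrow_cat E) M) id_functor f"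

definition rep_cat :: "('o, 'm) cat \<Rightarrow> ('o, 'm, 'v) psh_map set \<Rightarrow>
    (('o, 'm, 'v) psh_map, (('o, 'm, 'v) psh_map, ('o, 'm, 'v) psh_map \<times> ('o, 'm, 'v) psh_map) mor) cat"
  where
  "rep_cat C M =
    full_sub (full_sub (cart_arrow_cat (Psh C)) M) {m. representable C (Cod (Psh C) m)}"

definition uniform_fibration :: "('o, 'm) cat \<Rightarrow>
    (('o, 'm, 'v) psh, ('o, 'm, 'v) psh_map, ('o, 'm, 'v) psh, ('o, 'm, 'v) psh_map) fctr \<Rightarrow>
    (nat \<Rightarrow> ('o, 'm, 'v) psh \<Rightarrow> ('o, 'm, 'v) psh_map) \<Rightarrow>
    ('o, 'm, 'v) psh_map set \<Rightarrow> ('o, 'm, 'v) psh_map \<Rightarrow> bool" where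
  "uniform_fibration C I \<delta> M f \<longleftrightarrow>
    right_map (Psh C) (sum_cat (rep_cat C M) (rep_cat C M))
      (copair (fun_comp (leibniz_functor (Psh C) I (\<delta> 0)) id_functor)
              (fun_comp (leibniz_functor (Psh C) I (\<delta> 1)) id_functor)) f"

end

theory Submission
  imports Defs
begin

text \<open>
  A lifting property only asks that lifts exist; a uniform structure asks for lifts chosen compatibly
  with pullback squares. The two agree because all lifting problems against a fixed map are restrictions
  of a single one.

  The class \<open>M\<close> is local: a monomorphism \<open>m\<close> into \<open>B\<close> belongs to it as soon as all its restrictions to
  the elements of \<open>B\<close> do (\<open>M_local\<close>). These restrictions form a diagram of pullback squares over the
  category of elements of \<open>B\<close>. A colimit of it in \<open>M\<close> is a map \<open>n \<in> M\<close> together with a cocone of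
  pullback squares, and the bottom sides of the cocone induce a map from \<open>B\<close> to the codomain of \<open>n\<close>
  along which \<open>n\<close> pulls back to \<open>m\<close>. Hence membership in \<open>M\<close> is decided by the sieves that \<open>m\<close>
  induces on the representables (\<open>M_sieve_local\<close>).

  Given \<open>f : X \<rightarrow> Y\<close>, let \<open>T\<close> be the presheaf whose elements over \<open>c\<close> are an element \<open>y\<close> of \<open>Y\<close> and a
  partial section of \<open>f\<close> over \<open>y\<close>, defined on a sieve that comes from \<open>M\<close>. The sections that are defined
  everywhere form a subobject of \<open>T\<close>, which is in \<open>M\<close> by locality, and it poses a tautological lifting
  problem against \<open>f\<close>. A square from any \<open>m : A \<rightarrow> B\<close> in \<open>M\<close> to \<open>f\<close> amounts to a map \<open>B \<rightarrow> T\<close>, and this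
  correspondence respects pullback squares. So one lift against the universal problem, composed with
  these maps, is a uniform structure (\<open>rlp_uniform_lifts\<close>); this is the substance of the statement
  about trivial fibrations. Conversely, uniform lifts against the maps of \<open>M\<close> with representable codomain
  glue, by the Yoneda lemma, to a lift against any map of \<open>M\<close> (\<open>uniform_lifts_glue\<close>).

  The statement about fibrations is reduced to this by transposition. Let \<open>G\<close> be the right adjoint of \<open>I\<close>.
  Squares from the Leibniz product of an endpoint inclusion with \<open>i\<close> to \<open>f\<close> correspond to squares from
  \<open>i\<close> to the Leibniz exponential \<open>G X \<rightarrow> X \<times>\<^sub>Y G Y\<close> of \<open>f\<close>, with the same fillers up to transposition
  and compatibly with squares in \<open>i\<close> (\<open>leibniz_rlp_iff\<close>, \<open>leibniz_lifts_iff\<close>). So \<open>f\<close> is a fibration,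
  respectively a uniform fibration, iff its Leibniz exponentials for both endpoints lift, respectively
  lift uniformly, against \<open>M\<close>, respectively against the maps of \<open>M\<close> with representable codomain. The
  pushouts in the Leibniz products exist as unions of subobjects (\<open>ex_leibniz_pushout\<close>).
\<close>


section \<open>Small sets\<close>

lemma small_ordLeq:
  assumes "small V A" and "(card_of B, card_of A) \<in> ordLeq"
  shows "small V B"
  using assms ordLeq_ordLess_trans unfolding small_def by blast

lemma small_inj_on:
  assumes "small V A" "inj_on f B" "f ` B \<subseteq> A"
  shows "small V B"
  using assms card_of_ordLeq by (blast intro: small_ordLeq)

lemma small_subset: "small V A \<Longrightarrow> B \<subseteq> A \<Longrightarrow> small V B"
  by (rule small_ordLeq[OF _ card_of_mono1])

lemma small_image: "small V A \<Longrightarrow> small V (f ` A)"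
  by (rule small_ordLeq[OF _ card_of_image])

lemma small_encode:
  assumes "small TYPE('v) A"
  obtains f :: "'a \<Rightarrow> 'v" where "inj_on f A"
  using assms ordLess_imp_ordLeq card_of_ordLeq unfolding small_def by (metis)

lemma small_Pow:
  assumes "is_universe TYPE('v)" and A: "small TYPE('v) A"
  shows "small TYPE('v) (Pow A)"
proof -
  obtain f :: "'a \<Rightarrow> 'v" where f: "inj_on f A"
    using A by (rule small_encode)
  have "small TYPE('v) (Pow (f ` A))"
    using assms small_image[OF A, of f] unfolding is_universe_def by blast
  then show ?thesis
    by (rule small_inj_on[where f = "image f"]) (use f in \<open>auto intro: inj_on_image_Pow\<close>)
qed

lemma small_UN:
  fixes B :: "'i \<Rightarrow> 'v set"
  assumes U: "is_universe TYPE('v)" and A: "small TYPE('v) A" and B: "\<And>a. a \<in> A \<Longrightarrow> small TYPE('v) (B a)"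
  shows "small TYPE('v) (\<Union>a\<in>A. B a)"
proof -
  obtain f :: "'i \<Rightarrow> 'v" where f: "inj_on f A"
    using A by (rule small_encode)
  have "small TYPE('v) (\<Union>v\<in>f ` A. B (inv_into A f v))"
    using U small_image[OF A, of f] B f unfolding is_universe_def
    by (metis (no_types, lifting) inv_into_into)
  moreover have "(\<Union>v\<in>f ` A. B (inv_into A f v)) = (\<Union>a\<in>A. B a)"
    using f by simp
  ultimately show ?thesis by simp
qed

lemma small_Times:
  assumes U: "is_universe TYPE('v)" and A: "small TYPE('v) A" and B: "small TYPE('v) B"
  shows "small TYPE('v) (A \<times> B)"
proof -
  obtain f :: "'a \<Rightarrow> 'v" where f: "inj_on f A"
    using A by (rule small_encode)
  obtain g :: "'b \<Rightarrow> 'v" where g: "inj_on g B"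
    using B by (rule small_encode)
  have "(card_of (UNIV \<times> UNIV :: ('v \<times> 'v) set), card_of (UNIV :: 'v set)) \<in> ordIso"
    using U unfolding is_universe_def UNIV_Times_UNIV[symmetric]
    by (intro card_of_Times_same_infinite) simp
  then obtain p :: "'v \<times> 'v \<Rightarrow> 'v" where p: "bij_betw p (UNIV \<times> UNIV) UNIV"
    using card_of_ordIso by blast
  have "small TYPE('v) (\<Union>a\<in>A. (\<lambda>b. p (f a, g b)) ` B)"
    using small_UN[OF U A] small_image[OF B] .
  then show ?thesis
  proof (rule small_inj_on)
    show "inj_on (\<lambda>(a, b). p (f a, g b)) (A \<times> B)"
    proof (rule inj_onI, clarify)
      fix a b a' b' assume h: "a \<in> A" "b \<in> B" "a' \<in> A" "b' \<in> B" "p (f a, g b) = p (f a', g b')"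
      then have "(f a, g b) = (f a', g b')"
        using p unfolding bij_betw_def inj_on_def by blast
      then show "a = a' \<and> b = b'"
        using h f g unfolding inj_on_def by blast
    qed
    show "(\<lambda>(a, b). p (f a, g b)) ` (A \<times> B) \<subseteq> (\<Union>a\<in>A. (\<lambda>b. p (f a, g b)) ` B)"
      by auto
  qed
qed


section \<open>Generalities on categories\<close>

lemma homD: "f \<in> hom C x y \<Longrightarrow> f \<in> Arr C \<and> Dom C f = x \<and> Cod C f = y"
  by (simp add: hom_def)

lemma comm_sqI:
  assumes "m \<in> hom C a b" "n \<in> hom C c d" "s \<in> hom C a c" "t \<in> hom C b d"
    "n \<cdot>\<^bsub>C\<^esub> s = t \<cdot>\<^bsub>C\<^esub> m"
  shows "comm_sq C s m n t"
  using assms unfolding comm_sq_def hom_def by auto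

lemma is_functor_hom:
  assumes "is_functor C D F" "f \<in> hom C x y"
  shows "farr F f \<in> hom D (fobj F x) (fobj F y)"
  using assms unfolding is_functor_def hom_def by auto

lemma is_functor_comp:
  assumes "is_functor C D F" "f \<in> hom C x y" "g \<in> hom C y z"
  shows "farr F (g \<cdot>\<^bsub>C\<^esub> f) = farr F g \<cdot>\<^bsub>D\<^esub> farr F f"
  using assms unfolding is_functor_def hom_def by auto


section \<open>Presheaves as families of sets with an action\<close>

definition act :: "('o, 'm, 'v) psh \<Rightarrow> 'm \<Rightarrow> 'v \<Rightarrow> 'v" where
  "act F g x = und (farr F g) x"

definition app :: "('o, 'm, 'v) psh_map \<Rightarrow> 'o \<Rightarrow> 'v \<Rightarrow> 'v" where
  "app \<alpha> c x = und (und \<alpha> c) x"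

text \<open>A map of presheaves has to be extensional in the object and in the element; this builds one
  from an arbitrary family of functions.\<close>

definition mk_map :: "('o, 'm) cat \<Rightarrow> ('o, 'm, 'v) psh \<Rightarrow> ('o, 'm, 'v) psh \<Rightarrow>
    ('o \<Rightarrow> 'v \<Rightarrow> 'v) \<Rightarrow> ('o, 'm, 'v) psh_map" where
  "mk_map C F G u = Mor F G (\<lambda>c\<in>Obj C. Mor (fobj F c) (fobj G c) (\<lambda>x\<in>fobj F c. u c x))"

locale presheaf_category =
  fixes C :: "('o, 'm) cat"
    and E :: "(('o, 'm, 'v) psh, ('o, 'm, 'v) psh_map) cat"
  assumes universe: "is_universe TYPE('v)"
    and C_small: "small_category TYPE('v) C"
    and E_Psh: "E = Psh C"
begin

abbreviation compose :: "('o, 'm, 'v) psh_map \<Rightarrow> ('o, 'm, 'v) psh_map \<Rightarrow> ('o, 'm, 'v) psh_map" (infixr "\<odot>" 55) where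
  "g \<odot> f \<equiv> g \<cdot>\<^bsub>E\<^esub> f"

sublocale C: category C
  using C_small unfolding small_category_def by blast

lemma Psh_Obj_iff: "F \<in> Obj E \<longleftrightarrow>
    (\<forall>c\<in>Obj C. small TYPE('v) (fobj F c)) \<and>
    (\<forall>g\<in>Arr C. src (farr F g) = fobj F (Cod C g) \<and> tgt (farr F g) = fobj F (Dom C g) \<and>
      und (farr F g) \<in> fobj F (Cod C g) \<rightarrow>\<^sub>E fobj F (Dom C g)) \<and>
    (\<forall>c\<in>Obj C. \<forall>x\<in>fobj F c. act F (Id C c) x = x) \<and>
    (\<forall>g\<in>Arr C. \<forall>h\<in>Arr C. Dom C g = Cod C h \<longrightarrow> (\<forall>x\<in>fobj F (Cod C g).
        act F (g \<cdot>\<^bsub>C\<^esub> h) x = act F h (act F g x))) \<and>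
    fobj F \<in> extensional (Obj C) \<and> farr F \<in> extensional (Arr C)"
  (is "?L \<longleftrightarrow> ?R")
proof
  assume L: ?L
  then have F: "is_functor (op_cat C) set_cat F"
    by (simp add: E_Psh Psh_def fun_cat_def Let_def)
  have 1: "\<forall>g\<in>Arr C. farr F g \<in> hom set_cat (fobj F (Cod C g)) (fobj F (Dom C g))"
    using F unfolding is_functor_def op_cat_def by simp
  have 2: "act F (Id C c) x = x" if "c \<in> Obj C" "x \<in> fobj F c" for c x
    using F that unfolding is_functor_def op_cat_def act_def by (simp add: set_cat_def)
  have 3: "act F (g \<cdot>\<^bsub>C\<^esub> h) x = act F h (act F g x)"
    if "g \<in> Arr C" "h \<in> Arr C" "Dom C g = Cod C h" "x \<in> fobj F (Cod C g)" for g h x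
    using F that 1 unfolding is_functor_def op_cat_def act_def by (simp add: set_cat_def hom_def)
  show ?R
    using L F 1 2 3 unfolding is_functor_def op_cat_def
    by (simp add: E_Psh Psh_def fun_cat_def Let_def hom_def set_cat_def op_cat_def)
next
  assume R: ?R
  then have ext: "und (farr F g) \<in> fobj F (Cod C g) \<rightarrow>\<^sub>E fobj F (Dom C g)" if "g \<in> Arr C" for g
    using that by blast
  have "farr F (Id C c) = Id set_cat (fobj F c)" if c: "c \<in> Obj C" for c
  proof -
    have "Id C c \<in> Arr C" "Cod C (Id C c) = c" "Dom C (Id C c) = c"
      using C.Id_hom[OF c] by (auto simp: hom_def)
    then have "und (farr F (Id C c)) = (\<lambda>x\<in>fobj F c. x)"
      using R c ext[of "Id C c"] unfolding act_def by (auto simp: PiE_def extensional_def fun_eq_iff)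
    then show ?thesis
      using R c \<open>Id C c \<in> Arr C\<close> \<open>Cod C (Id C c) = c\<close> \<open>Dom C (Id C c) = c\<close>
      by (simp add: set_cat_def mor.expand)
  qed
  moreover have "farr F (g \<cdot>\<^bsub>C\<^esub> h) = farr F h \<cdot>\<^bsub>set_cat\<^esub> farr F g"
    if "g \<in> Arr C" "h \<in> Arr C" "Dom C g = Cod C h" for g h
  proof -
    have gh: "g \<cdot>\<^bsub>C\<^esub> h \<in> Arr C" "Dom C (g \<cdot>\<^bsub>C\<^esub> h) = Dom C h" "Cod C (g \<cdot>\<^bsub>C\<^esub> h) = Cod C g"
      using C.Comp_hom[of h "Dom C h" "Dom C g" g "Cod C g"] that by (auto simp: hom_def)
    then have "und (farr F (g \<cdot>\<^bsub>C\<^esub> h)) = (\<lambda>x\<in>fobj F (Cod C g). und (farr F h) (und (farr F g) x))"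
      using R that ext[of "g \<cdot>\<^bsub>C\<^esub> h"] unfolding act_def by (auto simp: PiE_def extensional_def fun_eq_iff)
    then show ?thesis
      using R gh that by (simp add: set_cat_def mor.expand)
  qed
  ultimately have "is_functor (op_cat C) set_cat F"
    using R C.Dom_Obj C.Cod_Obj unfolding is_functor_def op_cat_def
    by (auto simp: set_cat_def hom_def)
  then show ?L
    using R by (simp add: E_Psh Psh_def fun_cat_def Let_def op_cat_def)
qed

lemma psh_small: "F \<in> Obj E \<Longrightarrow> c \<in> Obj C \<Longrightarrow> small TYPE('v) (fobj F c)"
  unfolding Psh_Obj_iff by blast

lemma act_in: "F \<in> Obj E \<Longrightarrow> g \<in> hom C d c \<Longrightarrow> x \<in> fobj F c \<Longrightarrow> act F g x \<in> fobj F d"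
  unfolding Psh_Obj_iff act_def hom_def by (auto simp: PiE_iff)

lemma act_Id: "F \<in> Obj E \<Longrightarrow> c \<in> Obj C \<Longrightarrow> x \<in> fobj F c \<Longrightarrow> act F (Id C c) x = x"
  unfolding Psh_Obj_iff by blast

lemma act_comp: "F \<in> Obj E \<Longrightarrow> g \<in> hom C d c \<Longrightarrow> h \<in> hom C e d \<Longrightarrow> x \<in> fobj F c \<Longrightarrow>
    act F (g \<cdot>\<^bsub>C\<^esub> h) x = act F h (act F g x)"
  unfolding Psh_Obj_iff hom_def by auto

definition encodes :: "('o \<Rightarrow> 'x set) \<Rightarrow> ('m \<Rightarrow> 'x \<Rightarrow> 'x) \<Rightarrow> ('o, 'm, 'v) psh \<Rightarrow>
    ('o \<Rightarrow> 'x \<Rightarrow> 'v) \<Rightarrow> ('o \<Rightarrow> 'v \<Rightarrow> 'x) \<Rightarrow> bool" where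
  "encodes S a F e i \<longleftrightarrow> F \<in> Obj E \<and>
    (\<forall>c\<in>Obj C. \<forall>x\<in>S c. e c x \<in> fobj F c \<and> i c (e c x) = x) \<and>
    (\<forall>c\<in>Obj C. \<forall>v\<in>fobj F c. i c v \<in> S c \<and> e c (i c v) = v) \<and>
    (\<forall>d c. \<forall>g\<in>hom C d c. \<forall>v\<in>fobj F c. i d (act F g v) = a g (i c v))"

lemma encodesD:
  assumes "encodes S a F e i"
  shows "F \<in> Obj E"
    "c \<in> Obj C \<Longrightarrow> x \<in> S c \<Longrightarrow> e c x \<in> fobj F c" "c \<in> Obj C \<Longrightarrow> x \<in> S c \<Longrightarrow> i c (e c x) = x"
    "c \<in> Obj C \<Longrightarrow> v \<in> fobj F c \<Longrightarrow> i c v \<in> S c" "c \<in> Obj C \<Longrightarrow> v \<in> fobj F c \<Longrightarrow> e c (i c v) = v"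
    "g \<in> hom C d c \<Longrightarrow> v \<in> fobj F c \<Longrightarrow> i d (act F g v) = a g (i c v)"
  using assms unfolding encodes_def by simp_all

lemma encodes_act:
  assumes E: "encodes S a F e i" and g: "g \<in> hom C d c" and x: "x \<in> S c"
  shows "act F g (e c x) = e d (a g x)"
proof -
  have oc: "d \<in> Obj C" "c \<in> Obj C" using g C.Dom_Obj C.Cod_Obj by (auto simp: hom_def)
  note ex = encodesD(2)[OF E oc(2) x]
  show ?thesis
    using encodesD(6)[OF E g ex] encodesD(3)[OF E oc(2) x]
      encodesD(5)[OF E oc(1) act_in[OF encodesD(1)[OF E] g ex]] by simp
qed

text \<open>Inject each set into \<open>'v\<close> and transport the action. All presheaves constructed below
  (representables, subobjects, pullbacks, the universal lifting problem) come from here, so their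
  elements may be described in whatever type is convenient.\<close>

lemma realize_presheaf:
  fixes S :: "'o \<Rightarrow> 'x set" and a :: "'m \<Rightarrow> 'x \<Rightarrow> 'x"
  assumes small: "\<And>c. c \<in> Obj C \<Longrightarrow> small TYPE('v) (S c)"
    and a_in: "\<And>d c g x. g \<in> hom C d c \<Longrightarrow> x \<in> S c \<Longrightarrow> a g x \<in> S d"
    and a_Id: "\<And>c x. c \<in> Obj C \<Longrightarrow> x \<in> S c \<Longrightarrow> a (Id C c) x = x"
    and a_comp: "\<And>c d e g h x. g \<in> hom C d c \<Longrightarrow> h \<in> hom C e d \<Longrightarrow> x \<in> S c \<Longrightarrow>
      a (g \<cdot>\<^bsub>C\<^esub> h) x = a h (a g x)"
  shows "\<exists>F e i. encodes S a F e i"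
proof -
  have "\<forall>c\<in>Obj C. \<exists>f :: 'x \<Rightarrow> 'v. inj_on f (S c)"
    using small small_encode by metis
  then obtain e :: "'o \<Rightarrow> 'x \<Rightarrow> 'v" where e: "\<And>c. c \<in> Obj C \<Longrightarrow> inj_on (e c) (S c)"
    by metis
  define F :: "('o, 'm, 'v) psh" where "F = \<lparr>fobj = (\<lambda>c\<in>Obj C. e c ` S c),
    farr = (\<lambda>g\<in>Arr C. Mor (e (Cod C g) ` S (Cod C g)) (e (Dom C g) ` S (Dom C g))
      (\<lambda>v\<in>e (Cod C g) ` S (Cod C g). e (Dom C g) (a g (inv_into (S (Cod C g)) (e (Cod C g)) v))))\<rparr>"
  have obj: "fobj F c = e c ` S c" if "c \<in> Obj C" for c
    using that by (simp add: F_def)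
  have ac: "act F g (e c x) = e d (a g x)" if "g \<in> hom C d c" "x \<in> S c" for d c g x
  proof -
    have "c \<in> Obj C" "g \<in> Arr C" "Cod C g = c" "Dom C g = d"
      using that C.Cod_Obj unfolding hom_def by auto
    then show ?thesis
      using that e by (simp add: F_def act_def)
  qed
  have h: "h \<in> hom C (Dom C h) (Cod C h) \<and> Dom C h \<in> Obj C \<and> Cod C h \<in> Obj C" if "h \<in> Arr C" for h
    using that C.Dom_Obj C.Cod_Obj by (simp add: hom_def)
  have "F \<in> Obj E"
    unfolding Psh_Obj_iff
  proof (intro conjI ballI impI)
    fix c assume "c \<in> Obj C"
    then show "small TYPE('v) (fobj F c)"
      using small small_image by (metis obj)
  next
    fix g assume g: "g \<in> Arr C"
    show "src (farr F g) = fobj F (Cod C g)" "tgt (farr F g) = fobj F (Dom C g)"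
      using g h[OF g] by (simp_all add: F_def)
    show "und (farr F g) \<in> fobj F (Cod C g) \<rightarrow>\<^sub>E fobj F (Dom C g)"
    proof
      fix x assume "x \<in> fobj F (Cod C g)"
      then show "und (farr F g) x \<in> fobj F (Dom C g)"
        using h[OF g] ac a_in unfolding act_def by (force simp: obj)
    next
      fix x assume "x \<notin> fobj F (Cod C g)"
      then show "und (farr F g) x = undefined"
        using g h[OF g] by (simp add: F_def)
    qed
  next
    fix c x assume "c \<in> Obj C" "x \<in> fobj F c"
    then show "act F (Id C c) x = x"
      using ac C.Id_hom a_Id by (force simp: obj)
  next
    fix g k x assume gk: "g \<in> Arr C" "k \<in> Arr C" "Dom C g = Cod C k" "x \<in> fobj F (Cod C g)"
    then obtain y where y: "x = e (Cod C g) y" "y \<in> S (Cod C g)"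
      using h by (force simp: obj)
    have g: "g \<in> hom C (Cod C k) (Cod C g)" and k: "k \<in> hom C (Dom C k) (Cod C k)"
      using gk by (auto simp: hom_def)
    then show "act F (g \<cdot>\<^bsub>C\<^esub> k) x = act F k (act F g x)"
      unfolding y(1) ac[OF C.Comp_hom[OF k g] y(2)] a_comp[OF g k y(2)] ac[OF g y(2)]
        ac[OF k a_in[OF g y(2)]] by simp
  qed (simp_all add: F_def)
  moreover have "inv_into (S d) (e d) (act F g v) = a g (inv_into (S c) (e c) v)"
    if g: "g \<in> hom C d c" and v: "v \<in> fobj F c" for d c g v
  proof -
    have oc: "d \<in> Obj C" "c \<in> Obj C" using g C.Dom_Obj C.Cod_Obj by (auto simp: hom_def)
    obtain x where x: "x \<in> S c" "v = e c x" using v obj[OF oc(2)] by auto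
    show ?thesis
      unfolding x(2) ac[OF g x(1)] using e[OF oc(1)] e[OF oc(2)] x(1) a_in[OF g x(1)] by simp
  qed
  moreover have "e c x \<in> fobj F c \<and> inv_into (S c) (e c) (e c x) = x" if "c \<in> Obj C" "x \<in> S c" for c x
    using e that by (simp add: obj)
  moreover have "inv_into (S c) (e c) v \<in> S c \<and> e c (inv_into (S c) (e c) v) = v"
    if "c \<in> Obj C" "v \<in> fobj F c" for c v
    using that inv_into_into[of v "e c" "S c"] f_inv_into_f[of v "e c" "S c"] by (simp add: obj)
  ultimately show ?thesis
    by (intro exI[of _ F] exI[of _ e] exI[of _ "\<lambda>c. inv_into (S c) (e c)"])
      (simp add: encodes_def)
qed

lemma hom_iff: "\<alpha> \<in> hom E F G \<longleftrightarrow> F \<in> Obj E \<and> G \<in> Obj E \<and> src \<alpha> = F \<and> tgt \<alpha> = G \<and>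
    und \<alpha> \<in> extensional (Obj C) \<and>
    (\<forall>c\<in>Obj C. src (und \<alpha> c) = fobj F c \<and> tgt (und \<alpha> c) = fobj G c \<and>
      und (und \<alpha> c) \<in> fobj F c \<rightarrow>\<^sub>E fobj G c) \<and>
    (\<forall>g\<in>Arr C. \<forall>x\<in>fobj F (Cod C g). act G g (app \<alpha> (Cod C g) x) = app \<alpha> (Dom C g) (act F g x))"
  (is "?L \<longleftrightarrow> ?R")
proof -
  have L: "?L \<longleftrightarrow> F \<in> Obj E \<and> G \<in> Obj E \<and> src \<alpha> = F \<and> tgt \<alpha> = G \<and>
      und \<alpha> \<in> extensional (Obj C) \<and> nat_trans (op_cat C) set_cat F G (und \<alpha>)"
    by (auto simp: E_Psh Psh_def fun_cat_def Let_def hom_def op_cat_def)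
  show ?thesis
  proof (cases "F \<in> Obj E \<and> G \<in> Obj E")
    case True
    then have fg: "is_functor (op_cat C) set_cat F" "is_functor (op_cat C) set_cat G"
      by (auto simp: E_Psh Psh_def fun_cat_def Let_def)
    have S: "small TYPE('v) (fobj F c)" "small TYPE('v) (fobj G c)" if "c \<in> Obj C" for c
      using True that psh_small by auto
    have eq: "farr G g \<cdot>\<^bsub>set_cat\<^esub> und \<alpha> (Cod C g) = und \<alpha> (Dom C g) \<cdot>\<^bsub>set_cat\<^esub> farr F g
        \<longleftrightarrow> (\<forall>x\<in>fobj F (Cod C g). act G g (app \<alpha> (Cod C g) x) = app \<alpha> (Dom C g) (act F g x))"
      if "\<forall>c\<in>Obj C. src (und \<alpha> c) = fobj F c \<and> tgt (und \<alpha> c) = fobj G c" "g \<in> Arr C" for g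
    proof -
      have "src (farr F g) = fobj F (Cod C g)" "tgt (farr G g) = fobj G (Dom C g)"
        "Dom C g \<in> Obj C" "Cod C g \<in> Obj C"
        using True that C.Dom_Obj C.Cod_Obj unfolding Psh_Obj_iff by auto
      then show ?thesis
        using that by (auto simp: set_cat_def act_def app_def restrict_def fun_eq_iff)
    qed
    have "nat_trans (op_cat C) set_cat F G (und \<alpha>) \<longleftrightarrow>
      (\<forall>c\<in>Obj C. und \<alpha> c \<in> hom set_cat (fobj F c) (fobj G c)) \<and>
      (\<forall>g\<in>Arr C. farr G g \<cdot>\<^bsub>set_cat\<^esub> und \<alpha> (Cod C g) = und \<alpha> (Dom C g) \<cdot>\<^bsub>set_cat\<^esub> farr F g)"
      using fg unfolding nat_trans_def by (simp add: op_cat_def)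
    also have "\<dots> \<longleftrightarrow> (\<forall>c\<in>Obj C. src (und \<alpha> c) = fobj F c \<and> tgt (und \<alpha> c) = fobj G c \<and>
      und (und \<alpha> c) \<in> fobj F c \<rightarrow>\<^sub>E fobj G c) \<and>
      (\<forall>g\<in>Arr C. \<forall>x\<in>fobj F (Cod C g). act G g (app \<alpha> (Cod C g) x) = app \<alpha> (Dom C g) (act F g x))"
    proof (cases "\<forall>c\<in>Obj C. src (und \<alpha> c) = fobj F c \<and> tgt (und \<alpha> c) = fobj G c")
      case T: True
      then show ?thesis
        using S eq[OF T] by (simp add: hom_def set_cat_def)
    qed (auto simp: hom_def set_cat_def)
    finally show ?thesis
      using L True by blast
  qed (use L in blast)
qed

lemma Arr_hom: "\<alpha> \<in> Arr E \<longleftrightarrow> \<alpha> \<in> hom E (Dom E \<alpha>) (Cod E \<alpha>)"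
  by (auto simp: hom_def)

lemma hom_Obj: "\<alpha> \<in> hom E F G \<Longrightarrow> F \<in> Obj E \<and> G \<in> Obj E"
  unfolding hom_iff by blast

lemma app_in: "\<alpha> \<in> hom E F G \<Longrightarrow> c \<in> Obj C \<Longrightarrow> x \<in> fobj F c \<Longrightarrow> app \<alpha> c x \<in> fobj G c"
  unfolding hom_iff app_def by (auto simp: PiE_iff)

lemma app_act: "\<alpha> \<in> hom E F G \<Longrightarrow> g \<in> hom C d c \<Longrightarrow> x \<in> fobj F c \<Longrightarrow>
    app \<alpha> d (act F g x) = act G g (app \<alpha> c x)"
  unfolding hom_iff hom_def[of C] by auto

lemma map_eqI:
  assumes "\<alpha> \<in> hom E F G" "\<beta> \<in> hom E F G"
    and "\<And>c x. c \<in> Obj C \<Longrightarrow> x \<in> fobj F c \<Longrightarrow> app \<alpha> c x = app \<beta> c x"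
  shows "\<alpha> = \<beta>"
proof -
  have "und \<alpha> c = und \<beta> c" for c
  proof (cases "c \<in> Obj C")
    case True
    have "und (und \<alpha> c) = und (und \<beta> c)"
      using assms True unfolding hom_iff app_def by (intro extensionalityI[of _ "fobj F c"]) (auto simp: PiE_iff)
    then show ?thesis
      using assms(1,2) True unfolding hom_iff by (auto intro: mor.expand)
  next
    case False
    then show ?thesis
      using assms(1,2) unfolding hom_iff by (auto simp: extensional_def)
  qed
  then have "und \<alpha> = und \<beta>" by blast
  then show ?thesis
    using assms(1,2) unfolding hom_iff by (auto intro: mor.expand)
qed

lemma mk_map_hom:
  assumes "F \<in> Obj E" "G \<in> Obj E"
    and u_in: "\<And>c x. c \<in> Obj C \<Longrightarrow> x \<in> fobj F c \<Longrightarrow> u c x \<in> fobj G c"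
    and nat: "\<And>d c g x. g \<in> hom C d c \<Longrightarrow> x \<in> fobj F c \<Longrightarrow> u d (act F g x) = act G g (u c x)"
  shows "mk_map C F G u \<in> hom E F G"
proof -
  have "act F g x \<in> fobj F (Dom C g)" "Cod C g \<in> Obj C" "Dom C g \<in> Obj C"
    if "g \<in> Arr C" "x \<in> fobj F (Cod C g)" for g x
    using act_in[OF assms(1), of g "Dom C g" "Cod C g" x] that C.Dom_Obj C.Cod_Obj
    by (auto simp: hom_def)
  then show ?thesis
    using assms unfolding hom_iff by (auto simp: mk_map_def app_def hom_def)
qed

lemma app_mk_map: "c \<in> Obj C \<Longrightarrow> x \<in> fobj F c \<Longrightarrow> app (mk_map C F G u) c x = u c x"
  by (simp add: app_def mk_map_def)

lemma app_comp_hom: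
  assumes "\<alpha> \<in> hom E F G" "\<beta> \<in> hom E G H"
  shows "\<beta> \<odot> \<alpha> = mk_map C F H (\<lambda>c x. app \<beta> c (app \<alpha> c x))"
  using assms unfolding hom_iff
  by (auto simp: E_Psh Psh_def fun_cat_def Let_def mk_map_def set_cat_def app_def op_cat_def
      restrict_def fun_eq_iff)

lemma app_comp:
  assumes "\<alpha> \<in> hom E F G" "\<beta> \<in> hom E G H" "c \<in> Obj C" "x \<in> fobj F c"
  shows "app (\<beta> \<odot> \<alpha>) c x = app \<beta> c (app \<alpha> c x)"
  using assms by (simp add: app_comp_hom app_mk_map)

lemma Id_mk_map: "Id E F = mk_map C F F (\<lambda>c x. x)"
  by (auto simp: E_Psh Psh_def fun_cat_def Let_def mk_map_def set_cat_def op_cat_def restrict_def)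

lemma app_Id: "c \<in> Obj C \<Longrightarrow> x \<in> fobj F c \<Longrightarrow> app (Id E F) c x = x"
  by (simp add: Id_mk_map app_mk_map)

lemma comp_in_hom:
  assumes "\<alpha> \<in> hom E F G" "\<beta> \<in> hom E G H"
  shows "\<beta> \<odot> \<alpha> \<in> hom E F H"
  unfolding app_comp_hom[OF assms]
proof (rule mk_map_hom)
  fix d c g x assume g: "g \<in> hom C d c" and x: "x \<in> fobj F c"
  then have "c \<in> Obj C" using C.Cod_Obj by (auto simp: hom_def)
  then show "app \<beta> d (app \<alpha> d (act F g x)) = act H g (app \<beta> c (app \<alpha> c x))"
    by (simp add: app_act[OF assms(1) g x] app_act[OF assms(2) g app_in[OF assms(1) _ x]])
qed (use assms in \<open>auto dest: hom_Obj intro: app_in\<close>)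

lemma Id_in_hom: "F \<in> Obj E \<Longrightarrow> Id E F \<in> hom E F F"
  unfolding Id_mk_map by (rule mk_map_hom) auto

sublocale category E
proof
  fix \<alpha> assume "\<alpha> \<in> Arr E"
  then show "Dom E \<alpha> \<in> Obj E" "Cod E \<alpha> \<in> Obj E"
    using Arr_hom hom_Obj by blast+
next
  fix \<alpha> \<beta> \<gamma> W X Y Z assume h: "\<alpha> \<in> hom E W X" "\<beta> \<in> hom E X Y" "\<gamma> \<in> hom E Y Z"
  show "(\<gamma> \<odot> \<beta>) \<odot> \<alpha> = \<gamma> \<odot> (\<beta> \<odot> \<alpha>)"
  proof (rule map_eqI)
    fix c x assume "c \<in> Obj C" "x \<in> fobj W c"
    then show "app ((\<gamma> \<odot> \<beta>) \<odot> \<alpha>) c x = app (\<gamma> \<odot> (\<beta> \<odot> \<alpha>)) c x"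
      using h app_in[OF h(1)]
      by (simp add: app_comp[OF h(1) comp_in_hom[OF h(2,3)]] app_comp[OF comp_in_hom[OF h(1,2)] h(3)]
          app_comp[OF h(1,2)] app_comp[OF h(2,3)])
  qed (use h comp_in_hom in blast)+
next
  fix \<alpha> F G assume h: "\<alpha> \<in> hom E F G"
  then have o: "F \<in> Obj E" "G \<in> Obj E" using hom_Obj by auto
  show "\<alpha> \<odot> Id E F = \<alpha>"
    by (rule map_eqI[OF comp_in_hom[OF Id_in_hom[OF o(1)] h] h])
      (simp add: app_comp[OF Id_in_hom[OF o(1)] h] app_Id)
  show "Id E G \<odot> \<alpha> = \<alpha>"
    by (rule map_eqI[OF comp_in_hom[OF h Id_in_hom[OF o(2)]] h])
      (simp add: app_comp[OF h Id_in_hom[OF o(2)]] app_Id app_in[OF h])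
qed (use comp_in_hom Id_in_hom in auto)


section \<open>Representable presheaves\<close>

lemma ex_representing:
  assumes c: "c \<in> Obj C"
  shows "\<exists>F \<theta>. F \<in> Obj E \<and> (\<forall>d\<in>Obj C. bij_betw (\<theta> d) (hom C d c) (fobj F d)) \<and>
    (\<forall>d e g h. g \<in> hom C e d \<longrightarrow> h \<in> hom C d c \<longrightarrow> act F g (\<theta> d h) = \<theta> e (h \<cdot>\<^bsub>C\<^esub> g))"
proof -
  have sm: "small TYPE('v) (hom C d c)" if "d \<in> Obj C" for d
    using C_small unfolding small_category_def hom_def by (blast intro: small_subset)
  have cl: "h \<cdot>\<^bsub>C\<^esub> g \<in> hom C d c" if "g \<in> hom C d e" "h \<in> hom C e c" for d e g h
    using that by (rule C.Comp_hom)
  have unit: "x \<cdot>\<^bsub>C\<^esub> Id C d = x" if "d \<in> Obj C" "x \<in> hom C d c" for d x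
    using that(2) by (rule C.Comp_Id)
  have assoc: "x \<cdot>\<^bsub>C\<^esub> (g \<cdot>\<^bsub>C\<^esub> h) = (x \<cdot>\<^bsub>C\<^esub> g) \<cdot>\<^bsub>C\<^esub> h"
    if "g \<in> hom C d e" "h \<in> hom C k d" "x \<in> hom C e c" for d e k g h x
    using C.Comp_assoc[OF that(2,1,3)] by simp
  have "\<exists>F e i. encodes (\<lambda>d. hom C d c) (\<lambda>g h. h \<cdot>\<^bsub>C\<^esub> g) F e i"
    by (rule realize_presheaf) (fact sm cl unit assoc)+
  then obtain F e i where enc: "encodes (\<lambda>d. hom C d c) (\<lambda>g h. h \<cdot>\<^bsub>C\<^esub> g) F e i"
    by blast
  note F = encodesD(1)[OF enc]
  have "bij_betw (e d) (hom C d c) (fobj F d)" if "d \<in> Obj C" for d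
    by (rule bij_betw_byWitness[of _ "i d"]) (use encodesD(2-5)[OF enc that] in auto)
  moreover have "act F g (e d h) = e d' (h \<cdot>\<^bsub>C\<^esub> g)" if "g \<in> hom C d' d" "h \<in> hom C d c" for d' d g h
    by (rule encodes_act[OF enc that])
  ultimately show ?thesis using F by blast
qed

definition yo_choice :: "'o \<Rightarrow> ('o, 'm, 'v) psh \<times> ('o \<Rightarrow> 'm \<Rightarrow> 'v)" where
  "yo_choice c = (SOME (F, \<theta>). F \<in> Obj E \<and>
    (\<forall>d\<in>Obj C. bij_betw (\<theta> d) (hom C d c) (fobj F d)) \<and>
    (\<forall>d e g h. g \<in> hom C e d \<longrightarrow> h \<in> hom C d c \<longrightarrow> act F g (\<theta> d h) = \<theta> e (h \<cdot>\<^bsub>C\<^esub> g)))"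

definition yo :: "'o \<Rightarrow> ('o, 'm, 'v) psh" where
  "yo c = fst (yo_choice c)"

definition yo_iso :: "'o \<Rightarrow> 'o \<Rightarrow> 'm \<Rightarrow> 'v" where
  "yo_iso c = snd (yo_choice c)"

text \<open>The element of \<open>yo c\<close> at \<open>c\<close> that corresponds to the identity. By the Yoneda lemma everything
  about \<open>yo c\<close> can be said in terms of it.\<close>

definition yo_gen :: "'o \<Rightarrow> 'v" where
  "yo_gen c = yo_iso c c (Id C c)"

lemma yo_spec:
  assumes "c \<in> Obj C"
  shows yo_Obj: "yo c \<in> Obj E"
    and yo_iso_bij: "d \<in> Obj C \<Longrightarrow> bij_betw (yo_iso c d) (hom C d c) (fobj (yo c) d)"
    and yo_iso_act: "g \<in> hom C e d \<Longrightarrow> h \<in> hom C d c \<Longrightarrow>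
      act (yo c) g (yo_iso c d h) = yo_iso c e (h \<cdot>\<^bsub>C\<^esub> g)"
proof -
  have "case yo_choice c of (F, \<theta>) \<Rightarrow> F \<in> Obj E \<and>
    (\<forall>d\<in>Obj C. bij_betw (\<theta> d) (hom C d c) (fobj F d)) \<and>
    (\<forall>d e g h. g \<in> hom C e d \<longrightarrow> h \<in> hom C d c \<longrightarrow> act F g (\<theta> d h) = \<theta> e (h \<cdot>\<^bsub>C\<^esub> g))"
    unfolding yo_choice_def by (rule someI_ex) (use ex_representing[OF assms] in simp)
  then have "yo c \<in> Obj E \<and>
    (\<forall>d\<in>Obj C. bij_betw (yo_iso c d) (hom C d c) (fobj (yo c) d)) \<and>
    (\<forall>d e g h. g \<in> hom C e d \<longrightarrow> h \<in> hom C d c \<longrightarrow> act (yo c) g (yo_iso c d h) = yo_iso c e (h \<cdot>\<^bsub>C\<^esub> g))"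
    unfolding yo_def yo_iso_def by (simp add: case_prod_beta)
  then show "yo c \<in> Obj E"
    "d \<in> Obj C \<Longrightarrow> bij_betw (yo_iso c d) (hom C d c) (fobj (yo c) d)"
    "g \<in> hom C e d \<Longrightarrow> h \<in> hom C d c \<Longrightarrow> act (yo c) g (yo_iso c d h) = yo_iso c e (h \<cdot>\<^bsub>C\<^esub> g)"
    by blast+
qed

lemma hom_Obj_C: "g \<in> hom C d c \<Longrightarrow> d \<in> Obj C \<and> c \<in> Obj C"
  using C.Dom_Obj C.Cod_Obj by (auto simp: hom_def)

lemma yo_gen_act:
  assumes "g \<in> hom C d c"
  shows "act (yo c) g (yo_gen c) = yo_iso c d g"
proof -
  have c: "c \<in> Obj C" using assms hom_Obj_C by blast
  show ?thesis
    unfolding yo_gen_def using yo_iso_act[OF c assms C.Id_hom[OF c]] C.Id_Comp[OF assms] by simp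
qed

lemma yo_gen_in: "c \<in> Obj C \<Longrightarrow> yo_gen c \<in> fobj (yo c) c"
  unfolding yo_gen_def using yo_iso_bij C.Id_hom by (blast dest: bij_betwE)

lemma yo_elem:
  assumes "c \<in> Obj C" "d \<in> Obj C" "v \<in> fobj (yo c) d"
  obtains g where "g \<in> hom C d c" "v = act (yo c) g (yo_gen c)"
proof -
  have "v \<in> yo_iso c d ` hom C d c"
    using yo_iso_bij[OF assms(1,2)] assms(3) by (simp add: bij_betw_def)
  then show thesis
    using yo_gen_act that by auto
qed

lemma yo_representable: "c \<in> Obj C \<Longrightarrow> representable C (yo c)"
proof -
  assume c: "c \<in> Obj C"
  have "yo_iso c (Dom C g) (f \<cdot>\<^bsub>C\<^esub> g) = und (farr (yo c) g) (yo_iso c (Cod C g) f)"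
    if "g \<in> Arr C" "f \<in> hom C (Cod C g) c" for f g
    using yo_iso_act[OF c, of g "Dom C g" "Cod C g" f] that by (simp add: act_def hom_def)
  then show ?thesis
    unfolding representable_def
    using c yo_Obj[OF c] yo_iso_bij[OF c]
    by (intro conjI bexI[of _ c] exI[of _ "yo_iso c"]) (simp_all add: E_Psh[symmetric])
qed

text \<open>The map out of a representable that corresponds to an element under the Yoneda lemma.\<close>

definition yon :: "('o, 'm, 'v) psh \<Rightarrow> 'o \<Rightarrow> 'v \<Rightarrow> ('o, 'm, 'v) psh_map" where
  "yon F c x = mk_map C (yo c) F (\<lambda>d v. act F (inv_into (hom C d c) (yo_iso c d) v) x)"

lemma app_yon:
  assumes "g \<in> hom C d c"
  shows "app (yon F c x) d (act (yo c) g (yo_gen c)) = act F g x"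
proof -
  have o: "d \<in> Obj C" "c \<in> Obj C" using assms hom_Obj_C by auto
  show ?thesis
    using yo_iso_bij[OF o(2,1)] assms o unfolding yon_def yo_gen_act[OF assms]
    by (simp add: app_mk_map bij_betw_def bij_betwE inv_into_f_f)
qed

lemma yon_hom:
  assumes F: "F \<in> Obj E" and c: "c \<in> Obj C" and x: "x \<in> fobj F c"
  shows "yon F c x \<in> hom E (yo c) F"
proof -
  let ?u = "\<lambda>d v. act F (inv_into (hom C d c) (yo_iso c d) v) x"
  have u: "?u d (yo_iso c d g) = act F g x" if "g \<in> hom C d c" for d g
    using yo_iso_bij[OF c] hom_Obj_C[OF that] that by (simp add: bij_betw_def)
  have el: "\<exists>g\<in>hom C d c. v = yo_iso c d g" if "d \<in> Obj C" "v \<in> fobj (yo c) d" for d v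
    using yo_iso_bij[OF c that(1)] that(2) unfolding bij_betw_def by blast
  show ?thesis
    unfolding yon_def
  proof (rule mk_map_hom)
    fix d v assume "d \<in> Obj C" "v \<in> fobj (yo c) d"
    then show "?u d v \<in> fobj F d"
      using el u act_in[OF F] x by metis
  next
    fix e d g v assume g: "g \<in> hom C e d" and v: "v \<in> fobj (yo c) d"
    then obtain h where h: "h \<in> hom C d c" "v = yo_iso c d h"
      using el hom_Obj_C by blast
    show "?u e (act (yo c) g v) = act F g (?u d v)"
      unfolding h(2) yo_iso_act[OF c g h(1)] u[OF C.Comp_hom[OF g h(1)]] u[OF h(1)]
      using act_comp[OF F h(1) g x] .
  qed (use F c yo_Obj in auto)
qed

lemma app_yon_gen:
  assumes "F \<in> Obj E" "c \<in> Obj C" "x \<in> fobj F c"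
  shows "app (yon F c x) c (yo_gen c) = x"
  using app_yon[OF C.Id_hom[OF assms(2)], of F x]
  by (simp add: assms act_Id yo_Obj yo_gen_in)

lemma yo_map_eqI:
  assumes c: "c \<in> Obj C" and h: "\<alpha> \<in> hom E (yo c) F" "\<beta> \<in> hom E (yo c) F"
    and eq: "app \<alpha> c (yo_gen c) = app \<beta> c (yo_gen c)"
  shows "\<alpha> = \<beta>"
  using h
proof (rule map_eqI)
  fix d v assume "d \<in> Obj C" "v \<in> fobj (yo c) d"
  then obtain g where "g \<in> hom C d c" "v = act (yo c) g (yo_gen c)"
    using yo_elem c by blast
  then show "app \<alpha> d v = app \<beta> d v"
    using eq by (simp add: app_act[OF h(1) _ yo_gen_in[OF c]] app_act[OF h(2) _ yo_gen_in[OF c]])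
qed

lemma comp_yon:
  assumes a: "\<alpha> \<in> hom E F G" and c: "c \<in> Obj C" and x: "x \<in> fobj F c"
  shows "\<alpha> \<odot> yon F c x = yon G c (app \<alpha> c x)"
proof -
  have F: "F \<in> Obj E" and G: "G \<in> Obj E" using a hom_Obj by auto
  note y = yon_hom[OF F c x]
  show ?thesis
    by (rule yo_map_eqI[OF c comp_in_hom[OF y a] yon_hom[OF G c app_in[OF a c x]]])
      (simp add: app_comp[OF y a c yo_gen_in[OF c]] app_yon_gen F G c x app_in[OF a c x])
qed

definition yo_arr :: "'m \<Rightarrow> ('o, 'm, 'v) psh_map" where
  "yo_arr g = yon (yo (Cod C g)) (Dom C g) (act (yo (Cod C g)) g (yo_gen (Cod C g)))"

lemma yo_arr_hom: "g \<in> hom C d c \<Longrightarrow> yo_arr g \<in> hom E (yo d) (yo c)"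
  unfolding yo_arr_def using hom_Obj_C[of g d c] homD[of g C d c]
  by (auto intro!: yon_hom yo_Obj act_in yo_gen_in)

lemma app_yo_arr_gen: "g \<in> hom C d c \<Longrightarrow> app (yo_arr g) d (yo_gen d) = act (yo c) g (yo_gen c)"
  unfolding yo_arr_def using hom_Obj_C[of g d c] homD[of g C d c]
  by (auto intro!: app_yon_gen yo_Obj act_in yo_gen_in)

lemma yon_yo_arr:
  assumes F: "F \<in> Obj E" and g: "g \<in> hom C d c" and x: "x \<in> fobj F c"
  shows "yon F c x \<odot> yo_arr g = yon F d (act F g x)"
proof -
  have o: "d \<in> Obj C" "c \<in> Obj C" using g hom_Obj_C by auto
  have "yo_arr g = yon (yo c) d (act (yo c) g (yo_gen c))"
    using homD[OF g] by (simp add: yo_arr_def)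
  moreover have "act (yo c) g (yo_gen c) \<in> fobj (yo c) d"
    using act_in[OF yo_Obj g yo_gen_in] o by blast
  ultimately show ?thesis
    using comp_yon[OF yon_hom[OF F o(2) x] o(1)] by (simp add: app_yon[OF g])
qed

lemma map_act_gen:
  assumes "\<alpha> \<in> hom E (yo c) F" "g \<in> hom C d c"
  shows "app (\<alpha> \<odot> yo_arr g) d (yo_gen d) = act F g (app \<alpha> c (yo_gen c))"
  using app_comp[OF yo_arr_hom[OF assms(2)] assms(1), of d "yo_gen d"] hom_Obj_C[OF assms(2)]
  by (simp add: yo_gen_in app_yo_arr_gen[OF assms(2)] app_act[OF assms])


section \<open>Pullbacks and monomorphisms, element by element\<close>

lemma comm_sqE:
  assumes "comm_sq E a m n b"
  obtains P A B D where "a \<in> hom E P A" "m \<in> hom E P B" "n \<in> hom E A D" "b \<in> hom E B D"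
    "n \<odot> a = b \<odot> m"
  using assms unfolding comm_sq_def hom_def by auto

lemma comm_sq_app:
  assumes "a \<in> hom E P A" "m \<in> hom E P B" "n \<in> hom E A D" "b \<in> hom E B D"
    "n \<odot> a = b \<odot> m" "c \<in> Obj C" "w \<in> fobj P c"
  shows "app n c (app a c w) = app b c (app m c w)"
  using assms app_comp by metis

text \<open>Testing the universal property on representables shows that it holds for elements.\<close>

lemma pullback_elem:
  assumes pb: "is_pullback E a m n b" and h: "a \<in> hom E P A" "m \<in> hom E P B" "n \<in> hom E A D" "b \<in> hom E B D"
    and c: "c \<in> Obj C" and x: "x \<in> fobj A c" and z: "z \<in> fobj B c" and eq: "app n c x = app b c z"
  shows "\<exists>!w. w \<in> fobj P c \<and> app a c w = x \<and> app m c w = z"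
proof -
  have o: "P \<in> Obj E" "A \<in> Obj E" "B \<in> Obj E" "D \<in> Obj E" using h hom_Obj by auto
  note yx = yon_hom[OF o(2) c x] and yz = yon_hom[OF o(3) c z]
  have "comm_sq E (yon A c x) (yon B c z) n b"
    by (rule comm_sqI[OF yz h(3) yx h(4)]) (simp add: comp_yon[OF h(3) c x] comp_yon[OF h(4) c z] eq)
  then have ex1: "\<exists>!k. k \<in> hom E (yo c) P \<and> a \<odot> k = yon A c x \<and> m \<odot> k = yon B c z"
    using pb homD[OF h(2)] homD[OF yz] unfolding is_pullback_def by metis
  have iff: "app a c w = x \<longleftrightarrow> a \<odot> yon P c w = yon A c x" "app m c w = z \<longleftrightarrow> m \<odot> yon P c w = yon B c z"
    if "w \<in> fobj P c" for w
    unfolding comp_yon[OF h(1) c that] comp_yon[OF h(2) c that]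
    using app_yon_gen[OF o(2) c] app_yon_gen[OF o(3) c] app_in[OF h(1) c that] app_in[OF h(2) c that] x z
    by metis+
  obtain k where k: "k \<in> hom E (yo c) P" "a \<odot> k = yon A c x" "m \<odot> k = yon B c z"
    using ex1 by blast
  have w: "app k c (yo_gen c) \<in> fobj P c"
    using app_in[OF k(1) c yo_gen_in[OF c]] .
  have "yon P c (app k c (yo_gen c)) = k"
    by (rule yo_map_eqI[OF c yon_hom[OF o(1) c w] k(1)]) (simp add: app_yon_gen o c w)
  then have "app a c (app k c (yo_gen c)) = x" "app m c (app k c (yo_gen c)) = z"
    using iff[OF w] k by auto
  moreover have "w1 = w2" if "w1 \<in> fobj P c \<and> app a c w1 = x \<and> app m c w1 = z"
    "w2 \<in> fobj P c \<and> app a c w2 = x \<and> app m c w2 = z" for w1 w2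
  proof -
    have "yon P c w1 = yon P c w2"
    proof (rule ex1E[OF ex1])
      fix k
      assume "\<forall>k'. k' \<in> hom E (yo c) P \<and> a \<odot> k' = yon A c x \<and> m \<odot> k' = yon B c z \<longrightarrow> k' = k"
      then have "yon P c w = k" if "w \<in> fobj P c \<and> app a c w = x \<and> app m c w = z" for w
        using iff[of w] that yon_hom[OF o(1) c, of w] by simp
      then show ?thesis
        using that by simp
    qed
    then show ?thesis
      using app_yon_gen[OF o(1) c] that by metis
  qed
  ultimately show ?thesis using w by blast
qed

lemma pullbackI_elem:
  assumes h: "a \<in> hom E P A" "m \<in> hom E P B" "n \<in> hom E A D" "b \<in> hom E B D"
    and comm: "n \<odot> a = b \<odot> m"
    and ex1: "\<And>c x z. \<lbrakk>c \<in> Obj C; x \<in> fobj A c; z \<in> fobj B c; app n c x = app b c z\<rbrakk> \<Longrightarrow>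
      \<exists>!w. w \<in> fobj P c \<and> app a c w = x \<and> app m c w = z"
  shows "is_pullback E a m n b"
  unfolding is_pullback_def
proof (intro conjI allI impI)
  show "comm_sq E a m n b" by (rule comm_sqI[OF h(2,3,1,4) comm])
next
  fix a' m' assume "comm_sq E a' m' n b"
  then obtain X where h': "a' \<in> hom E X A" "m' \<in> hom E X B" and comm': "n \<odot> a' = b \<odot> m'"
    using h by (elim comm_sqE) (auto simp: hom_def)
  have o: "X \<in> Obj E" "P \<in> Obj E" using h h' hom_Obj by auto
  define k where "k c v = (THE w. w \<in> fobj P c \<and> app a c w = app a' c v \<and> app m c w = app m' c v)" for c v
  have k1: "\<exists>!w. w \<in> fobj P c \<and> app a c w = app a' c v \<and> app m c w = app m' c v"
    if "c \<in> Obj C" "v \<in> fobj X c" for c v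
    using ex1[OF that(1) app_in[OF h'(1) that] app_in[OF h'(2) that]]
      comm_sq_app[OF h' h(3,4) comm' that] by blast
  have k: "k c v \<in> fobj P c \<and> app a c (k c v) = app a' c v \<and> app m c (k c v) = app m' c v"
    if "c \<in> Obj C" "v \<in> fobj X c" for c v
    unfolding k_def using theI'[OF k1[OF that]] .
  have K: "mk_map C X P k \<in> hom E X P"
  proof (rule mk_map_hom[OF o])
    fix d c g v assume g: "g \<in> hom C d c" and v: "v \<in> fobj X c"
    then have oc: "d \<in> Obj C" "c \<in> Obj C" using hom_Obj_C by auto
    have "app a d (act P g (k c v)) = app a' d (act X g v)" "app m d (act P g (k c v)) = app m' d (act X g v)"
      using k[OF oc(2) v] by (simp_all add: app_act[OF h(1) g] app_act[OF h(2) g] app_act[OF h'(1) g v] app_act[OF h'(2) g v])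
    then show "k d (act X g v) = act P g (k c v)"
      using k[OF oc(1) act_in[OF o(1) g v]] k1[OF oc(1) act_in[OF o(1) g v]] act_in[OF o(2) g] k[OF oc(2) v]
      by blast
  qed (use k in blast)
  have "a \<odot> mk_map C X P k = a'"
    by (rule map_eqI[OF comp_in_hom[OF K h(1)] h'(1)]) (simp add: app_comp[OF K h(1)] app_mk_map k)
  moreover have "m \<odot> mk_map C X P k = m'"
    by (rule map_eqI[OF comp_in_hom[OF K h(2)] h'(2)]) (simp add: app_comp[OF K h(2)] app_mk_map k)
  moreover have "l = mk_map C X P k" if l: "l \<in> hom E X P" "a \<odot> l = a'" "m \<odot> l = m'" for l
  proof (rule map_eqI[OF l(1) K])
    fix c v assume cv: "c \<in> Obj C" "v \<in> fobj X c"
    have "app a c (app l c v) = app a' c v" "app m c (app l c v) = app m' c v"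
      using app_comp[OF l(1) h(1) cv] app_comp[OF l(1) h(2) cv] l by auto
    then show "app l c v = app (mk_map C X P k) c v"
      using k1[OF cv] k[OF cv] app_in[OF l(1) cv] cv by (auto simp: app_mk_map)
  qed
  ultimately show "\<exists>!h. h \<in> hom E (Dom E m') (Dom E m) \<and> a \<odot> h = a' \<and> m \<odot> h = m'"
    unfolding conjunct1[OF conjunct2[OF homD[OF h'(2)]]] conjunct1[OF conjunct2[OF homD[OF h(2)]]]
    using K by (intro ex1I[of _ "mk_map C X P k"]) blast+
qed

lemma ex_pullback:
  assumes n: "n \<in> hom E A D" and b: "b \<in> hom E B D"
  obtains P a m where "a \<in> hom E P A" "m \<in> hom E P B" "is_pullback E a m n b"
proof -
  have o: "A \<in> Obj E" "B \<in> Obj E" using n b hom_Obj by auto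
  let ?S = "\<lambda>c. {(x, z). x \<in> fobj A c \<and> z \<in> fobj B c \<and> app n c x = app b c z}"
  have sm: "small TYPE('v) (?S c)" if "c \<in> Obj C" for c
    by (rule small_subset[OF small_Times[OF universe psh_small[OF o(1) that] psh_small[OF o(2) that]]]) auto
  have cl: "map_prod (act A g) (act B g) w \<in> ?S d" if "g \<in> hom C d c" "w \<in> ?S c" for d c g w
    using that act_in[OF o(1) that(1)] act_in[OF o(2) that(1)]
    by (auto simp: app_act[OF n that(1)] app_act[OF b that(1)])
  have unit: "map_prod (act A (Id C c)) (act B (Id C c)) w = w" if "c \<in> Obj C" "w \<in> ?S c" for c w
    using that by (auto simp: act_Id o)
  have assoc: "map_prod (act A (g \<cdot>\<^bsub>C\<^esub> h)) (act B (g \<cdot>\<^bsub>C\<^esub> h)) w =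
      map_prod (act A h) (act B h) (map_prod (act A g) (act B g) w)"
    if "g \<in> hom C d c" "h \<in> hom C k d" "w \<in> ?S c" for c d k g h w
    using that by (auto simp: act_comp[OF o(1) that(1,2)] act_comp[OF o(2) that(1,2)])
  have "\<exists>P e i. encodes ?S (\<lambda>g. map_prod (act A g) (act B g)) P e i"
    by (rule realize_presheaf) (fact sm cl unit assoc)+
  then obtain P e i where enc: "encodes ?S (\<lambda>g. map_prod (act A g) (act B g)) P e i"
    by blast
  note P = encodesD(1)[OF enc] and ie = encodesD(2,3)[OF enc] and i = encodesD(4,5)[OF enc] and ia = encodesD(6)[OF enc]
  define a where "a = mk_map C P A (\<lambda>c v. fst (i c v))"
  define m where "m = mk_map C P B (\<lambda>c v. snd (i c v))"
  have a: "a \<in> hom E P A" unfolding a_def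
    by (rule mk_map_hom[OF P o(1)]) (use i(1) ia in force)+
  have m: "m \<in> hom E P B" unfolding m_def
    by (rule mk_map_hom[OF P o(2)]) (use i(1) ia in force)+
  have "is_pullback E a m n b"
  proof (rule pullbackI_elem[OF a m n b])
    show "n \<odot> a = b \<odot> m"
    proof (rule map_eqI[OF comp_in_hom[OF a n] comp_in_hom[OF m b]])
      fix c v assume cv: "c \<in> Obj C" "v \<in> fobj P c"
      show "app (n \<odot> a) c v = app (b \<odot> m) c v"
        using i(1)[OF cv] unfolding app_comp[OF a n cv] app_comp[OF m b cv]
        by (auto simp: a_def m_def app_mk_map cv)
    qed
    fix c x z assume h: "c \<in> Obj C" "x \<in> fobj A c" "z \<in> fobj B c" "app n c x = app b c z"
    then have S: "(x, z) \<in> ?S c" by simp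
    show "\<exists>!w. w \<in> fobj P c \<and> app a c w = x \<and> app m c w = z"
    proof (rule ex1I[of _ "e c (x, z)"])
      show "e c (x, z) \<in> fobj P c \<and> app a c (e c (x, z)) = x \<and> app m c (e c (x, z)) = z"
        using ie[OF h(1) S] h(1) by (simp add: a_def m_def app_mk_map)
      show "w = e c (x, z)" if "w \<in> fobj P c \<and> app a c w = x \<and> app m c w = z" for w
        using i(2)[of c w] that h(1) by (auto simp: a_def m_def app_mk_map)
    qed
  qed
  then show thesis using that a m by blast
qed

definition injective :: "('o, 'm, 'v) psh_map \<Rightarrow> bool" where
  "injective m \<longleftrightarrow> (\<forall>c\<in>Obj C. inj_on (app m c) (fobj (Dom E m) c))"

lemma injectiveD:
  assumes "injective m" "m \<in> hom E A B" "c \<in> Obj C" "x \<in> fobj A c" "y \<in> fobj A c"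
    "app m c x = app m c y"
  shows "x = y"
proof -
  have "inj_on (app m c) (fobj A c)"
    using assms(1,3) homD[OF assms(2)] unfolding injective_def by auto
  then show ?thesis
    using assms(4-6) by (blast dest: inj_onD)
qed

lemma mono_injective:
  assumes "mono_arr E m"
  shows "injective m"
  unfolding injective_def
proof (intro ballI inj_onI)
  define A B where "A = Dom E m" and "B = Cod E m"
  have m: "m \<in> hom E A B" using assms unfolding mono_arr_def A_def B_def by (auto simp: hom_def)
  then have A: "A \<in> Obj E" using hom_Obj by blast
  fix c x y assume c: "c \<in> Obj C" and "x \<in> fobj (Dom E m) c" "y \<in> fobj (Dom E m) c"
    and eq: "app m c x = app m c y"
  then have x: "x \<in> fobj A c" and y: "y \<in> fobj A c" by (simp_all add: A_def)
  have "m \<odot> yon A c x = m \<odot> yon A c y"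
    unfolding comp_yon[OF m c x] comp_yon[OF m c y] eq ..
  then have "yon A c x = yon A c y"
    using assms yon_hom[OF A c x] yon_hom[OF A c y] unfolding mono_arr_def A_def
    by (auto simp: hom_def)
  then show "x = y" using app_yon_gen[OF A c] x y by metis
qed

lemma injective_pullback_iff:
  assumes i: "i \<in> hom E A B"
  shows "injective i \<longleftrightarrow> is_pullback E (Id E A) (Id E A) i i"
proof
  have A: "A \<in> Obj E" using i hom_Obj by blast
  note I = Id_in_hom[OF A]
  show "is_pullback E (Id E A) (Id E A) i i" if "injective i"
    by (rule pullbackI_elem[OF I I i i refl]) (auto simp: app_Id injectiveD[OF that i])
  show "injective i" if pb: "is_pullback E (Id E A) (Id E A) i i"
    unfolding injective_def
  proof (intro ballI inj_onI)
    fix c x y assume "c \<in> Obj C" "x \<in> fobj (Dom E i) c" "y \<in> fobj (Dom E i) c" "app i c x = app i c y"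
    then show "x = y"
      using pullback_elem[OF pb I I i i, of c x y] homD[OF i] app_Id by metis
  qed
qed

lemma ex_subpresheaf:
  assumes F: "F \<in> Obj E" and sub: "\<And>c. c \<in> Obj C \<Longrightarrow> Q c \<subseteq> fobj F c"
    and cl: "\<And>d c g x. g \<in> hom C d c \<Longrightarrow> x \<in> Q c \<Longrightarrow> act F g x \<in> Q d"
  shows "\<exists>A m. m \<in> hom E A F \<and> injective m \<and> (\<forall>c\<in>Obj C. app m c ` fobj A c = Q c)"
proof -
  have sm: "small TYPE('v) (Q c)" if "c \<in> Obj C" for c
    using small_subset[OF psh_small[OF F that] sub[OF that]] .
  have unit: "act F (Id C c) x = x" if "c \<in> Obj C" "x \<in> Q c" for c x
    using act_Id[OF F that(1)] sub that by blast
  have assoc: "act F (g \<cdot>\<^bsub>C\<^esub> h) x = act F h (act F g x)"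
    if "g \<in> hom C d c" "h \<in> hom C k d" "x \<in> Q c" for c d k g h x
    using act_comp[OF F that(1,2)] sub that(3) hom_Obj_C[OF that(1)] by blast
  have "\<exists>A e i. encodes Q (act F) A e i"
    by (rule realize_presheaf) (fact sm cl unit assoc)+
  then obtain A e i where enc: "encodes Q (act F) A e i"
    by blast
  note A = encodesD(1)[OF enc] and ie = encodesD(2,3)[OF enc] and i = encodesD(4,5)[OF enc] and ia = encodesD(6)[OF enc]
  have m: "mk_map C A F i \<in> hom E A F"
  proof (rule mk_map_hom[OF A F])
    show "i c v \<in> fobj F c" if "c \<in> Obj C" "v \<in> fobj A c" for c v
      using i(1)[OF that] sub[OF that(1)] by blast
  qed (rule ia)
  have "injective (mk_map C A F i)"
    unfolding injective_def conjunct1[OF conjunct2[OF homD[OF m]]]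
    by (intro ballI inj_onI) (metis app_mk_map i(2))
  moreover have "app (mk_map C A F i) c ` fobj A c = Q c" if c: "c \<in> Obj C" for c
  proof
    show "app (mk_map C A F i) c ` fobj A c \<subseteq> Q c" using c i(1) by (auto simp: app_mk_map)
    show "Q c \<subseteq> app (mk_map C A F i) c ` fobj A c"
    proof
      fix x assume "x \<in> Q c"
      then show "x \<in> app (mk_map C A F i) c ` fobj A c"
        using ie[OF c] c by (intro image_eqI[of _ _ "e c x"]) (simp_all add: app_mk_map)
    qed
  qed
  ultimately show ?thesis using m by blast
qed

end


section \<open>Cocones for diagrams indexed by small categories over any types\<close>

text \<open>Colimits are only assumed for index categories whose objects and arrows are elements of \<open>'v\<close>;
  an arbitrary small index category is replaced by an isomorphic one of this kind.\<close>

lemma has_colimits_ex_cocone: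
  fixes J :: "('j, 'k) cat" and D :: "('o, 'a) cat"
  assumes colim: "has_colimits TYPE('v) D" and J: "small_category TYPE('v) J" and F: "is_functor J D F"
  shows "\<exists>x l. is_cocone J D F x l"
proof -
  interpret J: category J using J unfolding small_category_def by blast
  obtain e1 :: "'j \<Rightarrow> 'v" where e1: "inj_on e1 (Obj J)"
    using J small_encode unfolding small_category_def by metis
  obtain e2 :: "'k \<Rightarrow> 'v" where e2: "inj_on e2 (Arr J)"
    using J small_encode unfolding small_category_def by metis
  define i1 where "i1 = inv_into (Obj J) e1"
  define i2 where "i2 = inv_into (Arr J) e2"
  have i1: "i1 (e1 x) = x" if "x \<in> Obj J" for x using e1 that by (simp add: i1_def)
  have i2: "i2 (e2 x) = x" if "x \<in> Arr J" for x using e2 that by (simp add: i2_def)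
  define K :: "('v, 'v) cat" where "K = \<lparr>Obj = e1 ` Obj J, Arr = e2 ` Arr J,
    Dom = (\<lambda>v. e1 (Dom J (i2 v))), Cod = (\<lambda>v. e1 (Cod J (i2 v))), Id = (\<lambda>v. e2 (Id J (i1 v))),
    Comp = (\<lambda>g f. e2 (i2 g \<cdot>\<^bsub>J\<^esub> i2 f))\<rparr>"
  have homK: "f \<in> hom K x y \<longleftrightarrow> (\<exists>f'. f = e2 f' \<and> f' \<in> Arr J \<and> x = e1 (Dom J f') \<and> y = e1 (Cod J f'))"
    for f x y
    by (auto simp: K_def hom_def i2)
  have e1_eq: "e1 x = e1 y \<longleftrightarrow> x = y" if "x \<in> Obj J" "y \<in> Obj J" for x y
    using inj_on_eq_iff[OF e1] that by blast
  have comp: "g \<cdot>\<^bsub>J\<^esub> f \<in> Arr J \<and> Dom J (g \<cdot>\<^bsub>J\<^esub> f) = Dom J f \<and> Cod J (g \<cdot>\<^bsub>J\<^esub> f) = Cod J g"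
    if "f \<in> Arr J" "g \<in> Arr J" "Cod J f = Dom J g" for f g
    using J.Comp_hom[of f "Dom J f" "Dom J g" g "Cod J g"] that by (simp add: hom_def)
  have Id: "Id J x \<in> Arr J \<and> Dom J (Id J x) = x \<and> Cod J (Id J x) = x" if "x \<in> Obj J" for x
    using J.Id_hom[OF that] by (simp add: hom_def)
  have catK: "category K"
  proof
    show "Dom K f \<in> Obj K" "Cod K f \<in> Obj K" if "f \<in> Arr K" for f
      using that J.Dom_Obj J.Cod_Obj by (auto simp: K_def i2)
    show "Id K x \<in> hom K x x" if "x \<in> Obj K" for x
      using that Id unfolding homK by (auto simp: K_def i1)
    show "g \<cdot>\<^bsub>K\<^esub> f \<in> hom K x z" if "f \<in> hom K x y" "g \<in> hom K y z" for f g x y z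
    proof -
      obtain f' g' where "f = e2 f'" "f' \<in> Arr J" "x = e1 (Dom J f')" "y = e1 (Cod J f')"
        "g = e2 g'" "g' \<in> Arr J" "y = e1 (Dom J g')" "z = e1 (Cod J g')"
        using \<open>f \<in> hom K x y\<close> \<open>g \<in> hom K y z\<close> unfolding homK by blast
      moreover from this have "Cod J f' = Dom J g'"
        using e1_eq J.Dom_Obj J.Cod_Obj by metis
      ultimately show ?thesis
        using comp[of f' g'] unfolding homK by (auto simp: K_def i2)
    qed
    show "(h \<cdot>\<^bsub>K\<^esub> g) \<cdot>\<^bsub>K\<^esub> f = h \<cdot>\<^bsub>K\<^esub> (g \<cdot>\<^bsub>K\<^esub> f)"
      if "f \<in> hom K w x" "g \<in> hom K x y" "h \<in> hom K y z" for f g h w x y z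
    proof -
      obtain f' g' h' where "f = e2 f'" "f' \<in> Arr J" "x = e1 (Cod J f')"
        "g = e2 g'" "g' \<in> Arr J" "x = e1 (Dom J g')" "y = e1 (Cod J g')"
        "h = e2 h'" "h' \<in> Arr J" "y = e1 (Dom J h')"
        using \<open>f \<in> hom K w x\<close> \<open>g \<in> hom K x y\<close> \<open>h \<in> hom K y z\<close> unfolding homK by blast
      moreover from this have "Cod J f' = Dom J g'" "Cod J g' = Dom J h'"
        using e1_eq J.Dom_Obj J.Cod_Obj by metis+
      ultimately show ?thesis
        using comp[of f' g'] comp[of g' h']
          J.Comp_assoc[of f' "Dom J f'" "Cod J f'" g' "Cod J g'" h' "Cod J h'"]
        by (simp add: K_def i2 hom_def)
    qed
    show "f \<cdot>\<^bsub>K\<^esub> Id K x = f" "Id K y \<cdot>\<^bsub>K\<^esub> f = f" if "f \<in> hom K x y" for f x y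
    proof -
      obtain f' where "f = e2 f'" "f' \<in> Arr J" "x = e1 (Dom J f')" "y = e1 (Cod J f')"
        using \<open>f \<in> hom K x y\<close> unfolding homK by blast
      then show "f \<cdot>\<^bsub>K\<^esub> Id K x = f" "Id K y \<cdot>\<^bsub>K\<^esub> f = f"
        using Id J.Dom_Obj J.Cod_Obj J.Comp_Id[of f' "Dom J f'" "Cod J f'"]
          J.Id_Comp[of f' "Dom J f'" "Cod J f'"]
        by (simp_all add: K_def i1 i2 hom_def)
    qed
  qed
  have K: "small_category TYPE('v) K"
    using catK J small_image[of "TYPE('v)" "Obj J" e1] small_image[of "TYPE('v)" "Arr J" e2]
    unfolding small_category_def K_def by simp
  define F' where "F' = \<lparr>fobj = (\<lambda>v. fobj F (i1 v)), farr = (\<lambda>v. farr F (i2 v))\<rparr>"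
  have F'_comp: "farr F' (g \<cdot>\<^bsub>K\<^esub> f) = farr F' g \<cdot>\<^bsub>D\<^esub> farr F' f"
    if "f \<in> Arr K" "g \<in> Arr K" "Cod K f = Dom K g" for f g
  proof -
    obtain f' g' where f': "f = e2 f'" "f' \<in> Arr J" and g': "g = e2 g'" "g' \<in> Arr J"
      using \<open>f \<in> Arr K\<close> \<open>g \<in> Arr K\<close> by (auto simp: K_def)
    then have "e1 (Cod J f') = e1 (Dom J g')"
      using that(3) by (simp add: K_def i2)
    then have "Cod J f' = Dom J g'"
      using e1_eq J.Dom_Obj J.Cod_Obj f' g' by metis
    then show ?thesis
      using comp[of f' g'] f' g' F unfolding is_functor_def by (simp add: K_def F'_def i2)
  qed
  have "is_functor K D F'"
    using F F'_comp J.Dom_Obj J.Cod_Obj Id unfolding is_functor_def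
    by (auto simp: K_def F'_def i1 i2)
  then obtain x l where "is_cocone K D F' x l"
    using colim K unfolding has_colimits_def is_colimit_def by blast
  then have "is_cocone J D F x (\<lambda>j. l (e1 j))"
    using J.Dom_Obj J.Cod_Obj unfolding is_cocone_def by (auto simp: K_def F'_def i1 i2)
  then show ?thesis by blast
qed


context presheaf_category
begin

section \<open>Subobjects and unions\<close>

lemma pullback_image_iff:
  assumes pb: "is_pullback E a m n k" and m: "m \<in> hom E A B" and k: "k \<in> hom E B B'" and n: "n \<in> hom E A' B'"
    and c: "c \<in> Obj C" and z: "z \<in> fobj B c"
  shows "z \<in> app m c ` fobj A c \<longleftrightarrow> app k c z \<in> app n c ` fobj A' c"
proof -
  have a: "a \<in> hom E A A'" and comm: "n \<odot> a = k \<odot> m"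
    using pb homD[OF m] homD[OF n] unfolding is_pullback_def comm_sq_def by auto
  show ?thesis
  proof
    assume "z \<in> app m c ` fobj A c"
    then obtain w where "w \<in> fobj A c" "z = app m c w" by blast
    then show "app k c z \<in> app n c ` fobj A' c"
      using comm_sq_app[OF a m n k comm c] app_in[OF a c] by (metis imageI)
  next
    assume "app k c z \<in> app n c ` fobj A' c"
    then obtain x where "x \<in> fobj A' c" "app n c x = app k c z" by auto
    then show "z \<in> app m c ` fobj A c"
      using pullback_elem[OF pb a m n k c _ z] by blast
  qed
qed

text \<open>Whether a square of subobjects over \<open>k\<close> is a pullback is a question about elements: as \<open>n\<close> is
  injective, the top side is forced, and so is its naturality.\<close>

lemma ex_pullback_square:
  assumes m: "m \<in> hom E A B" and n: "n \<in> hom E A' B'" and k: "k \<in> hom E B B'"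
    and m_inj: "injective m" and n_inj: "injective n"
    and iff: "\<And>c z. c \<in> Obj C \<Longrightarrow> z \<in> fobj B c \<Longrightarrow>
      z \<in> app m c ` fobj A c \<longleftrightarrow> app k c z \<in> app n c ` fobj A' c"
  shows "\<exists>a. is_pullback E a m n k"
proof -
  have o: "A \<in> Obj E" "A' \<in> Obj E" using m n hom_Obj by auto
  define u where "u c w = (THE x. x \<in> fobj A' c \<and> app n c x = app k c (app m c w))" for c w
  have u: "u c w \<in> fobj A' c \<and> app n c (u c w) = app k c (app m c w)"
    if c: "c \<in> Obj C" and w: "w \<in> fobj A c" for c w
  proof -
    obtain x where x: "x \<in> fobj A' c" "app n c x = app k c (app m c w)"
      using iff[OF c app_in[OF m c w]] w by auto
    show ?thesis
      unfolding u_def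
    proof (rule theI[where a = x])
      show "y = x" if "y \<in> fobj A' c \<and> app n c y = app k c (app m c w)" for y
        using injectiveD[OF n_inj n c, of y x] x that by simp
    qed (use x in blast)
  qed
  have a: "mk_map C A A' u \<in> hom E A A'"
  proof (rule mk_map_hom[OF o])
    fix d c g w assume g: "g \<in> hom C d c" and w: "w \<in> fobj A c"
    then have oc: "d \<in> Obj C" "c \<in> Obj C" using hom_Obj_C by auto
    have uw: "u c w \<in> fobj A' c" "app n c (u c w) = app k c (app m c w)" using u[OF oc(2) w] by auto
    have uv: "u d (act A g w) \<in> fobj A' d" "app n d (u d (act A g w)) = app k d (app m d (act A g w))"
      using u[OF oc(1) act_in[OF o(1) g w]] by auto
    have "app n d (u d (act A g w)) = app n d (act A' g (u c w))"
      unfolding uv(2) app_act[OF n g uw(1)] uw(2) app_act[OF m g w] app_act[OF k g app_in[OF m oc(2) w]] ..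
    then show "u d (act A g w) = act A' g (u c w)"
      using injectiveD[OF n_inj n oc(1) uv(1) act_in[OF o(2) g uw(1)]] by blast
  qed (use u in blast)
  have "is_pullback E (mk_map C A A' u) m n k"
  proof (rule pullbackI_elem[OF a m n k])
    show "n \<odot> mk_map C A A' u = k \<odot> m"
      by (rule map_eqI[OF comp_in_hom[OF a n] comp_in_hom[OF m k]])
        (simp add: app_comp[OF a n] app_comp[OF m k] app_mk_map u)
    fix c x z assume h: "c \<in> Obj C" "x \<in> fobj A' c" "z \<in> fobj B c" "app n c x = app k c z"
    then have "z \<in> app m c ` fobj A c"
      using iff by (metis imageI)
    then obtain w where w: "w \<in> fobj A c" "app m c w = z" by auto
    show "\<exists>!w. w \<in> fobj A c \<and> app (mk_map C A A' u) c w = x \<and> app m c w = z"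
    proof (rule ex1I[of _ w])
      show "w \<in> fobj A c \<and> app (mk_map C A A' u) c w = x \<and> app m c w = z"
        using w h u[OF h(1) w(1)] injectiveD[OF n_inj n h(1), of "u c w" x] by (simp add: app_mk_map)
      show "v = w" if "v \<in> fobj A c \<and> app (mk_map C A A' u) c v = x \<and> app m c v = z" for v
        using injectiveD[OF m_inj m h(1)] w that by simp
    qed
  qed
  then show ?thesis by blast
qed

text \<open>Two subobjects that cover \<open>U\<close> form a pushout with their intersection: maps out of them that agree
  on the intersection combine, element by element, to a map out of \<open>U\<close>.\<close>

lemma pushout_of_cover:
  assumes h: "a \<in> hom E P A" "m \<in> hom E P B" "p \<in> hom E A U" "q \<in> hom E B U"
    and pq: "p \<odot> a = q \<odot> m" and p_inj: "injective p" and q_inj: "injective q"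
    and meet: "\<And>c x z. \<lbrakk>c \<in> Obj C; x \<in> fobj A c; z \<in> fobj B c; app p c x = app q c z\<rbrakk> \<Longrightarrow>
      \<exists>w\<in>fobj P c. app a c w = x \<and> app m c w = z"
    and cover: "\<And>c v. \<lbrakk>c \<in> Obj C; v \<in> fobj U c\<rbrakk> \<Longrightarrow>
      (\<exists>x\<in>fobj A c. v = app p c x) \<or> (\<exists>z\<in>fobj B c. v = app q c z)"
  shows "is_pushout E a m p q"
  unfolding is_pushout_def
proof (intro conjI allI impI)
  note a = h(1) and m = h(2) and p = h(3) and q = h(4)
  have o: "A \<in> Obj E" "B \<in> Obj E" "U \<in> Obj E" using p q hom_Obj by auto
  show "comm_sq E a m p q" by (rule comm_sqI[OF m p a q pq])
  fix p' q' assume "comm_sq E a m p' q'"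
  then obtain X where p': "p' \<in> hom E A X" and q': "q' \<in> hom E B X" and pq': "p' \<odot> a = q' \<odot> m"
    using a m by (elim comm_sqE) (auto simp: hom_def)
  have X: "X \<in> Obj E" using p' hom_Obj by blast
  define R where "R c v y \<longleftrightarrow> (\<exists>x\<in>fobj A c. v = app p c x \<and> y = app p' c x) \<or>
    (\<exists>z\<in>fobj B c. v = app q c z \<and> y = app q' c z)" for c v y
  have R_ex: "\<exists>y. R c v y" if "c \<in> Obj C" "v \<in> fobj U c" for c v
    using cover[OF that] unfolding R_def by blast
  have agree: "app p' c x = app q' c z"
    if c: "c \<in> Obj C" and x: "x \<in> fobj A c" and z: "z \<in> fobj B c" and eq: "app p c x = app q c z" for c x z
  proof -
    obtain w where w: "w \<in> fobj P c" "app a c w = x" "app m c w = z"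
      using meet[OF c x z eq] by blast
    then show ?thesis
      using comm_sq_app[OF a m p' q' pq' c w(1)] by simp
  qed
  have R_un: "y = y'" if c: "c \<in> Obj C" and "R c v y" "R c v y'" for c v y y'
    using that(2,3) agree[OF c] injectiveD[OF p_inj p c] injectiveD[OF q_inj q c] unfolding R_def by metis
  define k where "k c v = (THE y. R c v y)" for c v
  have k_eq: "k c v = y" if "c \<in> Obj C" "R c v y" for c v y
    unfolding k_def using that R_un by blast
  have R_in: "y \<in> fobj X c" if "c \<in> Obj C" "R c v y" for c v y
    using that app_in[OF p' that(1)] app_in[OF q' that(1)] unfolding R_def by blast
  have R_act: "R d (act U g v) (act X g y)" if g: "g \<in> hom C d c" and R: "R c v y" for d c g v y
  proof -
    from R consider x where "x \<in> fobj A c" "v = app p c x" "y = app p' c x"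
      | z where "z \<in> fobj B c" "v = app q c z" "y = app q' c z"
      unfolding R_def by blast
    then show ?thesis
    proof cases
      case 1
      then have "act U g v = app p d (act A g x)" "act X g y = app p' d (act A g x)"
        by (simp_all add: app_act[OF p g] app_act[OF p' g])
      then show ?thesis
        using act_in[OF o(1) g 1(1)] unfolding R_def by blast
    next
      case 2
      then have "act U g v = app q d (act B g z)" "act X g y = app q' d (act B g z)"
        by (simp_all add: app_act[OF q g] app_act[OF q' g])
      then show ?thesis
        using act_in[OF o(2) g 2(1)] unfolding R_def by blast
    qed
  qed
  have K: "mk_map C U X k \<in> hom E U X"
  proof (rule mk_map_hom[OF o(3) X])
    show "k c v \<in> fobj X c" if "c \<in> Obj C" "v \<in> fobj U c" for c v
      using R_ex[OF that] k_eq R_in that by metis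
    show "k d (act U g v) = act X g (k c v)" if "g \<in> hom C d c" "v \<in> fobj U c" for d c g v
      using R_ex k_eq R_act[OF that(1)] hom_Obj_C[OF that(1)] that(2) by metis
  qed
  have kA: "k c (app p c x) = app p' c x" if "c \<in> Obj C" "x \<in> fobj A c" for c x
    using k_eq[OF that(1)] that(2) unfolding R_def by blast
  have kB: "k c (app q c z) = app q' c z" if "c \<in> Obj C" "z \<in> fobj B c" for c z
    using k_eq[OF that(1)] that(2) unfolding R_def by blast
  have 1: "mk_map C U X k \<odot> p = p'"
    by (rule map_eqI[OF comp_in_hom[OF p K] p']) (simp add: app_comp[OF p K] app_mk_map app_in[OF p] kA)
  have 2: "mk_map C U X k \<odot> q = q'"
    by (rule map_eqI[OF comp_in_hom[OF q K] q']) (simp add: app_comp[OF q K] app_mk_map app_in[OF q] kB)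
  have 3: "l = mk_map C U X k" if l: "l \<in> hom E U X" "l \<odot> p = p'" "l \<odot> q = q'" for l
  proof (rule map_eqI[OF l(1) K])
    fix c v assume c: "c \<in> Obj C" and v: "v \<in> fobj U c"
    have "app l c (app p c x) = k c (app p c x)" if "x \<in> fobj A c" for x
      using app_comp[OF p l(1) c that] l(2) kA[OF c that] by simp
    moreover have "app l c (app q c z) = k c (app q c z)" if "z \<in> fobj B c" for z
      using app_comp[OF q l(1) c that] l(3) kB[OF c that] by simp
    ultimately show "app l c v = app (mk_map C U X k) c v"
      using cover[OF c v] by (auto simp: app_mk_map c v)
  qed
  show "\<exists>!h. h \<in> hom E (Cod E p) (Cod E p') \<and> h \<odot> p = p' \<and> h \<odot> q = q'"
    unfolding conjunct2[OF conjunct2[OF homD[OF p]]] conjunct2[OF conjunct2[OF homD[OF p']]]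
    using K 1 2 3 by (intro ex1I[of _ "mk_map C U X k"]) blast+
qed

lemma ex_factor:
  assumes n: "n \<in> hom E A D" and u: "u \<in> hom E U D" and inj: "injective u"
    and img: "\<And>c x. c \<in> Obj C \<Longrightarrow> x \<in> fobj A c \<Longrightarrow> app n c x \<in> app u c ` fobj U c"
  shows "\<exists>p. p \<in> hom E A U \<and> u \<odot> p = n"
proof -
  have A: "A \<in> Obj E" using hom_Obj[OF n] by blast
  note I = Id_in_hom[OF A]
  have "\<exists>p. is_pullback E p (Id E A) u n"
  proof (rule ex_pullback_square[OF I u n _ inj])
    show "injective (Id E A)"
      using homD[OF I] unfolding injective_def by (auto simp: app_Id inj_on_def)
    show "x \<in> app (Id E A) c ` fobj A c \<longleftrightarrow> app n c x \<in> app u c ` fobj U c"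
      if "c \<in> Obj C" "x \<in> fobj A c" for c x
      using img[OF that] that app_Id[OF that] by (auto intro: image_eqI[of _ _ x])
  qed
  then show ?thesis
    using homD[OF I] homD[OF u] Comp_Id[OF n] unfolding is_pullback_def comm_sq_def by auto
qed

lemma ex_pushout_union:
  assumes pb: "is_pullback E a m n b" and n_inj: "injective n" and b_inj: "injective b"
  shows "\<exists>p q. is_pushout E a m p q"
proof -
  obtain P A B D where a: "a \<in> hom E P A" and m: "m \<in> hom E P B" and n: "n \<in> hom E A D" and b: "b \<in> hom E B D"
    and comm: "n \<odot> a = b \<odot> m"
    using pb unfolding is_pullback_def by (blast elim: comm_sqE)
  have o: "A \<in> Obj E" "B \<in> Obj E" "D \<in> Obj E" using n b hom_Obj by auto
  define Q where "Q c = app n c ` fobj A c \<union> app b c ` fobj B c" for c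
  have "\<exists>U u. u \<in> hom E U D \<and> injective u \<and> (\<forall>c\<in>Obj C. app u c ` fobj U c = Q c)"
  proof (rule ex_subpresheaf[OF o(3)])
    show "Q c \<subseteq> fobj D c" if "c \<in> Obj C" for c
      using app_in[OF n that] app_in[OF b that] by (auto simp: Q_def)
    show "act D g w \<in> Q d" if g: "g \<in> hom C d c" and w: "w \<in> Q c" for d c g w
    proof -
      have "act D g (app n c x) \<in> Q d" if "x \<in> fobj A c" for x
        using act_in[OF o(1) g that] unfolding app_act[OF n g that, symmetric] Q_def by blast
      moreover have "act D g (app b c z) \<in> Q d" if "z \<in> fobj B c" for z
        using act_in[OF o(2) g that] unfolding app_act[OF b g that, symmetric] Q_def by blast
      ultimately show ?thesis using w unfolding Q_def[of c] by blast
    qed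
  qed
  then obtain U u where u: "u \<in> hom E U D" and u_inj: "injective u"
    and img: "\<And>c. c \<in> Obj C \<Longrightarrow> app u c ` fobj U c = Q c"
    by blast
  obtain p where p: "p \<in> hom E A U" "u \<odot> p = n"
    using ex_factor[OF n u u_inj] img unfolding Q_def by blast
  obtain q where q: "q \<in> hom E B U" "u \<odot> q = b"
    using ex_factor[OF b u u_inj] img unfolding Q_def by blast
  have up: "app u c (app p c x) = app n c x" if "c \<in> Obj C" "x \<in> fobj A c" for c x
    using app_comp[OF p(1) u that] p(2) by simp
  have uq: "app u c (app q c z) = app b c z" if "c \<in> Obj C" "z \<in> fobj B c" for c z
    using app_comp[OF q(1) u that] q(2) by simp
  have "is_pushout E a m p q"
  proof (rule pushout_of_cover[OF a m p(1) q(1)])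
    show "p \<odot> a = q \<odot> m"
    proof (rule map_eqI[OF comp_in_hom[OF a p(1)] comp_in_hom[OF m q(1)]])
      fix c v assume cv: "c \<in> Obj C" "v \<in> fobj P c"
      show "app (p \<odot> a) c v = app (q \<odot> m) c v"
        unfolding app_comp[OF a p(1) cv] app_comp[OF m q(1) cv]
        using comm_sq_app[OF a m n b comm cv] up uq app_in[OF a cv] app_in[OF m cv] cv(1)
          injectiveD[OF u_inj u cv(1) app_in[OF p(1) cv(1)] app_in[OF q(1) cv(1)]] by simp
    qed
    show "injective p"
      unfolding injective_def conjunct1[OF conjunct2[OF homD[OF p(1)]]]
      using up injectiveD[OF n_inj n] by (intro ballI inj_onI) metis
    show "injective q"
      unfolding injective_def conjunct1[OF conjunct2[OF homD[OF q(1)]]]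
      using uq injectiveD[OF b_inj b] by (intro ballI inj_onI) metis
    show "\<exists>w\<in>fobj P c. app a c w = x \<and> app m c w = z"
      if h: "c \<in> Obj C" "x \<in> fobj A c" "z \<in> fobj B c" and eq: "app p c x = app q c z" for c x z
      using pullback_elem[OF pb a m n b h] up[OF h(1,2)] uq[OF h(1,3)] eq by auto
    show "(\<exists>x\<in>fobj A c. v = app p c x) \<or> (\<exists>z\<in>fobj B c. v = app q c z)"
      if c: "c \<in> Obj C" and v: "v \<in> fobj U c" for c v
    proof -
      have "app u c v \<in> Q c" using img[OF c] v by blast
      then consider x where "x \<in> fobj A c" "app u c v = app n c x" | z where "z \<in> fobj B c" "app u c v = app b c z"
        unfolding Q_def by blast
      then show ?thesis
        using up[OF c] uq[OF c] injectiveD[OF u_inj u c v] app_in[OF p(1) c] app_in[OF q(1) c] by metis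
    qed
  qed
  then show ?thesis by blast
qed

lemma injective_pullback:
  assumes pb: "is_pullback E a m n k" and n: "n \<in> hom E A' B'" and inj: "injective n"
  shows "injective m"
  unfolding injective_def
proof (intro ballI inj_onI)
  fix c x y assume h: "c \<in> Obj C" "x \<in> fobj (Dom E m) c" "y \<in> fobj (Dom E m) c" "app m c x = app m c y"
  obtain A B where m: "m \<in> hom E A B" and a: "a \<in> hom E A A'" and k: "k \<in> hom E B B'"
    and comm: "n \<odot> a = k \<odot> m"
    using pb homD[OF n] unfolding is_pullback_def comm_sq_def hom_def by auto
  have xy: "x \<in> fobj A c" "y \<in> fobj A c" using h homD[OF m] by auto
  have ax: "app a c x = app a c y"
  proof (rule injectiveD[OF inj n h(1) app_in[OF a h(1) xy(1)] app_in[OF a h(1) xy(2)]])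
    show "app n c (app a c x) = app n c (app a c y)"
      unfolding comm_sq_app[OF a m n k comm h(1) xy(1)] comm_sq_app[OF a m n k comm h(1) xy(2)] h(4) ..
  qed
  have "\<exists>!w. w \<in> fobj A c \<and> app a c w = app a c x \<and> app m c w = app m c x"
    using pullback_elem[OF pb a m n k h(1) app_in[OF a h(1) xy(1)] app_in[OF m h(1) xy(1)]
        comm_sq_app[OF a m n k comm h(1) xy(1)]] .
  then show "x = y"
    using xy h(4) ax by metis
qed

section \<open>The restrictions of a subobject to representables\<close>

definition restr_choice :: "('o, 'm, 'v) psh_map \<Rightarrow> 'o \<Rightarrow> 'v \<Rightarrow> ('o, 'm, 'v) psh_map \<times> ('o, 'm, 'v) psh_map" where
  "restr_choice m c b = (SOME (a, r). is_pullback E a r m (yon (Cod E m) c b))"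

definition restr_top :: "('o, 'm, 'v) psh_map \<Rightarrow> 'o \<Rightarrow> 'v \<Rightarrow> ('o, 'm, 'v) psh_map" where
  "restr_top m c b = fst (restr_choice m c b)"

definition restr :: "('o, 'm, 'v) psh_map \<Rightarrow> 'o \<Rightarrow> 'v \<Rightarrow> ('o, 'm, 'v) psh_map" where
  "restr m c b = snd (restr_choice m c b)"

lemma restr_spec:
  assumes m: "m \<in> hom E A B" and c: "c \<in> Obj C" and b: "b \<in> fobj B c"
  shows restr_pullback: "is_pullback E (restr_top m c b) (restr m c b) m (yon B c b)"
    and restr_hom: "restr m c b \<in> hom E (Dom E (restr m c b)) (yo c)"
    and restr_top_hom: "restr_top m c b \<in> hom E (Dom E (restr m c b)) A"
    and restr_comm: "m \<odot> restr_top m c b = yon B c b \<odot> restr m c b"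
proof -
  have y: "yon B c b \<in> hom E (yo c) B" using yon_hom hom_Obj[OF m] c b by blast
  obtain P a r where "is_pullback E a r m (yon B c b)" using ex_pullback[OF m y] .
  then have "case restr_choice m c b of (a, r) \<Rightarrow> is_pullback E a r m (yon (Cod E m) c b)"
    unfolding restr_choice_def by (intro someI[of "\<lambda>(a, r). is_pullback E a r m (yon (Cod E m) c b)" "(a, r)"])
      (use homD[OF m] in simp)
  then show pb: "is_pullback E (restr_top m c b) (restr m c b) m (yon B c b)"
    using homD[OF m] by (simp add: restr_top_def restr_def case_prod_beta)
  then show "restr m c b \<in> hom E (Dom E (restr m c b)) (yo c)"
    "restr_top m c b \<in> hom E (Dom E (restr m c b)) A"
    "m \<odot> restr_top m c b = yon B c b \<odot> restr m c b"
    using homD[OF m] homD[OF y] unfolding is_pullback_def comm_sq_def by (auto simp: hom_def)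
qed

lemma restr_image_iff:
  assumes m: "m \<in> hom E A B" and c: "c \<in> Obj C" and b: "b \<in> fobj B c"
    and d: "d \<in> Obj C" and z: "z \<in> fobj (yo c) d"
  shows "z \<in> app (restr m c b) d ` fobj (Dom E (restr m c b)) d \<longleftrightarrow>
    app (yon B c b) d z \<in> app m d ` fobj A d"
  using pullback_image_iff[OF restr_pullback[OF m c b] restr_hom[OF m c b] yon_hom m d z]
    hom_Obj[OF m] c b by blast

text \<open>Restrictions of an injective map are injective, so this top side is determined by the bottom side
  \<open>yo_arr g\<close>; hence the squares for composable arrows compose.\<close>

definition restr_sq :: "('o, 'm, 'v) psh_map \<Rightarrow> 'm \<Rightarrow> 'v \<Rightarrow> ('o, 'm, 'v) psh_map" where
  "restr_sq m g b = (SOME a. is_pullback E a (restr m (Dom C g) (act (Cod E m) g b)) (restr m (Cod C g) b) (yo_arr g))"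

lemma restr_sq_spec:
  assumes m: "m \<in> hom E A B" and inj: "injective m" and g: "g \<in> hom C d c" and b: "b \<in> fobj B c"
  shows restr_sq_pullback: "is_pullback E (restr_sq m g b) (restr m d (act B g b)) (restr m c b) (yo_arr g)"
    and restr_sq_hom: "restr_sq m g b \<in> hom E (Dom E (restr m d (act B g b))) (Dom E (restr m c b))"
    and restr_sq_comm: "restr m c b \<odot> restr_sq m g b = yo_arr g \<odot> restr m d (act B g b)"
    and restr_sq_top: "restr_top m c b \<odot> restr_sq m g b = restr_top m d (act B g b)"
proof -
  have oc: "d \<in> Obj C" "c \<in> Obj C" using g hom_Obj_C by auto
  have o: "A \<in> Obj E" "B \<in> Obj E" using m hom_Obj by auto
  note bg = act_in[OF o(2) g b]
  note r = restr_hom[OF m oc(2) b] and r' = restr_hom[OF m oc(1) bg] and y = yo_arr_hom[OF g]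
  note yb = yon_hom[OF o(2) oc(2) b] and ybg = yon_hom[OF o(2) oc(1) bg]
  have "\<exists>a. is_pullback E a (restr m d (act B g b)) (restr m c b) (yo_arr g)"
  proof (rule ex_pullback_square[OF r' r y])
    show "injective (restr m d (act B g b))" "injective (restr m c b)"
      using injective_pullback[OF restr_pullback m inj] m oc b bg by blast+
    fix e z assume e: "e \<in> Obj C" and z: "z \<in> fobj (yo d) e"
    show "z \<in> app (restr m d (act B g b)) e ` fobj (Dom E (restr m d (act B g b))) e \<longleftrightarrow>
      app (yo_arr g) e z \<in> app (restr m c b) e ` fobj (Dom E (restr m c b)) e"
      unfolding restr_image_iff[OF m oc(1) bg e z] restr_image_iff[OF m oc(2) b e app_in[OF y e z]]
        yon_yo_arr[OF o(2) g b, symmetric] app_comp[OF y yb e z] ..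
  qed
  then show pb: "is_pullback E (restr_sq m g b) (restr m d (act B g b)) (restr m c b) (yo_arr g)"
    using homD[OF g] homD[OF m] someI_ex[of "\<lambda>a. is_pullback E a (restr m d (act B g b)) (restr m c b) (yo_arr g)"]
    unfolding restr_sq_def by simp
  then show s: "restr_sq m g b \<in> hom E (Dom E (restr m d (act B g b))) (Dom E (restr m c b))"
    and comm: "restr m c b \<odot> restr_sq m g b = yo_arr g \<odot> restr m d (act B g b)"
    unfolding is_pullback_def comm_sq_def by auto
  note t = restr_top_hom[OF m oc(2) b] and t' = restr_top_hom[OF m oc(1) bg]
  show "restr_top m c b \<odot> restr_sq m g b = restr_top m d (act B g b)"
  proof (rule map_eqI[OF comp_in_hom[OF s t] t'])
    fix e w assume e: "e \<in> Obj C" and w: "w \<in> fobj (Dom E (restr m d (act B g b))) e"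
    note sw = app_in[OF s e w]
    have "app m e (app (restr_top m c b) e (app (restr_sq m g b) e w)) =
        app (yon B c b) e (app (yo_arr g) e (app (restr m d (act B g b)) e w))"
      using comm_sq_app[OF t r m yb restr_comm[OF m oc(2) b] e sw] comm_sq_app[OF s r' r y comm e w] by simp
    also have "\<dots> = app m e (app (restr_top m d (act B g b)) e w)"
      using comm_sq_app[OF t' r' m ybg restr_comm[OF m oc(1) bg] e w]
        app_comp[OF y yb e app_in[OF r' e w]] by (simp add: yon_yo_arr[OF o(2) g b])
    finally show "app (restr_top m c b \<odot> restr_sq m g b) e w = app (restr_top m d (act B g b)) e w"
      unfolding app_comp[OF s t e w]
      by (intro injectiveD[OF inj m e app_in[OF t e sw] app_in[OF t' e w]])
  qed
qed

text \<open>The category of elements of a presheaf: an arrow \<open>(g, b)\<close> goes from \<open>b \<cdot> g\<close> to \<open>b\<close>.\<close>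

definition elements :: "('o, 'm, 'v) psh \<Rightarrow> ('o \<times> 'v, 'm \<times> 'v) cat" where
  "elements B = \<lparr>Obj = {(c, b). c \<in> Obj C \<and> b \<in> fobj B c},
    Arr = {(g, b). g \<in> Arr C \<and> b \<in> fobj B (Cod C g)},
    Dom = (\<lambda>(g, b). (Dom C g, act B g b)),
    Cod = (\<lambda>(g, b). (Cod C g, b)),
    Id = (\<lambda>(c, b). (Id C c, b)),
    Comp = (\<lambda>(g, b) (h, b'). (g \<cdot>\<^bsub>C\<^esub> h, b))\<rparr>"

lemma elements_hom: "gb \<in> hom (elements B) x y \<longleftrightarrow>
    (\<exists>g. gb = (g, snd y) \<and> snd y \<in> fobj B (fst y) \<and> g \<in> hom C (fst x) (fst y) \<and> snd x = act B g (snd y))"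
proof (cases gb)
  case (Pair g b)
  show ?thesis
    unfolding Pair by (cases x; cases y; simp add: elements_def hom_def; metis)
qed

lemma small_elements:
  assumes B: "B \<in> Obj E"
  shows "small_category TYPE('v) (elements B)"
proof -
  have hom: "g \<in> hom C (Dom C g) (Cod C g)" if "g \<in> Arr C" for g using that by (simp add: hom_def)
  have "category (elements B)"
  proof
    show "Dom (elements B) f \<in> Obj (elements B)" "Cod (elements B) f \<in> Obj (elements B)"
      if "f \<in> Arr (elements B)" for f
      using that C.Dom_Obj C.Cod_Obj act_in[OF B hom] by (auto simp: elements_def)
    show "Id (elements B) x \<in> hom (elements B) x x" if "x \<in> Obj (elements B)" for x
      using that C.Id_hom act_Id[OF B] unfolding elements_hom by (auto simp: elements_def)
    show "g \<cdot>\<^bsub>elements B\<^esub> f \<in> hom (elements B) x z"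
      if "f \<in> hom (elements B) x y" "g \<in> hom (elements B) y z" for f g x y z
    proof -
      obtain f' g' where f: "f = (f', snd y)" "f' \<in> hom C (fst x) (fst y)" "snd x = act B f' (snd y)"
        and g: "g = (g', snd z)" "snd z \<in> fobj B (fst z)" "g' \<in> hom C (fst y) (fst z)" "snd y = act B g' (snd z)"
        using \<open>f \<in> hom (elements B) x y\<close> \<open>g \<in> hom (elements B) y z\<close> unfolding elements_hom by blast
      then show ?thesis
        using C.Comp_hom[OF f(2) g(3)] act_comp[OF B g(3) f(2) g(2)]
        unfolding elements_hom by (simp add: elements_def)
    qed
    show "(h \<cdot>\<^bsub>elements B\<^esub> g) \<cdot>\<^bsub>elements B\<^esub> f = h \<cdot>\<^bsub>elements B\<^esub> (g \<cdot>\<^bsub>elements B\<^esub> f)"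
      if "f \<in> hom (elements B) w x" "g \<in> hom (elements B) x y" "h \<in> hom (elements B) y z" for f g h w x y z
    proof -
      obtain f' g' h' where "f = (f', snd x)" "f' \<in> hom C (fst w) (fst x)"
        "g = (g', snd y)" "g' \<in> hom C (fst x) (fst y)" "h = (h', snd z)" "h' \<in> hom C (fst y) (fst z)"
        using \<open>f \<in> hom (elements B) w x\<close> \<open>g \<in> hom (elements B) x y\<close> \<open>h \<in> hom (elements B) y z\<close> unfolding elements_hom by blast
      then show ?thesis
        using C.Comp_assoc[of f' "fst w" "fst x" g' "fst y" h' "fst z"] by (simp add: elements_def)
    qed
    show "f \<cdot>\<^bsub>elements B\<^esub> Id (elements B) x = f" "Id (elements B) y \<cdot>\<^bsub>elements B\<^esub> f = f"
      if "f \<in> hom (elements B) x y" for f x y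
    proof -
      obtain f' where "f = (f', snd y)" "f' \<in> hom C (fst x) (fst y)"
        using \<open>f \<in> hom (elements B) x y\<close> unfolding elements_hom by blast
      then show "f \<cdot>\<^bsub>elements B\<^esub> Id (elements B) x = f" "Id (elements B) y \<cdot>\<^bsub>elements B\<^esub> f = f"
        using C.Comp_Id[of f' "fst x" "fst y"] C.Id_Comp[of f' "fst x" "fst y"]
        by (simp_all add: elements_def case_prod_beta)
    qed
  qed
  moreover have U: "small TYPE('v) (\<Union>c\<in>Obj C. fobj B c)"
    using C_small unfolding small_category_def
    by (intro small_UN[OF universe]) (auto intro: psh_small[OF B])
  have "small TYPE('v) (Obj (elements B))"
    by (rule small_subset[OF small_Times[OF universe _ U, of "Obj C"]])
      (use C_small in \<open>auto simp: elements_def small_category_def\<close>)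
  moreover have "small TYPE('v) (Arr (elements B))"
    by (rule small_subset[OF small_Times[OF universe _ U, of "Arr C"]])
      (use C_small C.Cod_Obj in \<open>auto simp: elements_def small_category_def\<close>)
  ultimately show ?thesis unfolding small_category_def by blast
qed

end


section \<open>Uniform lifting structures\<close>

text \<open>The structure of a right map for a full subcategory of the cartesian arrow category, given by
  its set \<open>S\<close> of objects.\<close>

definition uniform_lifts :: "('o, 'a) cat \<Rightarrow> 'a set \<Rightarrow> 'a \<Rightarrow> ('a \<Rightarrow> 'a \<Rightarrow> 'a \<Rightarrow> 'a) \<Rightarrow> bool" where
  "uniform_lifts E S f \<phi> \<longleftrightarrow>
    (\<forall>m\<in>S. \<forall>s t. comm_sq E s m f t \<longrightarrow> \<phi> m s t \<in> hom E (Cod E m) (Dom E f) \<and>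
      \<phi> m s t \<cdot>\<^bsub>E\<^esub> m = s \<and> f \<cdot>\<^bsub>E\<^esub> \<phi> m s t = t) \<and>
    (\<forall>m\<in>S. \<forall>m'\<in>S. \<forall>a b s t. is_pullback E a m' m b \<and> comm_sq E s m f t \<longrightarrow>
      \<phi> m s t \<cdot>\<^bsub>E\<^esub> b = \<phi> m' (s \<cdot>\<^bsub>E\<^esub> a) (t \<cdot>\<^bsub>E\<^esub> b))"

lemma uniform_lifts_subset: "uniform_lifts E S f \<phi> \<Longrightarrow> S' \<subseteq> S \<Longrightarrow> uniform_lifts E S' f \<phi>"
  unfolding uniform_lifts_def by blast


section \<open>Locality of the generating monomorphisms\<close>

locale cofibrations = presheaf_category C E
  for C :: "('o, 'm) cat"
    and E :: "(('o, 'm, 'v) psh, ('o, 'm, 'v) psh_map) cat" +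
  fixes M :: "('o, 'm, 'v) psh_map set"
  assumes M_Arr: "m \<in> M \<Longrightarrow> m \<in> Arr E"
    and M_inj: "m \<in> M \<Longrightarrow> injective m"
    and M_pullback: "n \<in> M \<Longrightarrow> is_pullback E a m n b \<Longrightarrow> m \<in> M"
    and M_colimits: "has_colimits TYPE('v) (full_sub (cart_arrow_cat E) M)"
begin

lemma M_hom: "m \<in> M \<Longrightarrow> m \<in> hom E (Dom E m) (Cod E m)"
  using M_Arr Arr_hom by blast

abbreviation "M_cat \<equiv> full_sub (cart_arrow_cat E) M"

lemma M_cat_simps:
  "Obj M_cat = M" "Arr M_cat = {s. is_pullback E (fst (und s)) (src s) (tgt s) (snd (und s)) \<and> src s \<in> M \<and> tgt s \<in> M}"
  "Dom M_cat = src" "Cod M_cat = tgt" "Id M_cat = (\<lambda>m. Mor m m (Id E (Dom E m), Id E (Cod E m)))"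
  "Comp M_cat = (\<lambda>s r. Mor (src r) (tgt s)
        (fst (und s) \<odot> fst (und r), snd (und s) \<odot> snd (und r)))"
  using M_Arr by (auto simp: full_sub_def cart_arrow_cat_def arrow_cat_def)

definition restr_functor where
  "restr_functor m = \<lparr>fobj = (\<lambda>(c, b). restr m c b),
    farr = (\<lambda>(g, b). Mor (restr m (Dom C g) (act (Cod E m) g b)) (restr m (Cod C g) b) (restr_sq m g b, yo_arr g))\<rparr>"

lemma restr_functor_is_functor:
  assumes m: "m \<in> hom E A B" and inj: "injective m"
    and rM: "\<And>c b. c \<in> Obj C \<Longrightarrow> b \<in> fobj B c \<Longrightarrow> restr m c b \<in> M"
  shows "is_functor (elements B) M_cat (restr_functor m)"
proof -
  have Cm: "Cod E m = B" using homD[OF m] by blast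
  have B: "B \<in> Obj E" using hom_Obj[OF m] by blast
  have rinj: "injective (restr m c b)" if "c \<in> Obj C" "b \<in> fobj B c" for c b
    using M_inj rM that by blast
  \<comment> \<open>Maps into the domain of a restriction are determined by their composite with it, so
    functoriality may be checked on the bottom sides.\<close>
  have uniq: "h = k"
    if r: "c \<in> Obj C" "b \<in> fobj B c" and h: "h \<in> hom E X (Dom E (restr m c b))"
      and k: "k \<in> hom E X (Dom E (restr m c b))"
      and eq: "restr m c b \<odot> h = restr m c b \<odot> k" for c b h k X
  proof (rule map_eqI[OF h k])
    fix d x assume d: "d \<in> Obj C" and x: "x \<in> fobj X d"
    note rh = restr_hom[OF m r]
    show "app h d x = app k d x"
      using injectiveD[OF rinj[OF r] rh d app_in[OF h d x] app_in[OF k d x]]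
        app_comp[OF h rh d x] app_comp[OF k rh d x] eq by simp
  qed
  have arr: "farr (restr_functor m) f \<in> hom M_cat (fobj (restr_functor m) (Dom (elements B) f))
      (fobj (restr_functor m) (Cod (elements B) f))" if f: "f \<in> Arr (elements B)" for f
  proof -
    obtain g b where gb: "f = (g, b)" "g \<in> Arr C" "b \<in> fobj B (Cod C g)"
      using f by (auto simp: elements_def)
    then have g: "g \<in> hom C (Dom C g) (Cod C g)" by (simp add: hom_def)
    show ?thesis
      using restr_sq_pullback[OF m inj g gb(3)] rM act_in[OF B g gb(3)] hom_Obj_C[OF g] gb
      by (simp add: hom_def M_cat_simps restr_functor_def elements_def Cm)
  qed
  have ident: "farr (restr_functor m) (Id (elements B) x) = Id M_cat (fobj (restr_functor m) x)"
    if x: "x \<in> Obj (elements B)" for x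
  proof -
    obtain c b where cb: "x = (c, b)" "c \<in> Obj C" "b \<in> fobj B c"
      using x by (auto simp: elements_def)
    note I = C.Id_hom[OF cb(2)] and r = restr_hom[OF m cb(2,3)]
    have bI: "act B (Id C c) b = b" using act_Id[OF B cb(2,3)] .
    have y: "yo_arr (Id C c) = Id E (yo c)"
      by (rule yo_map_eqI[OF cb(2) yo_arr_hom[OF I] Id_in_hom[OF yo_Obj[OF cb(2)]]])
        (simp add: app_yo_arr_gen[OF I] app_Id cb yo_gen_in act_Id yo_Obj)
    note s = restr_sq_hom[OF m inj I cb(3), unfolded bI]
    have D: "Dom E (restr m c b) \<in> Obj E" using hom_Obj[OF r] by blast
    have "restr_sq m (Id C c) b = Id E (Dom E (restr m c b))"
      by (rule uniq[OF cb(2,3) s Id_in_hom[OF D]])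
        (use restr_sq_comm[OF m inj I cb(3), unfolded bI y] Comp_Id[OF r] Id_Comp[OF r] in simp)
    then show ?thesis
      using cb bI y homD[OF I] homD[OF r] by (simp add: restr_functor_def elements_def M_cat_simps Cm)
  qed
  have comp: "farr (restr_functor m) (g \<cdot>\<^bsub>elements B\<^esub> f) = farr (restr_functor m) g \<cdot>\<^bsub>M_cat\<^esub> farr (restr_functor m) f"
    if gf: "f \<in> Arr (elements B)" "g \<in> Arr (elements B)" "Cod (elements B) f = Dom (elements B) g" for f g
  proof -
    obtain g' b where g': "g = (g', b)" "g' \<in> Arr C" and b: "b \<in> fobj B (Cod C g')"
      using gf(2) by (auto simp: elements_def)
    obtain f' where f': "f = (f', act B g' b)" "f' \<in> Arr C" "Cod C f' = Dom C g'"
      using gf(1,3) g' by (auto simp: elements_def)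
    have gh: "g' \<in> hom C (Dom C g') (Cod C g')" and fh: "f' \<in> hom C (Dom C f') (Dom C g')"
      using g' f' by (auto simp: hom_def)
    note gfh = C.Comp_hom[OF fh gh]
    have ab: "act B (g' \<cdot>\<^bsub>C\<^esub> f') b = act B f' (act B g' b)" using act_comp[OF B gh fh b] .
    have oc: "Cod C g' \<in> Obj C" "Dom C g' \<in> Obj C" "Dom C f' \<in> Obj C"
      using hom_Obj_C[OF gh] hom_Obj_C[OF fh] by auto
    have y: "yo_arr (g' \<cdot>\<^bsub>C\<^esub> f') = yo_arr g' \<odot> yo_arr f'"
      by (rule yo_map_eqI[OF oc(3) yo_arr_hom[OF gfh] comp_in_hom[OF yo_arr_hom[OF fh] yo_arr_hom[OF gh]]])
        (simp add: map_act_gen[OF yo_arr_hom[OF gh] fh] app_yo_arr_gen[OF gh] app_yo_arr_gen[OF gfh]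
          act_comp[OF yo_Obj[OF oc(1)] gh fh yo_gen_in[OF oc(1)]])
    have bg: "act B g' b \<in> fobj B (Dom C g')" using act_in[OF B gh b] .
    note sg = restr_sq_hom[OF m inj gh b] and sf = restr_sq_hom[OF m inj fh bg]
      and sgf = restr_sq_hom[OF m inj gfh b, unfolded ab]
    note r1 = restr_hom[OF m oc(1) b] and r2 = restr_hom[OF m oc(2) bg]
      and r3 = restr_hom[OF m oc(3) act_in[OF B fh bg]]
    have "restr_sq m (g' \<cdot>\<^bsub>C\<^esub> f') b = restr_sq m g' b \<odot> restr_sq m f' (act B g' b)"
    proof (rule uniq[OF oc(1) b sgf comp_in_hom[OF sf sg]])
      have "restr m (Cod C g') b \<odot> (restr_sq m g' b \<odot> restr_sq m f' (act B g' b)) =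
          (yo_arr g' \<odot> restr m (Dom C g') (act B g' b)) \<odot> restr_sq m f' (act B g' b)"
        using Comp_assoc[OF sf sg r1] restr_sq_comm[OF m inj gh b] by simp
      also have "\<dots> = yo_arr g' \<odot> (yo_arr f' \<odot> restr m (Dom C f') (act B f' (act B g' b)))"
        using Comp_assoc[OF sf r2 yo_arr_hom[OF gh]] restr_sq_comm[OF m inj fh bg] by simp
      also have "\<dots> = restr m (Cod C g') b \<odot> restr_sq m (g' \<cdot>\<^bsub>C\<^esub> f') b"
        using Comp_assoc[OF r3 yo_arr_hom[OF fh] yo_arr_hom[OF gh]]
          restr_sq_comm[OF m inj gfh b] y ab by simp
      finally show "restr m (Cod C g') b \<odot> restr_sq m (g' \<cdot>\<^bsub>C\<^esub> f') b =
          restr m (Cod C g') b \<odot> (restr_sq m g' b \<odot> restr_sq m f' (act B g' b))" ..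
    qed
    then show ?thesis
      using g' f' y ab homD[OF gfh] by (simp add: restr_functor_def elements_def M_cat_simps Cm)
  qed
  have "fobj (restr_functor m) x \<in> Obj M_cat" if "x \<in> Obj (elements B)" for x
    using that rM by (auto simp: elements_def M_cat_simps restr_functor_def)
  then show ?thesis
    using arr ident comp unfolding is_functor_def by blast
qed

text \<open>A subobject \<open>m\<close> of \<open>B\<close> is the colimit of its restrictions to the elements of \<open>B\<close>. If these are in
  \<open>M\<close>, they have some cocone in \<open>M\<close>; its legs being pullback squares, the vertex \<open>n\<close> pulls back to
  \<open>m\<close> along the induced map out of \<open>B\<close>, and \<open>M\<close> is closed under pullback.\<close>

lemma M_local:
  assumes m: "m \<in> hom E A B" and inj: "injective m"
    and rM: "\<And>c b. c \<in> Obj C \<Longrightarrow> b \<in> fobj B c \<Longrightarrow> restr m c b \<in> M"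
  shows "m \<in> M"
proof -
  have Cm: "Cod E m = B" using homD[OF m] by blast
  have B: "B \<in> Obj E" using hom_Obj[OF m] by blast
  obtain n l where cocone: "is_cocone (elements B) M_cat (restr_functor m) n l"
    using has_colimits_ex_cocone[OF M_colimits small_elements[OF B]
        restr_functor_is_functor[OF m inj rM]] by blast
  have n: "n \<in> M" using cocone by (simp add: is_cocone_def M_cat_simps)
  define A' B' where "A' = Dom E n" and "B' = Cod E n"
  have nh: "n \<in> hom E A' B'" using M_hom[OF n] by (simp add: A'_def B'_def)
  have B': "B' \<in> Obj E" using hom_Obj[OF nh] by blast
  define top where "top c b = fst (und (l (c, b)))" for c b
  define leg where "leg c b = snd (und (l (c, b)))" for c b
  have pb: "is_pullback E (top c b) (restr m c b) n (leg c b)" if "c \<in> Obj C" "b \<in> fobj B c" for c b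
  proof -
    have "l (c, b) \<in> hom M_cat (restr m c b) n"
      using cocone that unfolding is_cocone_def by (auto simp: elements_def restr_functor_def)
    then show ?thesis by (auto simp: hom_def M_cat_simps top_def leg_def)
  qed
  have legh: "leg c b \<in> hom E (yo c) B'" if "c \<in> Obj C" "b \<in> fobj B c" for c b
    using pb[OF that] homD[OF restr_hom[OF m that]] homD[OF nh]
    unfolding is_pullback_def comm_sq_def by auto
  have nat: "leg c b \<odot> yo_arr g = leg d (act B g b)" if g: "g \<in> hom C d c" and b: "b \<in> fobj B c" for d c g b
  proof -
    have "(g, b) \<in> Arr (elements B)" using g b by (auto simp: elements_def hom_def)
    then have "l (Cod (elements B) (g, b)) \<cdot>\<^bsub>M_cat\<^esub> farr (restr_functor m) (g, b) = l (Dom (elements B) (g, b))"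
      using cocone unfolding is_cocone_def by blast
    then have "l (c, b) \<cdot>\<^bsub>M_cat\<^esub> farr (restr_functor m) (g, b) = l (d, act B g b)"
      using homD[OF g] by (simp add: elements_def)
    then have "snd (und (l (c, b) \<cdot>\<^bsub>M_cat\<^esub> farr (restr_functor m) (g, b))) = leg d (act B g b)"
      by (simp add: leg_def)
    then show ?thesis by (simp add: M_cat_simps restr_functor_def leg_def)
  qed
  define k where "k = mk_map C B B' (\<lambda>c b. app (leg c b) c (yo_gen c))"
  have k: "k \<in> hom E B B'"
    unfolding k_def
  proof (rule mk_map_hom[OF B B'])
    show "app (leg c b) c (yo_gen c) \<in> fobj B' c" if "c \<in> Obj C" "b \<in> fobj B c" for c b
      using app_in[OF legh[OF that]] that yo_gen_in by blast
    show "app (leg d (act B g b)) d (yo_gen d) = act B' g (app (leg c b) c (yo_gen c))"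
      if "g \<in> hom C d c" "b \<in> fobj B c" for d c g b
      using map_act_gen[OF legh[OF _ that(2)] that(1)] nat[OF that] hom_Obj_C[OF that(1)] by simp
  qed
  have "\<exists>a. is_pullback E a m n k"
  proof (rule ex_pullback_square[OF m nh k inj M_inj[OF n]])
    fix c b assume c: "c \<in> Obj C" and b: "b \<in> fobj B c"
    show "b \<in> app m c ` fobj A c \<longleftrightarrow> app k c b \<in> app n c ` fobj A' c"
      using restr_image_iff[OF m c b c yo_gen_in[OF c]]
        pullback_image_iff[OF pb[OF c b] restr_hom[OF m c b] legh[OF c b] nh c yo_gen_in[OF c]]
        app_yon_gen[OF B c b] c b by (simp add: k_def app_mk_map)
  qed
  then show ?thesis using M_pullback[OF n] by blast
qed

definition sieve_at :: "('o, 'm, 'v) psh_map \<Rightarrow> 'o \<Rightarrow> 'v \<Rightarrow> 'm set" where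
  "sieve_at m c b = {g \<in> Arr C. Cod C g = c \<and> act (Cod E m) g b \<in> app m (Dom C g) ` fobj (Dom E m) (Dom C g)}"

text \<open>The subobjects in \<open>M\<close> are those whose characteristic map takes values in a fixed set of sieves:
  the restriction of \<open>m\<close> along \<open>b\<close> only depends on the sieve of \<open>b\<close>.\<close>

lemma M_sieve_local:
  assumes m: "m \<in> hom E A B" and inj: "injective m"
    and sieves: "\<And>c b. c \<in> Obj C \<Longrightarrow> b \<in> fobj B c \<Longrightarrow>
      \<exists>n\<in>M. \<exists>x\<in>fobj (Cod E n) c. sieve_at n c x = sieve_at m c b"
  shows "m \<in> M"
proof (rule M_local[OF m inj])
  fix c b assume c: "c \<in> Obj C" and b: "b \<in> fobj B c"
  obtain n x where n: "n \<in> M" and x: "x \<in> fobj (Cod E n) c" and eq: "sieve_at n c x = sieve_at m c b"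
    using sieves[OF c b] by blast
  note nh = M_hom[OF n]
  have o: "B \<in> Obj E" "Cod E n \<in> Obj E" using m nh hom_Obj by auto
  have "\<exists>a. is_pullback E a (restr m c b) n (yon (Cod E n) c x)"
  proof (rule ex_pullback_square[OF restr_hom[OF m c b] nh yon_hom[OF o(2) c x]
        injective_pullback[OF restr_pullback[OF m c b] m inj] M_inj[OF n]])
    fix d z assume d: "d \<in> Obj C" and z: "z \<in> fobj (yo c) d"
    obtain g where g: "g \<in> hom C d c" "z = act (yo c) g (yo_gen c)"
      using yo_elem[OF c d z] .
    have "g \<in> sieve_at n c x \<longleftrightarrow> g \<in> sieve_at m c b" unfolding eq ..
    then show "z \<in> app (restr m c b) d ` fobj (Dom E (restr m c b)) d \<longleftrightarrow>
        app (yon (Cod E n) c x) d z \<in> app n d ` fobj (Dom E n) d"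
      unfolding restr_image_iff[OF m c b d z] unfolding g(2) app_yon[OF g(1)]
      using homD[OF g(1)] homD[OF m] by (simp add: sieve_at_def)
  qed
  then show "restr m c b \<in> M" using M_pullback[OF n] by blast
qed


section \<open>Uniform lifts against the generating monomorphisms\<close>

lemma uniform_trivial_fibration_iff:
  assumes f: "f \<in> Arr E"
  shows "uniform_trivial_fibration E M f \<longleftrightarrow> (\<exists>\<phi>. uniform_lifts E M f \<phi>)"
proof -
  have "(\<forall>\<sigma>\<in>Arr M_cat. \<forall>s t a b. und \<sigma> = (a, b) \<and> comm_sq E s (tgt \<sigma>) f t \<longrightarrow>
      \<phi> (tgt \<sigma>) s t \<odot> b = \<phi> (src \<sigma>) (s \<odot> a) (t \<odot> b)) \<longleftrightarrow>
    (\<forall>m\<in>M. \<forall>m'\<in>M. \<forall>a b s t. is_pullback E a m' m b \<and> comm_sq E s m f t \<longrightarrow>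
      \<phi> m s t \<odot> b = \<phi> m' (s \<odot> a) (t \<odot> b))" (is "?L \<longleftrightarrow> ?R") for \<phi>
  proof
    assume L: ?L
    show ?R
    proof (intro ballI allI impI)
      fix m m' a b s t
      assume "m \<in> M" "m' \<in> M" "is_pullback E a m' m b \<and> comm_sq E s m f t"
      then show "\<phi> m s t \<odot> b = \<phi> m' (s \<odot> a) (t \<odot> b)"
        using bspec[OF L, of "Mor m' m (a, b)"] by (simp add: M_cat_simps)
    qed
  next
    assume R: ?R
    show ?L
    proof (intro ballI allI impI)
      fix \<sigma> s t a b
      assume "\<sigma> \<in> Arr M_cat" "und \<sigma> = (a, b) \<and> comm_sq E s (tgt \<sigma>) f t"
      then show "\<phi> (tgt \<sigma>) s t \<odot> b = \<phi> (src \<sigma>) (s \<odot> a) (t \<odot> b)"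
        using R by (simp add: M_cat_simps)
    qed
  qed
  then have "right_map_structure E M_cat id_functor f \<phi> \<longleftrightarrow> uniform_lifts E M f \<phi>" for \<phi>
    unfolding right_map_structure_def uniform_lifts_def id_functor_def by (simp add: M_cat_simps)
  then show ?thesis
    using f unfolding uniform_trivial_fibration_def right_map_def by blast
qed

text \<open>The value of the glued lift at \<open>b\<close> is that of the given lift against the restriction of \<open>m\<close> along \<open>b\<close>,
  taken at the generic element of the representable. Uniformity along the squares \<open>restr_sq\<close> makes
  these values natural in \<open>b\<close>.\<close>

lemma uniform_lifts_glue:
  assumes u: "uniform_lifts E {m \<in> M. representable C (Cod E m)} f \<phi>" and m: "m \<in> M"
  shows "has_rlp E m f"
  unfolding has_rlp_def
proof (intro allI impI)
  fix s t assume "comm_sq E s m f t"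
  then obtain A B X Y where s: "s \<in> hom E A X" and mh: "m \<in> hom E A B" and f: "f \<in> hom E X Y"
    and t: "t \<in> hom E B Y" and comm: "f \<odot> s = t \<odot> m"
    by (rule comm_sqE)
  have o: "B \<in> Obj E" "X \<in> Obj E" using mh f hom_Obj by auto
  note inj = M_inj[OF m]
  have rS: "restr m c b \<in> {m \<in> M. representable C (Cod E m)}" if "c \<in> Obj C" "b \<in> fobj B c" for c b
    using M_pullback[OF m restr_pullback[OF mh that]] homD[OF restr_hom[OF mh that]]
      yo_representable[OF that(1)] by simp
  define S where "S c b = s \<odot> restr_top m c b" for c b
  define T where "T c b = t \<odot> yon B c b" for c b
  have sq: "comm_sq E (S c b) (restr m c b) f (T c b)" if cb: "c \<in> Obj C" "b \<in> fobj B c" for c b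
  proof -
    note tp = restr_top_hom[OF mh cb] and r = restr_hom[OF mh cb] and y = yon_hom[OF o(1) cb]
    show ?thesis
      unfolding S_def T_def
    proof (rule comm_sqI[OF r f comp_in_hom[OF tp s] comp_in_hom[OF y t]])
      show "f \<odot> (s \<odot> restr_top m c b) = (t \<odot> yon B c b) \<odot> restr m c b"
        using Comp_assoc[OF tp s f] Comp_assoc[OF tp mh t] Comp_assoc[OF r y t]
          restr_comm[OF mh cb] comm by simp
    qed
  qed
  define L where "L c b = \<phi> (restr m c b) (S c b) (T c b)" for c b
  have L: "L c b \<in> hom E (yo c) X \<and> L c b \<odot> restr m c b = S c b \<and> f \<odot> L c b = T c b"
    if cb: "c \<in> Obj C" "b \<in> fobj B c" for c b
  proof -
    have "L c b \<in> hom E (Cod E (restr m c b)) (Dom E f) \<and> L c b \<odot> restr m c b = S c b \<and> f \<odot> L c b = T c b"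
      using u rS[OF cb] sq[OF cb] unfolding uniform_lifts_def L_def by blast
    then show ?thesis
      using homD[OF restr_hom[OF mh cb]] homD[OF f] by simp
  qed
  have L_nat: "L c b \<odot> yo_arr g = L d (act B g b)" if g: "g \<in> hom C d c" and b: "b \<in> fobj B c" for d c g b
  proof -
    have oc: "d \<in> Obj C" "c \<in> Obj C" using g hom_Obj_C by auto
    note bg = act_in[OF o(1) g b]
    have "L c b \<odot> yo_arr g = \<phi> (restr m d (act B g b)) (S c b \<odot> restr_sq m g b) (T c b \<odot> yo_arr g)"
      using u rS[OF oc(2) b] rS[OF oc(1) bg] restr_sq_pullback[OF mh inj g b] sq[OF oc(2) b]
      unfolding uniform_lifts_def L_def by blast
    moreover have "S c b \<odot> restr_sq m g b = S d (act B g b)"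
      unfolding S_def
      using Comp_assoc[OF restr_sq_hom[OF mh inj g b] restr_top_hom[OF mh oc(2) b] s]
        restr_sq_top[OF mh inj g b] by simp
    moreover have "T c b \<odot> yo_arr g = T d (act B g b)"
      unfolding T_def
      using Comp_assoc[OF yo_arr_hom[OF g] yon_hom[OF o(1) oc(2) b] t] yon_yo_arr[OF o(1) g b] by simp
    ultimately show ?thesis unfolding L_def by simp
  qed
  define h where "h = mk_map C B X (\<lambda>c b. app (L c b) c (yo_gen c))"
  have h: "h \<in> hom E B X"
    unfolding h_def
  proof (rule mk_map_hom[OF o])
    show "app (L c b) c (yo_gen c) \<in> fobj X c" if "c \<in> Obj C" "b \<in> fobj B c" for c b
      using app_in[OF conjunct1[OF L[OF that]]] that yo_gen_in by blast
    show "app (L d (act B g b)) d (yo_gen d) = act X g (app (L c b) c (yo_gen c))"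
      if "g \<in> hom C d c" "b \<in> fobj B c" for d c g b
    proof -
      have "c \<in> Obj C" using hom_Obj_C[OF that(1)] by blast
      then show ?thesis
        using map_act_gen[OF conjunct1[OF L[OF _ that(2)]] that(1)] L_nat[OF that] by simp
    qed
  qed
  have "h \<odot> m = s"
  proof (rule map_eqI[OF comp_in_hom[OF mh h] s])
    fix c a assume c: "c \<in> Obj C" and a: "a \<in> fobj A c"
    define b where "b = app m c a"
    have b: "b \<in> fobj B c" using app_in[OF mh c a] by (simp add: b_def)
    note tp = restr_top_hom[OF mh c b] and r = restr_hom[OF mh c b] and y = yon_hom[OF o(1) c b]
    have "app m c a = app (yon B c b) c (yo_gen c)"
      using app_yon_gen[OF o(1) c b] b_def by simp
    then obtain w where w: "w \<in> fobj (Dom E (restr m c b)) c" "app (restr_top m c b) c w = a"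
      "app (restr m c b) c w = yo_gen c"
      using pullback_elem[OF restr_pullback[OF mh c b] tp r mh y c a yo_gen_in[OF c]] by blast
    have "app (L c b) c (app (restr m c b) c w) = app s c (app (restr_top m c b) c w)"
      using L[OF c b] app_comp[OF r _ c w(1), of "L c b" X] app_comp[OF tp s c w(1)] by (simp add: S_def)
    then show "app (h \<odot> m) c a = app s c a"
      using w b c unfolding app_comp[OF mh h c a] by (simp add: h_def app_mk_map b_def[symmetric])
  qed
  moreover have "f \<odot> h = t"
  proof (rule map_eqI[OF comp_in_hom[OF h f] t])
    fix c b assume c: "c \<in> Obj C" and b: "b \<in> fobj B c"
    have "app f c (app (L c b) c (yo_gen c)) = app (T c b) c (yo_gen c)"
      using L[OF c b] app_comp[OF _ f c yo_gen_in[OF c], of "L c b"] by simp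
    also have "\<dots> = app t c b"
      unfolding T_def using app_comp[OF yon_hom[OF o(1) c b] t c yo_gen_in[OF c]] app_yon_gen[OF o(1) c b] by simp
    finally show "app (f \<odot> h) c b = app t c b"
      using b c unfolding app_comp[OF h f c b] by (simp add: h_def app_mk_map)
  qed
  ultimately show "\<exists>h\<in>hom E (Cod E m) (Dom E f). h \<odot> m = s \<and> f \<odot> h = t"
    using h homD[OF mh] homD[OF f] by auto
qed


section \<open>The universal lifting problem\<close>

text \<open>A lifting problem \<open>(s, t)\<close> of \<open>m\<close> against \<open>f\<close>, seen from an element \<open>b\<close> of the codomain of \<open>m\<close>: the
  element \<open>t b\<close> together with the graph of a partial section of \<open>f\<close> over it, defined on the sieve of
  those arrows that restrict \<open>b\<close> into the subobject \<open>m\<close>. Everything a filler has to respect at \<open>b\<close> is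
  recorded in it, while \<open>m\<close> itself is forgotten; this is what keeps the local problems a small set.\<close>

definition problem_at :: "('o, 'm, 'v) psh_map \<Rightarrow> ('o, 'm, 'v) psh_map \<Rightarrow> ('o, 'm, 'v) psh_map \<Rightarrow> 'o \<Rightarrow> 'v \<Rightarrow>
    'v \<times> ('m \<times> 'v) set" where
  "problem_at m s t c b = (app t c b, {(g, x). g \<in> Arr C \<and> Cod C g = c \<and>
    (\<exists>w\<in>fobj (Dom E m) (Dom C g). app m (Dom C g) w = act (Cod E m) g b \<and> x = app s (Dom C g) w)})"

definition local_problems :: "('o, 'm, 'v) psh_map \<Rightarrow> 'o \<Rightarrow> ('v \<times> ('m \<times> 'v) set) set" where
  "local_problems f c = {p. \<exists>m s t b. m \<in> M \<and> comm_sq E s m f t \<and> b \<in> fobj (Cod E m) c \<and> p = problem_at m s t c b}"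

definition restrict_problem :: "('o, 'm, 'v) psh_map \<Rightarrow> 'm \<Rightarrow> 'v \<times> ('m \<times> 'v) set \<Rightarrow> 'v \<times> ('m \<times> 'v) set" where
  "restrict_problem f g = (\<lambda>(y, R). (act (Cod E f) g y,
    {(h, x). h \<in> Arr C \<and> Cod C h = Dom C g \<and> (g \<cdot>\<^bsub>C\<^esub> h, x) \<in> R}))"

lemma local_problemsE:
  assumes "p \<in> local_problems f c" and f: "f \<in> hom E X Y"
  obtains m s t b A B where "m \<in> M" "m \<in> hom E A B" "s \<in> hom E A X" "t \<in> hom E B Y"
    "f \<odot> s = t \<odot> m" "b \<in> fobj B c" "p = problem_at m s t c b"
proof -
  obtain m s t b where "m \<in> M" "comm_sq E s m f t" "b \<in> fobj (Cod E m) c" "p = problem_at m s t c b"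
    using assms(1) unfolding local_problems_def by blast
  then show thesis
    using that[of m "Dom E m" "Cod E m" s t b] M_hom[of m] homD[OF f] unfolding comm_sq_def by simp
qed

lemma restrict_problem_at:
  assumes f: "f \<in> hom E X Y" and mh: "m \<in> hom E A B" and t: "t \<in> hom E B Y"
    and g: "g \<in> hom C d c" and b: "b \<in> fobj B c"
  shows "restrict_problem f g (problem_at m s t c b) = problem_at m s t d (act B g b)"
proof -
  have B: "B \<in> Obj E" using hom_Obj[OF mh] by blast
  have "h \<in> Arr C \<and> Cod C h = Dom C g \<and> (g \<cdot>\<^bsub>C\<^esub> h, x) \<in> snd (problem_at m s t c b) \<longleftrightarrow>
      (h, x) \<in> snd (problem_at m s t d (act B g b))" for h x
  proof (cases "h \<in> Arr C \<and> Cod C h = d")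
    case True
    then have hh: "h \<in> hom C (Dom C h) d" by (simp add: hom_def)
    show ?thesis
      using True homD[OF g] homD[OF mh] homD[OF C.Comp_hom[OF hh g]] act_comp[OF B g hh b]
      by (simp add: problem_at_def)
  next
    case False
    then show ?thesis
      using homD[OF g] by (auto simp: problem_at_def)
  qed
  then have "snd (restrict_problem f g (problem_at m s t c b)) = snd (problem_at m s t d (act B g b))"
    unfolding restrict_problem_def by (auto simp: case_prod_beta)
  moreover have "fst (restrict_problem f g (problem_at m s t c b)) = fst (problem_at m s t d (act B g b))"
    using homD[OF f] by (simp add: restrict_problem_def problem_at_def app_act[OF t g b])
  ultimately show ?thesis by (rule prod_eqI[rotated])
qed

lemma local_problem:
  assumes p: "p \<in> local_problems f c" and f: "f \<in> hom E X Y" and c: "c \<in> Obj C"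
  shows "fst p \<in> fobj Y c"
    and "(g, x) \<in> snd p \<Longrightarrow> g \<in> hom C (Dom C g) c \<and> x \<in> fobj X (Dom C g) \<and> app f (Dom C g) x = act Y g (fst p)"
    and "(g, x) \<in> snd p \<Longrightarrow> (g, x') \<in> snd p \<Longrightarrow> x = x'"
    and "(g, x) \<in> snd p \<Longrightarrow> h \<in> Arr C \<Longrightarrow> Cod C h = Dom C g \<Longrightarrow> (g \<cdot>\<^bsub>C\<^esub> h, act X h x) \<in> snd p"
    and "\<exists>n\<in>M. \<exists>b\<in>fobj (Cod E n) c. Domain (snd p) = sieve_at n c b"
proof -
  obtain m s t b A B where m: "m \<in> M" and mh: "m \<in> hom E A B" and s: "s \<in> hom E A X" and t: "t \<in> hom E B Y"
    and comm: "f \<odot> s = t \<odot> m" and b: "b \<in> fobj B c" and pb: "p = problem_at m s t c b"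
    by (rule local_problemsE[OF p f])
  have o: "A \<in> Obj E" "B \<in> Obj E" using hom_Obj[OF mh] by auto
  have graph: "(g, x) \<in> snd p \<longleftrightarrow> g \<in> Arr C \<and> Cod C g = c \<and>
      (\<exists>w\<in>fobj A (Dom C g). app m (Dom C g) w = act B g b \<and> x = app s (Dom C g) w)" for g x
    using homD[OF mh] by (simp add: pb problem_at_def)
  show "fst p \<in> fobj Y c" using app_in[OF t c b] by (simp add: pb problem_at_def)
  show "g \<in> hom C (Dom C g) c \<and> x \<in> fobj X (Dom C g) \<and> app f (Dom C g) x = act Y g (fst p)" if gx: "(g, x) \<in> snd p"
  proof -
    obtain w where w: "g \<in> Arr C" "Cod C g = c" "w \<in> fobj A (Dom C g)"
      "app m (Dom C g) w = act B g b" "x = app s (Dom C g) w"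
      using gx unfolding graph by blast
    have g: "g \<in> hom C (Dom C g) c" using w by (simp add: hom_def)
    have d: "Dom C g \<in> Obj C" using hom_Obj_C[OF g] by blast
    show ?thesis
      using w g app_in[OF s d w(3)] comm_sq_app[OF s mh f t comm d w(3)] app_act[OF t g b]
      by (simp add: pb problem_at_def)
  qed
  show "x = x'" if gx: "(g, x) \<in> snd p" "(g, x') \<in> snd p"
  proof -
    obtain w w' where w: "g \<in> Arr C" "w \<in> fobj A (Dom C g)" "w' \<in> fobj A (Dom C g)"
      "app m (Dom C g) w = app m (Dom C g) w'" "x = app s (Dom C g) w" "x' = app s (Dom C g) w'"
      using gx unfolding graph by auto
    show ?thesis
      using injectiveD[OF M_inj[OF m] mh C.Dom_Obj[OF w(1)] w(2-4)] w(5,6) by simp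
  qed
  show "(g \<cdot>\<^bsub>C\<^esub> h, act X h x) \<in> snd p" if gx: "(g, x) \<in> snd p" and h: "h \<in> Arr C" "Cod C h = Dom C g"
  proof -
    obtain w where w: "g \<in> Arr C" "Cod C g = c" "w \<in> fobj A (Dom C g)"
      "app m (Dom C g) w = act B g b" "x = app s (Dom C g) w"
      using gx unfolding graph by blast
    have g: "g \<in> hom C (Dom C g) c" and hh: "h \<in> hom C (Dom C h) (Dom C g)"
      using w h by (simp_all add: hom_def)
    have "app m (Dom C h) (act A h w) = act B (g \<cdot>\<^bsub>C\<^esub> h) b"
      using app_act[OF mh hh w(3)] act_comp[OF o(2) g hh b] w(4) by simp
    moreover have "act X h x = app s (Dom C h) (act A h w)"
      using app_act[OF s hh w(3)] w(5) by simp
    ultimately show ?thesis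
      unfolding graph using homD[OF C.Comp_hom[OF hh g]] act_in[OF o(1) hh w(3)] by auto
  qed
  have "g \<in> Domain (snd p) \<longleftrightarrow> g \<in> sieve_at m c b" for g
    using homD[OF mh] unfolding Domain_iff graph
    by (simp add: sieve_at_def image_iff eq_commute[of "act B g b"]) blast
  then have "Domain (snd p) = sieve_at m c b" by blast
  then show "\<exists>n\<in>M. \<exists>b\<in>fobj (Cod E n) c. Domain (snd p) = sieve_at n c b"
    using m b homD[OF mh] by blast
qed

lemma ex_universal_problem:
  assumes f: "f \<in> hom E X Y"
  shows "\<exists>T e i. encodes (local_problems f) (restrict_problem f) T e i"
proof (rule realize_presheaf)
  have o: "X \<in> Obj E" "Y \<in> Obj E" using f hom_Obj by auto
  show "small TYPE('v) (local_problems f c)" if c: "c \<in> Obj C" for c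
  proof -
    have "small TYPE('v) (\<Union>d\<in>Obj C. fobj X d)"
      using C_small unfolding small_category_def
      by (intro small_UN[OF universe]) (auto intro: psh_small[OF o(1)])
    then have "small TYPE('v) (Pow (Arr C \<times> (\<Union>d\<in>Obj C. fobj X d)))"
      using C_small unfolding small_category_def
      by (intro small_Pow[OF universe] small_Times[OF universe]) auto
    then have "small TYPE('v) (fobj Y c \<times> Pow (Arr C \<times> (\<Union>d\<in>Obj C. fobj X d)))"
      by (intro small_Times[OF universe] psh_small[OF o(2) c])
    moreover have "local_problems f c \<subseteq> fobj Y c \<times> Pow (Arr C \<times> (\<Union>d\<in>Obj C. fobj X d))"
    proof
      fix p assume p: "p \<in> local_problems f c"
      have "snd p \<subseteq> Arr C \<times> (\<Union>d\<in>Obj C. fobj X d)"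
      proof (rule subrelI)
        fix g x assume "(g, x) \<in> snd p"
        then show "(g, x) \<in> Arr C \<times> (\<Union>d\<in>Obj C. fobj X d)"
          using local_problem(2)[OF p f c, of g x] C.Dom_Obj[of g] homD[of g C "Dom C g" c] by blast
      qed
      then show "p \<in> fobj Y c \<times> Pow (Arr C \<times> (\<Union>d\<in>Obj C. fobj X d))"
        using local_problem(1)[OF p f c] by (simp add: mem_Times_iff)
    qed
    ultimately show ?thesis by (rule small_subset)
  qed
  show "restrict_problem f g p \<in> local_problems f d" if g: "g \<in> hom C d c" and p: "p \<in> local_problems f c" for d c g p
    using p f
  proof (rule local_problemsE)
    fix m s t b A B
    assume h: "m \<in> M" "m \<in> hom E A B" "s \<in> hom E A X" "t \<in> hom E B Y" "f \<odot> s = t \<odot> m"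
      "b \<in> fobj B c" "p = problem_at m s t c b"
    have "comm_sq E s m f t" by (rule comm_sqI[OF h(2) f h(3-5)])
    moreover have "act B g b \<in> fobj (Cod E m) d"
      using act_in[OF _ g h(6)] hom_Obj[OF h(2)] homD[OF h(2)] by simp
    ultimately show ?thesis
      unfolding h(7) restrict_problem_at[OF f h(2,4) g h(6)] local_problems_def using h(1) by blast
  qed
  show "restrict_problem f (Id C c) p = p" if c: "c \<in> Obj C" and p: "p \<in> local_problems f c" for c p
    using p f
  proof (rule local_problemsE)
    fix m s t b A B assume h: "m \<in> hom E A B" "t \<in> hom E B Y" "b \<in> fobj B c" "p = problem_at m s t c b"
    show ?thesis
      unfolding h(4) restrict_problem_at[OF f h(1,2) C.Id_hom[OF c] h(3)]
      using act_Id[OF _ c h(3)] hom_Obj[OF h(1)] by simp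
  qed
  show "restrict_problem f (g \<cdot>\<^bsub>C\<^esub> k) p = restrict_problem f k (restrict_problem f g p)"
    if g: "g \<in> hom C d c" and k: "k \<in> hom C e d" and p: "p \<in> local_problems f c" for c d e g k p
    using p f
  proof (rule local_problemsE)
    fix m s t b A B assume h: "m \<in> hom E A B" "t \<in> hom E B Y" "b \<in> fobj B c" "p = problem_at m s t c b"
    have B: "B \<in> Obj E" using hom_Obj[OF h(1)] by blast
    show ?thesis
      unfolding h(4) restrict_problem_at[OF f h(1,2) C.Comp_hom[OF k g] h(3)]
        restrict_problem_at[OF f h(1,2) g h(3)] restrict_problem_at[OF f h(1,2) k act_in[OF B g h(3)]]
        act_comp[OF B g k h(3)] ..
  qed
qed

text \<open>The presheaf \<open>T\<close> of local problems carries a lifting problem against \<open>f\<close>, posed by the subobject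
  \<open>m\<^sub>T\<close> of those partial sections that are total. It is in \<open>M\<close> by locality, and every lifting
  problem posed by some \<open>m \<in> M\<close> is its restriction along a map \<open>\<chi>\<close> from the codomain of \<open>m\<close>
  to \<open>T\<close> which is compatible with pullback squares. So a single lift against \<open>m\<^sub>T\<close>, composed with the
  maps \<open>\<chi>\<close>, gives uniform lifts against all of \<open>M\<close>.\<close>

lemma rlp_uniform_lifts:
  assumes f: "f \<in> hom E X Y" and rlp: "\<And>m. m \<in> M \<Longrightarrow> has_rlp E m f"
  shows "\<exists>\<phi>. uniform_lifts E M f \<phi>"
proof -
  have o: "X \<in> Obj E" "Y \<in> Obj E" using f hom_Obj by auto
  note ff = homD[OF f]
  let ?P = "local_problems f"
  obtain T e i where enc: "encodes ?P (restrict_problem f) T e i"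
    using ex_universal_problem[OF f] by blast
  note T = encodesD(1)[OF enc] and e_in = encodesD(2)[OF enc] and ie = encodesD(3)[OF enc]
    and i_in = encodesD(4)[OF enc] and ia = encodesD(6)[OF enc] and ea = encodes_act[OF enc]
  note P = local_problem[OF _ f]
  have restr_snd: "(h, x) \<in> snd (restrict_problem f g p) \<longleftrightarrow> h \<in> Arr C \<and> Cod C h = Dom C g \<and> (g \<cdot>\<^bsub>C\<^esub> h, x) \<in> snd p"
    and restr_fst: "fst (restrict_problem f g p) = act Y g (fst p)" for g h x p
    using ff by (auto simp: restrict_problem_def case_prod_beta)

  \<comment> \<open>A partial section is total when its sieve contains the identity; its value there then
    determines it.\<close>
  define Q where "Q c = {v \<in> fobj T c. Id C c \<in> Domain (snd (i c v))}" for c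
  have in_Q: "act T g v \<in> Q d \<longleftrightarrow> g \<in> Domain (snd (i c v))" if g: "g \<in> hom C d c" and v: "v \<in> fobj T c" for d c g v
    using act_in[OF T g v] C.Id_hom[of d] hom_Obj_C[OF g] homD[OF g] C.Comp_Id[OF g]
    unfolding Q_def ia[OF g v] Domain_iff mem_Collect_eq restr_snd by (auto simp: hom_def)
  have cl: "act T g v \<in> Q d" if g: "g \<in> hom C d c" and v: "v \<in> Q c" for d c g v
  proof -
    have oc: "d \<in> Obj C" "c \<in> Obj C" using g hom_Obj_C by auto
    have vT: "v \<in> fobj T c" using v by (simp add: Q_def)
    obtain x where "(Id C c, x) \<in> snd (i c v)" using v unfolding Q_def by blast
    then have "(Id C c \<cdot>\<^bsub>C\<^esub> g, act X g x) \<in> snd (i c v)"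
      using P(4)[OF i_in[OF oc(2) vT] oc(2), of "Id C c" x g] homD[OF g] homD[OF C.Id_hom[OF oc(2)]] by simp
    then show ?thesis
      unfolding in_Q[OF g vT] using C.Id_Comp[OF g] by auto
  qed
  have "\<exists>A m. m \<in> hom E A T \<and> injective m \<and> (\<forall>c\<in>Obj C. app m c ` fobj A c = Q c)"
    by (rule ex_subpresheaf[OF T]) (simp add: Q_def, fact cl)
  then obtain A\<^sub>T m\<^sub>T where mT: "m\<^sub>T \<in> hom E A\<^sub>T T" and mT_inj: "injective m\<^sub>T"
    and mT_img: "\<And>c. c \<in> Obj C \<Longrightarrow> app m\<^sub>T c ` fobj A\<^sub>T c = Q c"
    by blast
  have mT_M: "m\<^sub>T \<in> M"
  proof (rule M_sieve_local[OF mT mT_inj])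
    fix c v assume c: "c \<in> Obj C" and v: "v \<in> fobj T c"
    have "g \<in> sieve_at m\<^sub>T c v \<longleftrightarrow> g \<in> Domain (snd (i c v))" for g
    proof (cases "g \<in> hom C (Dom C g) c")
      case True
      then show ?thesis
        using in_Q[OF True v] mT_img hom_Obj_C[OF True] homD[OF mT] by (auto simp: sieve_at_def hom_def)
    next
      case False
      then show ?thesis
        using P(2)[OF i_in[OF c v] c] by (auto simp: sieve_at_def hom_def)
    qed
    then have "sieve_at m\<^sub>T c v = Domain (snd (i c v))" by blast
    then show "\<exists>n\<in>M. \<exists>x\<in>fobj (Cod E n) c. sieve_at n c x = sieve_at m\<^sub>T c v"
      using P(5)[OF i_in[OF c v] c] by metis
  qed

  define s\<^sub>T where "s\<^sub>T = mk_map C A\<^sub>T X (\<lambda>c w. THE x. (Id C c, x) \<in> snd (i c (app m\<^sub>T c w)))"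
  define t\<^sub>T where "t\<^sub>T = mk_map C T Y (\<lambda>c v. fst (i c v))"
  have A\<^sub>T: "A\<^sub>T \<in> Obj E" using mT hom_Obj by blast
  have the_eq: "(THE x. (Id C c, x) \<in> snd (i c v)) = x" if "c \<in> Obj C" "v \<in> fobj T c" "(Id C c, x) \<in> snd (i c v)" for c v x
    using that P(3)[OF i_in[OF that(1,2)] that(1)] by blast
  have tot: "\<exists>x. (Id C c, x) \<in> snd (i c (app m\<^sub>T c w))" if "c \<in> Obj C" "w \<in> fobj A\<^sub>T c" for c w
  proof -
    have "app m\<^sub>T c w \<in> Q c" using mT_img[OF that(1)] that(2) by blast
    then show ?thesis by (auto simp: Q_def)
  qed
  have sT: "s\<^sub>T \<in> hom E A\<^sub>T X"
    unfolding s\<^sub>T_def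
  proof (rule mk_map_hom[OF A\<^sub>T o(1)])
    fix c w assume c: "c \<in> Obj C" and w: "w \<in> fobj A\<^sub>T c"
    obtain x where x: "(Id C c, x) \<in> snd (i c (app m\<^sub>T c w))" using tot[OF c w] ..
    then show "(THE x. (Id C c, x) \<in> snd (i c (app m\<^sub>T c w))) \<in> fobj X c"
      using P(2)[OF i_in[OF c app_in[OF mT c w]] c x] homD[OF C.Id_hom[OF c]]
      unfolding the_eq[OF c app_in[OF mT c w] x] by simp
  next
    fix d c g w assume g: "g \<in> hom C d c" and w: "w \<in> fobj A\<^sub>T c"
    then have oc: "d \<in> Obj C" "c \<in> Obj C" using hom_Obj_C by auto
    obtain x where x: "(Id C c, x) \<in> snd (i c (app m\<^sub>T c w))" using tot[OF oc(2) w] ..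
    note mw = app_in[OF mT oc(2) w]
    have "(Id C c \<cdot>\<^bsub>C\<^esub> g, act X g x) \<in> snd (i c (app m\<^sub>T c w))"
      using P(4)[OF i_in[OF oc(2) mw] oc(2) x, of g] homD[OF g] homD[OF C.Id_hom[OF oc(2)]] by simp
    then have "(Id C d, act X g x) \<in> snd (i d (app m\<^sub>T d (act A\<^sub>T g w)))"
      unfolding app_act[OF mT g w] ia[OF g mw] restr_snd
      using C.Id_Comp[OF g] C.Comp_Id[OF g] homD[OF g] homD[OF C.Id_hom[OF oc(1)]] by simp
    then show "(THE x. (Id C d, x) \<in> snd (i d (app m\<^sub>T d (act A\<^sub>T g w)))) =
        act X g (THE x. (Id C c, x) \<in> snd (i c (app m\<^sub>T c w)))"
      using the_eq[OF oc(2) mw x] the_eq[OF oc(1) app_in[OF mT oc(1) act_in[OF A\<^sub>T g w]]] by simp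
  qed
  have tT: "t\<^sub>T \<in> hom E T Y"
    unfolding t\<^sub>T_def
  proof (rule mk_map_hom[OF T o(2)])
    show "fst (i c v) \<in> fobj Y c" if "c \<in> Obj C" "v \<in> fobj T c" for c v
      using P(1)[OF i_in[OF that] that(1)] .
    show "fst (i d (act T g v)) = act Y g (fst (i c v))" if "g \<in> hom C d c" "v \<in> fobj T c" for d c g v
      unfolding ia[OF that] restr_fst ..
  qed
  have sT_app: "app s\<^sub>T c w = x" if "c \<in> Obj C" "w \<in> fobj A\<^sub>T c" "(Id C c, x) \<in> snd (i c (app m\<^sub>T c w))" for c w x
    using the_eq[OF that(1) app_in[OF mT that(1,2)] that(3)] that by (simp add: s\<^sub>T_def app_mk_map)
  have tT_app: "app t\<^sub>T c v = fst (i c v)" if "c \<in> Obj C" "v \<in> fobj T c" for c v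
    using that by (simp add: t\<^sub>T_def app_mk_map)
  have "comm_sq E s\<^sub>T m\<^sub>T f t\<^sub>T"
  proof (rule comm_sqI[OF mT f sT tT], rule map_eqI[OF comp_in_hom[OF sT f] comp_in_hom[OF mT tT]])
    fix c w assume c: "c \<in> Obj C" and w: "w \<in> fobj A\<^sub>T c"
    obtain x where x: "(Id C c, x) \<in> snd (i c (app m\<^sub>T c w))" using tot[OF c w] ..
    note mw = app_in[OF mT c w]
    show "app (f \<odot> s\<^sub>T) c w = app (t\<^sub>T \<odot> m\<^sub>T) c w"
      unfolding app_comp[OF sT f c w] app_comp[OF mT tT c w] sT_app[OF c w x] tT_app[OF c mw]
      using P(2)[OF i_in[OF c mw] c x] homD[OF C.Id_hom[OF c]] act_Id[OF o(2) c P(1)[OF i_in[OF c mw] c]] by simp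
  qed
  then obtain h where h: "h \<in> hom E T X" "h \<odot> m\<^sub>T = s\<^sub>T" "f \<odot> h = t\<^sub>T"
    using rlp[OF mT_M] homD[OF mT] ff unfolding has_rlp_def by blast

  define \<chi> where "\<chi> m s t = mk_map C (Cod E m) T (\<lambda>c b. e c (problem_at m s t c b))"
    for m s t :: "('o, 'm, 'v) psh_map"
  have problem_in: "problem_at m s t c b \<in> ?P c"
    if "m \<in> M" and mh: "m \<in> hom E A B" and "s \<in> hom E A X" "t \<in> hom E B Y" "f \<odot> s = t \<odot> m"
      and "b \<in> fobj B c" for m s t A B c b
    using that comm_sqI[OF mh f that(3-5)] homD[OF mh] unfolding local_problems_def by blast
  have \<chi>: "\<chi> m s t \<in> hom E B T"
    if m: "m \<in> M" and mh: "m \<in> hom E A B" and s: "s \<in> hom E A X" and t: "t \<in> hom E B Y"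
      and comm: "f \<odot> s = t \<odot> m"
    for m s t A B
  proof -
    have oAB: "A \<in> Obj E" "B \<in> Obj E" using mh hom_Obj by auto
    note pin = problem_in[OF m mh s t comm]
    have "mk_map C B T (\<lambda>c b. e c (problem_at m s t c b)) \<in> hom E B T"
    proof (rule mk_map_hom[OF oAB(2) T])
      show "e c (problem_at m s t c b) \<in> fobj T c" if "c \<in> Obj C" "b \<in> fobj B c" for c b
        using e_in[OF that(1) pin[OF that(2)]] .
      show "e d (problem_at m s t d (act B g b)) = act T g (e c (problem_at m s t c b))"
        if g: "g \<in> hom C d c" and b: "b \<in> fobj B c" for d c g b
        unfolding ea[OF g pin[OF b]] restrict_problem_at[OF f mh t g b] ..
    qed
    then show ?thesis using homD[OF mh] by (simp add: \<chi>_def)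
  qed
  have \<chi>_app: "app (\<chi> m s t) c b = e c (problem_at m s t c b)" if "c \<in> Obj C" "b \<in> fobj (Cod E m) c" for m s t c b
    using that by (simp add: \<chi>_def app_mk_map)

  define \<phi> where "\<phi> m s t = h \<odot> \<chi> m s t" for m s t
  have lift: "\<phi> m s t \<in> hom E (Cod E m) (Dom E f) \<and> \<phi> m s t \<odot> m = s \<and> f \<odot> \<phi> m s t = t"
    if m: "m \<in> M" and sq: "comm_sq E s m f t" for m s t
  proof -
    obtain A B where mh: "m \<in> hom E A B" and s: "s \<in> hom E A X" and t: "t \<in> hom E B Y"
      and comm: "f \<odot> s = t \<odot> m"
      using sq ff by (elim comm_sqE) (auto simp: hom_def)
    note pin = problem_in[OF m mh s t comm] and x = \<chi>[OF m mh s t comm]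
    have Cm: "Cod E m = B" "Dom E m = A" using homD[OF mh] by auto
    have "(h \<odot> \<chi> m s t) \<odot> m = s"
    proof (rule map_eqI[OF comp_in_hom[OF mh comp_in_hom[OF x h(1)]] s])
      fix c a assume c: "c \<in> Obj C" and a: "a \<in> fobj A c"
      note ma = app_in[OF mh c a]
      define v where "v = e c (problem_at m s t c (app m c a))"
      have v: "v \<in> fobj T c" "i c v = problem_at m s t c (app m c a)"
        unfolding v_def using e_in[OF c pin[OF ma]] ie[OF c pin[OF ma]] by auto
      have x0: "(Id C c, app s c a) \<in> snd (i c v)"
        using homD[OF C.Id_hom[OF c]] a act_Id[OF _ c ma] hom_Obj[OF mh] by (auto simp: v(2) problem_at_def Cm)
      then have "v \<in> Q c" using v(1) by (auto simp: Q_def)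
      then obtain w where w: "w \<in> fobj A\<^sub>T c" "app m\<^sub>T c w = v"
        unfolding mT_img[OF c, symmetric] by auto
      have "app h c v = app s\<^sub>T c w"
        using app_comp[OF mT h(1) c w(1)] h(2) w(2) by simp
      also have "\<dots> = app s c a"
        using sT_app[OF c w(1)] x0 w(2) by simp
      finally show "app ((h \<odot> \<chi> m s t) \<odot> m) c a = app s c a"
        using app_comp[OF mh comp_in_hom[OF x h(1)] c a] app_comp[OF x h(1) c ma] \<chi>_app[OF c, of _ m] ma
        by (simp add: v_def Cm)
    qed
    moreover have "f \<odot> (h \<odot> \<chi> m s t) = t"
    proof (rule map_eqI[OF comp_in_hom[OF comp_in_hom[OF x h(1)] f] t])
      fix c b assume c: "c \<in> Obj C" and b: "b \<in> fobj B c"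
      have v: "e c (problem_at m s t c b) \<in> fobj T c" using e_in[OF c pin[OF b]] .
      have "app (f \<odot> (h \<odot> \<chi> m s t)) c b = app (f \<odot> h) c (e c (problem_at m s t c b))"
        using app_comp[OF comp_in_hom[OF x h(1)] f c b] app_comp[OF x h(1) c b] app_comp[OF h(1) f c v]
          \<chi>_app[OF c, of b m] b by (simp add: Cm)
      also have "\<dots> = app t c b"
        unfolding h(3) tT_app[OF c v] ie[OF c pin[OF b]] by (simp add: problem_at_def)
      finally show "app (f \<odot> (h \<odot> \<chi> m s t)) c b = app t c b" .
    qed
    ultimately show ?thesis
      using comp_in_hom[OF x h(1)] ff by (simp add: \<phi>_def Cm)
  qed
  have "\<phi> m s t \<odot> b = \<phi> m' (s \<odot> a) (t \<odot> b)"
    if m: "m \<in> M" and m': "m' \<in> M" and pb: "is_pullback E a m' m b" and sq: "comm_sq E s m f t" for m m' a b s t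
  proof -
    obtain A B where mh: "m \<in> hom E A B" and s: "s \<in> hom E A X" and t: "t \<in> hom E B Y"
      and comm: "f \<odot> s = t \<odot> m"
      using sq ff by (elim comm_sqE) (auto simp: hom_def)
    obtain A' B' where mh': "m' \<in> hom E A' B'" and a: "a \<in> hom E A' A" and b: "b \<in> hom E B' B"
      and comm': "m \<odot> a = b \<odot> m'"
      using pb homD[OF mh] unfolding is_pullback_def by (elim conjE comm_sqE) (auto simp: hom_def)
    have oB: "B \<in> Obj E" "B' \<in> Obj E" using b hom_Obj by auto
    note sa = comp_in_hom[OF a s] and tb = comp_in_hom[OF b t]
    have comm'': "f \<odot> (s \<odot> a) = (t \<odot> b) \<odot> m'"
      using Comp_assoc[OF a s f] Comp_assoc[OF a mh t] Comp_assoc[OF mh' b t] comm comm' by simp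
    note x = \<chi>[OF m mh s t comm] and x' = \<chi>[OF m' mh' sa tb comm'']
    have "\<chi> m s t \<odot> b = \<chi> m' (s \<odot> a) (t \<odot> b)"
    proof (rule map_eqI[OF comp_in_hom[OF b x] x'])
      fix c z assume c: "c \<in> Obj C" and z: "z \<in> fobj B' c"
      note bz = app_in[OF b c z]
      have "(\<exists>w\<in>fobj A d. app m d w = act B g (app b c z) \<and> y = app s d w) \<longleftrightarrow>
          (\<exists>w\<in>fobj A' d. app m' d w = act B' g z \<and> y = app (s \<odot> a) d w)"
        if g: "g \<in> hom C d c" for g d y
      proof -
        have d: "d \<in> Obj C" using hom_Obj_C[OF g] by blast
        note zg = act_in[OF oB(2) g z]
        have eq: "act B g (app b c z) = app b d (act B' g z)" using app_act[OF b g z] by simp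
        show ?thesis
        proof
          assume "\<exists>w\<in>fobj A d. app m d w = act B g (app b c z) \<and> y = app s d w"
          then obtain w where w: "w \<in> fobj A d" "app m d w = app b d (act B' g z)" "y = app s d w"
            using eq by auto
          obtain w' where "w' \<in> fobj A' d" "app a d w' = w" "app m' d w' = act B' g z"
            using pullback_elem[OF pb a mh' mh b d w(1) zg w(2)] by blast
          then show "\<exists>w\<in>fobj A' d. app m' d w = act B' g z \<and> y = app (s \<odot> a) d w"
            using w(3) app_comp[OF a s d] by auto
        next
          assume "\<exists>w\<in>fobj A' d. app m' d w = act B' g z \<and> y = app (s \<odot> a) d w"
          then obtain w where w: "w \<in> fobj A' d" "app m' d w = act B' g z" "y = app (s \<odot> a) d w"
            by blast
          have "app m d (app a d w) = act B g (app b c z)"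
            using comm_sq_app[OF a mh' mh b comm' d w(1)] w(2) eq by simp
          then show "\<exists>w\<in>fobj A d. app m d w = act B g (app b c z) \<and> y = app s d w"
            using app_in[OF a d w(1)] w(3) app_comp[OF a s d w(1)] by auto
        qed
      qed
      then have "problem_at m s t c (app b c z) = problem_at m' (s \<odot> a) (t \<odot> b) c z"
        using homD[OF mh] homD[OF mh'] app_comp[OF b t c z] by (auto simp: problem_at_def hom_def)
      then show "app (\<chi> m s t \<odot> b) c z = app (\<chi> m' (s \<odot> a) (t \<odot> b)) c z"
        using app_comp[OF b x c z] \<chi>_app[OF c, of "app b c z" m] \<chi>_app[OF c, of z m'] bz z homD[OF mh] homD[OF mh']
        by simp
    qed
    then show ?thesis
      unfolding \<phi>_def using Comp_assoc[OF b x h(1)] by simp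
  qed
  with lift have "uniform_lifts E M f \<phi>"
    unfolding uniform_lifts_def by blast
  then show ?thesis by blast
qed

text \<open>The properties imply each other in a circle: by the universal lifting problem, by restriction to
  fewer maps, and by gluing.\<close>

lemma rlp_iff_uniform_lifts:
  assumes f: "f \<in> Arr E"
  shows "(\<forall>m\<in>M. has_rlp E m f) \<longleftrightarrow> (\<exists>\<phi>. uniform_lifts E M f \<phi>)"
    and "(\<forall>m\<in>M. has_rlp E m f) \<longleftrightarrow> (\<exists>\<phi>. uniform_lifts E {m \<in> M. representable C (Cod E m)} f \<phi>)"
proof -
  have fh: "f \<in> hom E (Dom E f) (Cod E f)" using f Arr_hom by blast
  let ?S = "{m \<in> M. representable C (Cod E m)}"
  have 1: "(\<forall>m\<in>M. has_rlp E m f) \<longrightarrow> (\<exists>\<phi>. uniform_lifts E M f \<phi>)"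
    by (intro impI rlp_uniform_lifts[OF fh]) (erule bspec)
  have 2: "(\<exists>\<phi>. uniform_lifts E M f \<phi>) \<longrightarrow> (\<exists>\<phi>. uniform_lifts E ?S f \<phi>)"
    by (intro impI, elim exE, rule exI, erule uniform_lifts_subset) simp
  have 3: "(\<exists>\<phi>. uniform_lifts E ?S f \<phi>) \<longrightarrow> (\<forall>m\<in>M. has_rlp E m f)"
    by (intro impI ballI, elim exE) (rule uniform_lifts_glue)
  show "(\<forall>m\<in>M. has_rlp E m f) \<longleftrightarrow> (\<exists>\<phi>. uniform_lifts E M f \<phi>)"
    "(\<forall>m\<in>M. has_rlp E m f) \<longleftrightarrow> (\<exists>\<phi>. uniform_lifts E ?S f \<phi>)"
    using 1 2 3 by argo+
qed

end


section \<open>Lifting structures for Leibniz products\<close>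

definition po_map :: "('o, 'a) cat \<Rightarrow> ('o, 'a, 'o, 'a) fctr \<Rightarrow> ('o \<Rightarrow> 'a) \<Rightarrow> 'a \<Rightarrow> 'a \<Rightarrow> 'a \<Rightarrow> 'a \<Rightarrow> 'a" where
  "po_map E I d i j a b = fst (und (leibniz_sq E I d (Mor i j (a, b))))"

text \<open>A right map structure on \<open>f\<close> for the Leibniz products of the maps in \<open>S\<close>, indexed by the full
  subcategory of the cartesian arrow category on \<open>S\<close>.\<close>

definition leibniz_lifts :: "('o, 'a) cat \<Rightarrow> ('o, 'a, 'o, 'a) fctr \<Rightarrow> ('o \<Rightarrow> 'a) \<Rightarrow> 'a set \<Rightarrow> 'a \<Rightarrow>
    ('a \<Rightarrow> 'a \<Rightarrow> 'a \<Rightarrow> 'a) \<Rightarrow> bool" where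
  "leibniz_lifts E I d S f \<phi> \<longleftrightarrow>
    (\<forall>i\<in>S. \<forall>s t. comm_sq E s (leibniz E I d i) f t \<longrightarrow>
      \<phi> i s t \<in> hom E (Cod E (leibniz E I d i)) (Dom E f) \<and>
      \<phi> i s t \<cdot>\<^bsub>E\<^esub> leibniz E I d i = s \<and> f \<cdot>\<^bsub>E\<^esub> \<phi> i s t = t) \<and>
    (\<forall>j\<in>S. \<forall>i\<in>S. \<forall>a b s t. is_pullback E a i j b \<and> comm_sq E s (leibniz E I d j) f t \<longrightarrow>
      \<phi> j s t \<cdot>\<^bsub>E\<^esub> farr I b = \<phi> i (s \<cdot>\<^bsub>E\<^esub> po_map E I d i j a b) (t \<cdot>\<^bsub>E\<^esub> farr I b))"

lemma und_leibniz_sq: "und (leibniz_sq E I d \<sigma>) =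
    (po_map E I d (src \<sigma>) (tgt \<sigma>) (fst (und \<sigma>)) (snd (und \<sigma>)), farr I (snd (und \<sigma>)))"
  by (simp add: po_map_def leibniz_sq_def Let_def)

lemma leibniz_lifts_arrows: "leibniz_lifts E I d S f \<phi> \<longleftrightarrow>
    (\<forall>i\<in>S. \<forall>s t. comm_sq E s (leibniz E I d i) f t \<longrightarrow>
      \<phi> i s t \<in> hom E (Cod E (leibniz E I d i)) (Dom E f) \<and>
      \<phi> i s t \<cdot>\<^bsub>E\<^esub> leibniz E I d i = s \<and> f \<cdot>\<^bsub>E\<^esub> \<phi> i s t = t) \<and>
    (\<forall>\<sigma>\<in>{\<sigma>. is_pullback E (fst (und \<sigma>)) (src \<sigma>) (tgt \<sigma>) (snd (und \<sigma>)) \<and> src \<sigma> \<in> S \<and> tgt \<sigma> \<in> S}. \<forall>s t a b.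
      und (leibniz_sq E I d \<sigma>) = (a, b) \<and> comm_sq E s (leibniz E I d (tgt \<sigma>)) f t \<longrightarrow>
      \<phi> (tgt \<sigma>) s t \<cdot>\<^bsub>E\<^esub> b = \<phi> (src \<sigma>) (s \<cdot>\<^bsub>E\<^esub> a) (t \<cdot>\<^bsub>E\<^esub> b))"
  (is "_ \<longleftrightarrow> ?P \<and> ?A")
proof -
  have "(\<forall>j\<in>S. \<forall>i\<in>S. \<forall>a b s t. is_pullback E a i j b \<and> comm_sq E s (leibniz E I d j) f t \<longrightarrow>
      \<phi> j s t \<cdot>\<^bsub>E\<^esub> farr I b = \<phi> i (s \<cdot>\<^bsub>E\<^esub> po_map E I d i j a b) (t \<cdot>\<^bsub>E\<^esub> farr I b)) \<longleftrightarrow> ?A"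
    (is "?B \<longleftrightarrow> ?A")
  proof
    assume B: ?B
    show ?A
    proof (intro ballI allI impI)
      fix \<sigma> s t a b
      assume "\<sigma> \<in> {\<sigma>. is_pullback E (fst (und \<sigma>)) (src \<sigma>) (tgt \<sigma>) (snd (und \<sigma>)) \<and> src \<sigma> \<in> S \<and> tgt \<sigma> \<in> S}"
        and ab: "und (leibniz_sq E I d \<sigma>) = (a, b) \<and> comm_sq E s (leibniz E I d (tgt \<sigma>)) f t"
      then show "\<phi> (tgt \<sigma>) s t \<cdot>\<^bsub>E\<^esub> b = \<phi> (src \<sigma>) (s \<cdot>\<^bsub>E\<^esub> a) (t \<cdot>\<^bsub>E\<^esub> b)"
        using B[rule_format, of "tgt \<sigma>" "src \<sigma>" "fst (und \<sigma>)" "snd (und \<sigma>)" s t]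
        by (simp add: und_leibniz_sq)
    qed
  next
    assume A: ?A
    show ?B
    proof (intro ballI allI impI)
      fix j i a b s t
      assume "j \<in> S" "i \<in> S" "is_pullback E a i j b \<and> comm_sq E s (leibniz E I d j) f t"
      then show "\<phi> j s t \<cdot>\<^bsub>E\<^esub> farr I b = \<phi> i (s \<cdot>\<^bsub>E\<^esub> po_map E I d i j a b) (t \<cdot>\<^bsub>E\<^esub> farr I b)"
        using bspec[OF A, of "Mor i j (a, b)"] by (simp add: und_leibniz_sq)
    qed
  qed
  then show ?thesis unfolding leibniz_lifts_def by simp
qed

lemma right_map_structure_copair:
  assumes R: "Obj R = S" "Dom R = src" "Cod R = tgt"
    "Arr R = {\<sigma>. is_pullback E (fst (und \<sigma>)) (src \<sigma>) (tgt \<sigma>) (snd (und \<sigma>)) \<and> src \<sigma> \<in> S \<and> tgt \<sigma> \<in> S}"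
  shows "right_map_structure E (sum_cat R R)
      (copair (fun_comp (leibniz_functor E I d) id_functor) (fun_comp (leibniz_functor E I d') id_functor)) f \<phi> \<longleftrightarrow>
    leibniz_lifts E I d S f (\<lambda>i. \<phi> (Inl i)) \<and> leibniz_lifts E I d' S f (\<lambda>i. \<phi> (Inr i))"
proof -
  have Ball_Plus: "(\<forall>x\<in>A <+> B. P x) \<longleftrightarrow> (\<forall>x\<in>A. P (Inl x)) \<and> (\<forall>x\<in>B. P (Inr x))"
    for A :: "'x set" and B :: "'y set" and P
    by blast
  show ?thesis
    unfolding leibniz_lifts_arrows R(4)[symmetric] right_map_structure_def
    by (simp add: sum_cat_def copair_def fun_comp_def leibniz_functor_def id_functor_def R(1-3) Ball_Plus
        conj_ac)
qed

section \<open>Transposing lifting problems across the Leibniz adjunction\<close>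

locale adjoint_cylinder = category E
  for E :: "('o, 'a) cat" +
  fixes I G :: "('o, 'a, 'o, 'a) fctr" and d \<eta> \<zeta> :: "'o \<Rightarrow> 'a"
  assumes d_nat: "nat_trans E E id_functor I d"
    and unit: "nat_trans E E id_functor (fun_comp G I) \<eta>"
    and counit: "nat_trans E E (fun_comp I G) id_functor \<zeta>"
    and G_functor: "is_functor E E G"
    and triangle_I: "x \<in> Obj E \<Longrightarrow> \<zeta> (fobj I x) \<cdot>\<^bsub>E\<^esub> farr I (\<eta> x) = Id E (fobj I x)"
    and triangle_G: "x \<in> Obj E \<Longrightarrow> farr G (\<zeta> x) \<cdot>\<^bsub>E\<^esub> \<eta> (fobj G x) = Id E (fobj G x)"
begin

abbreviation composite :: "'a \<Rightarrow> 'a \<Rightarrow> 'a" (infixr "\<odot>" 55) where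
  "g \<odot> f \<equiv> g \<cdot>\<^bsub>E\<^esub> f"

lemma I_functor: "is_functor E E I"
  using d_nat unfolding nat_trans_def by blast

lemma hom_Objs: "f \<in> hom E x y \<Longrightarrow> x \<in> Obj E \<and> y \<in> Obj E"
  using Dom_Obj Cod_Obj by (auto simp: hom_def)

lemmas I_hom = is_functor_hom[OF I_functor] and I_comp = is_functor_comp[OF I_functor]
  and G_hom = is_functor_hom[OF G_functor] and G_comp = is_functor_comp[OF G_functor]

lemma I_Obj: "x \<in> Obj E \<Longrightarrow> fobj I x \<in> Obj E" and G_Obj: "x \<in> Obj E \<Longrightarrow> fobj G x \<in> Obj E"
  using I_functor G_functor unfolding is_functor_def by auto

lemma d_hom: "x \<in> Obj E \<Longrightarrow> d x \<in> hom E x (fobj I x)"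
  and unit_hom: "x \<in> Obj E \<Longrightarrow> \<eta> x \<in> hom E x (fobj G (fobj I x))"
  and counit_hom: "x \<in> Obj E \<Longrightarrow> \<zeta> x \<in> hom E (fobj I (fobj G x)) x"
  using d_nat unit counit unfolding nat_trans_def by (auto simp: id_functor_def fun_comp_def)

lemma d_square: "f \<in> hom E x y \<Longrightarrow> farr I f \<odot> d x = d y \<odot> f"
  and unit_square: "f \<in> hom E x y \<Longrightarrow> farr G (farr I f) \<odot> \<eta> x = \<eta> y \<odot> f"
  and counit_square: "f \<in> hom E x y \<Longrightarrow> f \<odot> \<zeta> x = \<zeta> y \<odot> farr I (farr G f)"
  using d_nat unit counit unfolding nat_trans_def by (auto simp: id_functor_def fun_comp_def hom_def)

text \<open>Transposition across the adjunction: \<open>flat\<close> takes maps out of \<open>I x\<close> to maps out of \<open>x\<close>, and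
  \<open>sharp\<close> is its inverse.\<close>

definition flat :: "'o \<Rightarrow> 'a \<Rightarrow> 'a" where
  "flat x h = farr G h \<odot> \<eta> x"

definition sharp :: "'o \<Rightarrow> 'a \<Rightarrow> 'a" where
  "sharp y k = \<zeta> y \<odot> farr I k"

text \<open>Evaluation of a path at the endpoint \<open>d\<close>: the transpose of \<open>d\<close>.\<close>

definition ev :: "'o \<Rightarrow> 'a" where
  "ev x = \<zeta> x \<odot> d (fobj G x)"

lemma flat_hom: "h \<in> hom E (fobj I x) y \<Longrightarrow> x \<in> Obj E \<Longrightarrow> flat x h \<in> hom E x (fobj G y)"
  unfolding flat_def using Comp_hom[OF unit_hom G_hom] by blast

lemma sharp_hom: "k \<in> hom E x (fobj G y) \<Longrightarrow> y \<in> Obj E \<Longrightarrow> sharp y k \<in> hom E (fobj I x) y"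
  unfolding sharp_def using Comp_hom[OF I_hom counit_hom] by blast

lemma ev_hom: "x \<in> Obj E \<Longrightarrow> ev x \<in> hom E (fobj G x) x"
  unfolding ev_def using Comp_hom[OF d_hom counit_hom] G_Obj by blast

lemma sharp_flat:
  assumes h: "h \<in> hom E (fobj I x) y" and x: "x \<in> Obj E"
  shows "sharp y (flat x h) = h"
proof -
  have y: "y \<in> Obj E" using hom_Objs[OF h] by blast
  have "sharp y (flat x h) = \<zeta> y \<odot> (farr I (farr G h) \<odot> farr I (\<eta> x))"
    unfolding sharp_def flat_def using I_comp[OF unit_hom[OF x] G_hom[OF h]] by simp
  also have "\<dots> = (\<zeta> y \<odot> farr I (farr G h)) \<odot> farr I (\<eta> x)"
    using Comp_assoc[OF I_hom[OF unit_hom[OF x]] I_hom[OF G_hom[OF h]] counit_hom[OF y]] by simp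
  also have "\<dots> = h \<odot> (\<zeta> (fobj I x) \<odot> farr I (\<eta> x))"
    using Comp_assoc[OF I_hom[OF unit_hom[OF x]] counit_hom[OF I_Obj[OF x]] h] counit_square[OF h] by simp
  also have "\<dots> = h"
    unfolding triangle_I[OF x] using Comp_Id[OF h] .
  finally show ?thesis .
qed

lemma flat_sharp:
  assumes k: "k \<in> hom E x (fobj G y)" and y: "y \<in> Obj E"
  shows "flat x (sharp y k) = k"
proof -
  have x: "x \<in> Obj E" using hom_Objs[OF k] by blast
  have "flat x (sharp y k) = (farr G (\<zeta> y) \<odot> farr G (farr I k)) \<odot> \<eta> x"
    unfolding sharp_def flat_def using G_comp[OF I_hom[OF k] counit_hom[OF y]] by simp
  also have "\<dots> = farr G (\<zeta> y) \<odot> (\<eta> (fobj G y) \<odot> k)"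
    using Comp_assoc[OF unit_hom[OF x] G_hom[OF I_hom[OF k]] G_hom[OF counit_hom[OF y]]]
      unit_square[OF k] by simp
  also have "\<dots> = (farr G (\<zeta> y) \<odot> \<eta> (fobj G y)) \<odot> k"
    using Comp_assoc[OF k unit_hom[OF G_Obj[OF y]] G_hom[OF counit_hom[OF y]]] by simp
  also have "\<dots> = k"
    unfolding triangle_G[OF y] using Id_Comp[OF k] .
  finally show ?thesis .
qed

lemma flat_comp_right:
  assumes h: "h \<in> hom E (fobj I x) y" and a: "a \<in> hom E x' x"
  shows "flat x' (h \<odot> farr I a) = flat x h \<odot> a"
proof -
  have o: "x' \<in> Obj E" "x \<in> Obj E" using hom_Objs[OF a] by auto
  show ?thesis
    unfolding flat_def
    using G_comp[OF I_hom[OF a] h] Comp_assoc[OF unit_hom[OF o(1)] G_hom[OF I_hom[OF a]] G_hom[OF h]]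
      Comp_assoc[OF a unit_hom[OF o(2)] G_hom[OF h]] unit_square[OF a] by simp
qed

lemma flat_comp_left:
  assumes h: "h \<in> hom E (fobj I x) y" and x: "x \<in> Obj E" and f: "f \<in> hom E y z"
  shows "flat x (f \<odot> h) = farr G f \<odot> flat x h"
  unfolding flat_def using G_comp[OF h f] Comp_assoc[OF unit_hom[OF x] G_hom[OF h] G_hom[OF f]] by simp

lemma sharp_comp_right:
  assumes k: "k \<in> hom E x (fobj G y)" and y: "y \<in> Obj E" and a: "a \<in> hom E x' x"
  shows "sharp y (k \<odot> a) = sharp y k \<odot> farr I a"
  unfolding sharp_def using I_comp[OF a k] Comp_assoc[OF I_hom[OF a] I_hom[OF k] counit_hom[OF y]] by simp

lemma sharp_comp_left:
  assumes k: "k \<in> hom E x (fobj G y)" and f: "f \<in> hom E y z"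
  shows "sharp z (farr G f \<odot> k) = f \<odot> sharp y k"
proof -
  have o: "y \<in> Obj E" "z \<in> Obj E" using hom_Objs[OF f] by auto
  show ?thesis
    unfolding sharp_def
    using I_comp[OF k G_hom[OF f]] Comp_assoc[OF I_hom[OF k] I_hom[OF G_hom[OF f]] counit_hom[OF o(2)]]
      Comp_assoc[OF I_hom[OF k] counit_hom[OF o(1)] f] counit_square[OF f] by simp
qed

lemma ev_transpose:
  assumes k: "k \<in> hom E x (fobj G y)" and y: "y \<in> Obj E"
  shows "sharp y k \<odot> d x = ev y \<odot> k"
proof -
  have x: "x \<in> Obj E" using hom_Objs[OF k] by blast
  show ?thesis
    unfolding sharp_def ev_def
    using Comp_assoc[OF d_hom[OF x] I_hom[OF k] counit_hom[OF y]] d_square[OF k]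
      Comp_assoc[OF k d_hom[OF G_Obj[OF y]] counit_hom[OF y]] by simp
qed

lemma ev_flat:
  assumes h: "h \<in> hom E (fobj I x) y" and x: "x \<in> Obj E"
  shows "h \<odot> d x = ev y \<odot> flat x h"
  using ev_transpose[OF flat_hom[OF h x]] sharp_flat[OF h x] hom_Objs[OF h] by simp

lemma ev_square:
  assumes f: "f \<in> hom E x y"
  shows "f \<odot> ev x = ev y \<odot> farr G f"
proof -
  have o: "x \<in> Obj E" "y \<in> Obj E" using hom_Objs[OF f] by auto
  show ?thesis
    unfolding ev_def
    using Comp_assoc[OF d_hom[OF G_Obj[OF o(1)]] counit_hom[OF o(1)] f] counit_square[OF f]
      Comp_assoc[OF d_hom[OF G_Obj[OF o(1)]] I_hom[OF G_hom[OF f]] counit_hom[OF o(2)]]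
      d_square[OF G_hom[OF f]]
      Comp_assoc[OF G_hom[OF f] d_hom[OF G_Obj[OF o(2)]] counit_hom[OF o(2)]] by simp
qed

lemma pushout_eqI:
  assumes po: "is_pushout E u v p q" and h: "h \<in> hom E (Cod E p) z" "k \<in> hom E (Cod E p) z"
    and eq: "h \<odot> p = k \<odot> p" "h \<odot> q = k \<odot> q"
  shows "h = k"
proof -
  have sq: "comm_sq E u v p q" using po unfolding is_pushout_def by blast
  then have p: "p \<in> hom E (Cod E u) (Cod E p)" and q: "q \<in> hom E (Cod E v) (Cod E p)"
    and u: "u \<in> hom E (Dom E u) (Cod E u)" and v: "v \<in> hom E (Dom E u) (Cod E v)"
    and pq: "p \<odot> u = q \<odot> v"
    unfolding comm_sq_def hom_def by auto
  have "(h \<odot> p) \<odot> u = (h \<odot> q) \<odot> v"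
    using Comp_assoc[OF u p h(1)] Comp_assoc[OF v q h(1)] pq by simp
  then have "comm_sq E u v (h \<odot> p) (h \<odot> q)"
    by (intro comm_sqI[OF v Comp_hom[OF p h(1)] u Comp_hom[OF q h(1)]])
  then have "\<exists>!l. l \<in> hom E (Cod E p) (Cod E (h \<odot> p)) \<and> l \<odot> p = h \<odot> p \<and> l \<odot> q = h \<odot> q"
    using po unfolding is_pushout_def by blast
  moreover have "Cod E (h \<odot> p) = z" using homD[OF Comp_hom[OF p h(1)]] by blast
  ultimately show ?thesis using h eq by metis
qed

lemma pullback_eqI:
  assumes pb: "is_pullback E u v p q" and h: "h \<in> hom E z (Dom E v)" "k \<in> hom E z (Dom E v)"
    and eq: "u \<odot> h = u \<odot> k" "v \<odot> h = v \<odot> k"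
  shows "h = k"
proof -
  have sq: "comm_sq E u v p q" using pb unfolding is_pullback_def by blast
  then have p: "p \<in> hom E (Dom E p) (Cod E p)" and q: "q \<in> hom E (Cod E v) (Cod E p)"
    and u: "u \<in> hom E (Dom E v) (Dom E p)" and v: "v \<in> hom E (Dom E v) (Cod E v)"
    and pq: "p \<odot> u = q \<odot> v"
    unfolding comm_sq_def hom_def by auto
  have "p \<odot> (u \<odot> h) = q \<odot> (v \<odot> h)"
    using Comp_assoc[OF h(1) u p] Comp_assoc[OF h(1) v q] pq by simp
  then have "comm_sq E (u \<odot> h) (v \<odot> h) p q"
    by (intro comm_sqI[OF Comp_hom[OF h(1) v] p Comp_hom[OF h(1) u] q])
  then have "\<exists>!l. l \<in> hom E (Dom E (v \<odot> h)) (Dom E v) \<and> u \<odot> l = u \<odot> h \<and> v \<odot> l = v \<odot> h"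
    using pb unfolding is_pullback_def by blast
  moreover have "Dom E (v \<odot> h) = z" using homD[OF Comp_hom[OF h(1) v]] by blast
  ultimately show ?thesis using h eq by metis
qed

end

text \<open>A fixed map \<open>f\<close> and its Leibniz exponential \<open>gap : G X \<rightarrow> X \<times>\<^sub>Y G Y\<close>, where \<open>G\<close> is the path
  object functor: a path in \<open>X\<close> is sent to its endpoint and to its image in \<open>Y\<close>.\<close>

locale leibniz_exponential = adjoint_cylinder E I G d \<eta> \<zeta>
  for E :: "('o, 'a) cat" and I G :: "('o, 'a, 'o, 'a) fctr" and d \<eta> \<zeta> :: "'o \<Rightarrow> 'a" +
  fixes S :: "'a set" and f q\<^sub>1 q\<^sub>2 :: 'a and X Y Q :: 'o
  assumes S_Arr: "i \<in> S \<Longrightarrow> i \<in> Arr E"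
    and ex_pushout: "i \<in> S \<Longrightarrow> \<exists>p q. is_pushout E (d (Dom E i)) i p q"
    and f: "f \<in> hom E X Y"
    and q1: "q\<^sub>1 \<in> hom E Q X" and q2: "q\<^sub>2 \<in> hom E Q (fobj G Y)"
    and Q: "is_pullback E q\<^sub>1 q\<^sub>2 f (ev Y)"
begin

lemma X: "X \<in> Obj E" and Y: "Y \<in> Obj E"
  using hom_Objs[OF f] by auto

lemma Q_comm: "f \<odot> q\<^sub>1 = ev Y \<odot> q\<^sub>2"
  using Q unfolding is_pullback_def comm_sq_def by blast

lemma Q_pair:
  assumes u: "u \<in> hom E z X" and v: "v \<in> hom E z (fobj G Y)" and uv: "f \<odot> u = ev Y \<odot> v"
  shows "\<exists>h. h \<in> hom E z Q \<and> q\<^sub>1 \<odot> h = u \<and> q\<^sub>2 \<odot> h = v"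
proof -
  have "comm_sq E u v f (ev Y)" by (rule comm_sqI[OF v f u ev_hom[OF Y] uv])
  then have "\<exists>h. h \<in> hom E (Dom E v) (Dom E q\<^sub>2) \<and> q\<^sub>1 \<odot> h = u \<and> q\<^sub>2 \<odot> h = v"
    using Q unfolding is_pullback_def by blast
  then show ?thesis using homD[OF v] homD[OF q2] by simp
qed

lemma Q_eqI:
  assumes "h \<in> hom E z Q" "k \<in> hom E z Q" "q\<^sub>1 \<odot> h = q\<^sub>1 \<odot> k" "q\<^sub>2 \<odot> h = q\<^sub>2 \<odot> k"
  shows "h = k"
  by (rule pullback_eqI[OF Q, where z = z]) (use assms homD[OF q2] in simp_all)

definition gap :: 'a where
  "gap = (SOME h. h \<in> hom E (fobj G X) Q \<and> q\<^sub>1 \<odot> h = ev X \<and> q\<^sub>2 \<odot> h = farr G f)"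

lemma gap: "gap \<in> hom E (fobj G X) Q" and q1_gap: "q\<^sub>1 \<odot> gap = ev X" and q2_gap: "q\<^sub>2 \<odot> gap = farr G f"
  using someI_ex[OF Q_pair[OF ev_hom[OF X] G_hom[OF f] ev_square[OF f]]] unfolding gap_def by auto

abbreviation "cyl i \<equiv> po_cyl E d i"
abbreviation "base i \<equiv> po_base E d i"
abbreviation "lz i \<equiv> leibniz E I d i"

lemma pushout:
  assumes "i \<in> S"
  shows "is_pushout E (d (Dom E i)) i (cyl i) (base i)"
proof -
  obtain p q where "is_pushout E (d (Dom E i)) i p q" using ex_pushout[OF assms] by blast
  then have "case chosen_pushout E d i of (p, q) \<Rightarrow> is_pushout E (d (Dom E i)) i p q"
    unfolding chosen_pushout_def 
    by (intro someI[of "\<lambda>(p, q). is_pushout E (d (Dom E i)) i p q" "(p, q)"]) simp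
  then show ?thesis by (simp add: po_cyl_def po_base_def case_prod_beta)
qed

lemma legs:
  assumes i: "i \<in> S" "i \<in> hom E A B"
  shows cyl_hom: "cyl i \<in> hom E (fobj I A) (Cod E (cyl i))" and base_hom: "base i \<in> hom E B (Cod E (cyl i))"
    and cyl_base: "cyl i \<odot> d A = base i \<odot> i"
proof -
  have "A \<in> Obj E" "Dom E i = A" "Cod E i = B" using homD[OF i(2)] hom_Objs[OF i(2)] by auto
  then show "cyl i \<in> hom E (fobj I A) (Cod E (cyl i))" "base i \<in> hom E B (Cod E (cyl i))"
    "cyl i \<odot> d A = base i \<odot> i"
    using pushout[OF i(1)] homD[OF d_hom[of A]] unfolding is_pushout_def comm_sq_def by (auto simp: hom_def)
qed

lemma copair_ex1:
  assumes i: "i \<in> S" "i \<in> hom E A B" and u: "u \<in> hom E (fobj I A) z" and v: "v \<in> hom E B z"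
    and uv: "u \<odot> d A = v \<odot> i"
  shows "\<exists>!h. h \<in> hom E (Cod E (cyl i)) z \<and> h \<odot> cyl i = u \<and> h \<odot> base i = v"
proof -
  have A: "A \<in> Obj E" "Dom E i = A" using homD[OF i(2)] hom_Objs[OF i(2)] by auto
  have "comm_sq E (d (Dom E i)) i u v"
    unfolding A(2) by (rule comm_sqI[OF i(2) u d_hom[OF A(1)] v uv])
  then have "\<exists>!h. h \<in> hom E (Cod E (cyl i)) (Cod E u) \<and> h \<odot> cyl i = u \<and> h \<odot> base i = v"
    using pushout[OF i(1)] unfolding is_pushout_def by blast
  then show ?thesis using homD[OF u] by simp
qed

lemma leibniz_spec:
  assumes i: "i \<in> S" "i \<in> hom E A B"
  shows lz_hom: "lz i \<in> hom E (Cod E (cyl i)) (fobj I B)" and lz_cyl: "lz i \<odot> cyl i = farr I i"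
    and lz_base: "lz i \<odot> base i = d B"
proof -
  have B: "B \<in> Obj E" "Cod E i = B" using homD[OF i(2)] hom_Objs[OF i(2)] by auto
  show "lz i \<in> hom E (Cod E (cyl i)) (fobj I B)" "lz i \<odot> cyl i = farr I i" "lz i \<odot> base i = d B"
    using theI'[OF copair_ex1[OF i I_hom[OF i(2)] d_hom[OF B(1)] d_square[OF i(2)]]]
    unfolding leibniz_def B(2) by auto
qed

lemma po_map_spec:
  assumes i: "i \<in> S" "i \<in> hom E A B" and j: "j \<in> S" "j \<in> hom E A' B'"
    and a: "a \<in> hom E A A'" and b: "b \<in> hom E B B'" and ab: "j \<odot> a = b \<odot> i"
  shows po_map_hom: "po_map E I d i j a b \<in> hom E (Cod E (cyl i)) (Cod E (cyl j))"
    and po_map_cyl: "po_map E I d i j a b \<odot> cyl i = cyl j \<odot> farr I a"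
    and po_map_base: "po_map E I d i j a b \<odot> base i = base j \<odot> b"
    and lz_po_map: "lz j \<odot> po_map E I d i j a b = farr I b \<odot> lz i"
proof -
  have o: "A \<in> Obj E" "A' \<in> Obj E" using hom_Objs[OF a] by auto
  note ci = cyl_hom[OF i] and bi = base_hom[OF i] and cj = cyl_hom[OF j] and bj = base_hom[OF j]
  note li = lz_hom[OF i] and lj = lz_hom[OF j]
  have "(cyl j \<odot> farr I a) \<odot> d A = (cyl j \<odot> d A') \<odot> a"
    using Comp_assoc[OF d_hom[OF o(1)] I_hom[OF a] cj] Comp_assoc[OF a d_hom[OF o(2)] cj] d_square[OF a] by simp
  also have "\<dots> = (base j \<odot> b) \<odot> i"
    using cyl_base[OF j] Comp_assoc[OF a j(2) bj] Comp_assoc[OF i(2) b bj] ab by simp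
  finally have "\<exists>!h. h \<in> hom E (Cod E (cyl i)) (Cod E (cyl j)) \<and> h \<odot> cyl i = cyl j \<odot> farr I a \<and>
      h \<odot> base i = base j \<odot> b"
    by (rule copair_ex1[OF i Comp_hom[OF I_hom[OF a] cj] Comp_hom[OF b bj]])
  from theI'[OF this]
  show h: "po_map E I d i j a b \<in> hom E (Cod E (cyl i)) (Cod E (cyl j))"
    and hc: "po_map E I d i j a b \<odot> cyl i = cyl j \<odot> farr I a"
    and hb: "po_map E I d i j a b \<odot> base i = base j \<odot> b"
    unfolding po_map_def leibniz_sq_def by (simp_all add: Let_def)
  show "lz j \<odot> po_map E I d i j a b = farr I b \<odot> lz i"
  proof (rule pushout_eqI[OF pushout[OF i(1)] Comp_hom[OF h lj] Comp_hom[OF li I_hom[OF b]]])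
    show "(lz j \<odot> po_map E I d i j a b) \<odot> cyl i = (farr I b \<odot> lz i) \<odot> cyl i"
      using Comp_assoc[OF ci h lj] hc Comp_assoc[OF I_hom[OF a] cj lj] lz_cyl[OF j] I_comp[OF a j(2)]
        Comp_assoc[OF ci li I_hom[OF b]] lz_cyl[OF i] I_comp[OF i(2) b] ab by simp
    show "(lz j \<odot> po_map E I d i j a b) \<odot> base i = (farr I b \<odot> lz i) \<odot> base i"
      using Comp_assoc[OF bi h lj] hb Comp_assoc[OF b bj lj] lz_base[OF j] d_square[OF b]
        Comp_assoc[OF bi li I_hom[OF b]] lz_base[OF i] by simp
  qed
qed

text \<open>The square \<open>(s, t)\<close> from the Leibniz product of \<open>i\<close> to \<open>f\<close> and the square \<open>(s', t')\<close> from \<open>i\<close> to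
  \<open>gap\<close> are transposes of each other. Treating transposition as a relation lets both directions and
  both notions of lifting use the same facts: it is a bijection, and it respects fillers and
  restriction along squares.\<close>

definition transposes :: "'a \<Rightarrow> 'a \<Rightarrow> 'a \<Rightarrow> 'a \<Rightarrow> 'a \<Rightarrow> bool" where
  "transposes i s t s' t' \<longleftrightarrow> comm_sq E s (lz i) f t \<and> comm_sq E s' i gap t' \<and>
    s \<odot> cyl i = sharp X s' \<and> s \<odot> base i = q\<^sub>1 \<odot> t' \<and> t = sharp Y (q\<^sub>2 \<odot> t')"

lemma transposes_sq:
  assumes "transposes i s t s' t'"
  shows "comm_sq E s (lz i) f t" "comm_sq E s' i gap t'"
  using assms unfolding transposes_def by blast+

lemma transposes_homs:
  assumes "transposes i s t s' t'" "i \<in> S" "i \<in> hom E A B"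
  shows "s \<in> hom E (Cod E (cyl i)) X" "t \<in> hom E (fobj I B) Y" "s' \<in> hom E A (fobj G X)" "t' \<in> hom E B Q"
    "f \<odot> s = t \<odot> lz i" "gap \<odot> s' = t' \<odot> i"
  using transposes_sq[OF assms(1)] homD[OF lz_hom[OF assms(2,3)]] homD[OF f] homD[OF gap] homD[OF assms(3)]
  unfolding comm_sq_def by simp_all

lemma transposes_eqs:
  assumes "transposes i s t s' t'"
  shows "s \<odot> cyl i = sharp X s'" "s \<odot> base i = q\<^sub>1 \<odot> t'" "t = sharp Y (q\<^sub>2 \<odot> t')"
  using assms unfolding transposes_def by blast+

lemma ex_transpose:
  assumes i: "i \<in> S" "i \<in> hom E A B" and sq: "comm_sq E s (lz i) f t"
  shows "\<exists>s' t'. transposes i s t s' t'"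
proof -
  have o: "A \<in> Obj E" "B \<in> Obj E" using hom_Objs[OF i(2)] by auto
  have s: "s \<in> hom E (Cod E (cyl i)) X" and t: "t \<in> hom E (fobj I B) Y" and st: "f \<odot> s = t \<odot> lz i"
    using sq homD[OF lz_hom[OF i]] homD[OF f] unfolding comm_sq_def by auto
  note ci = cyl_hom[OF i] and bi = base_hom[OF i] and li = lz_hom[OF i]
  note sc = Comp_hom[OF ci s] and sb = Comp_hom[OF bi s]
  have "f \<odot> (s \<odot> base i) = t \<odot> d B"
    using Comp_assoc[OF bi s f] st Comp_assoc[OF bi li t] lz_base[OF i] by simp
  then have "f \<odot> (s \<odot> base i) = ev Y \<odot> flat B t"
    using ev_flat[OF t o(2)] by simp
  then obtain t' where t': "t' \<in> hom E B Q" "q\<^sub>1 \<odot> t' = s \<odot> base i" "q\<^sub>2 \<odot> t' = flat B t"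
    using Q_pair[OF sb flat_hom[OF t o(2)]] by blast
  define s' where "s' = flat A (s \<odot> cyl i)"
  have s': "s' \<in> hom E A (fobj G X)" unfolding s'_def by (rule flat_hom[OF sc o(1)])
  have "gap \<odot> s' = t' \<odot> i"
  proof (rule Q_eqI[OF Comp_hom[OF s' gap] Comp_hom[OF i(2) t'(1)]])
    have "q\<^sub>1 \<odot> (gap \<odot> s') = (s \<odot> cyl i) \<odot> d A"
      using Comp_assoc[OF s' gap q1] q1_gap ev_flat[OF sc o(1)] by (simp add: s'_def)
    also have "\<dots> = (s \<odot> base i) \<odot> i"
      using Comp_assoc[OF d_hom[OF o(1)] ci s] Comp_assoc[OF i(2) bi s] cyl_base[OF i] by simp
    also have "\<dots> = q\<^sub>1 \<odot> (t' \<odot> i)"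
      using Comp_assoc[OF i(2) t'(1) q1] t'(2) by simp
    finally show "q\<^sub>1 \<odot> (gap \<odot> s') = q\<^sub>1 \<odot> (t' \<odot> i)" .
    have "q\<^sub>2 \<odot> (gap \<odot> s') = flat A (f \<odot> (s \<odot> cyl i))"
      using Comp_assoc[OF s' gap q2] q2_gap flat_comp_left[OF sc o(1) f] by (simp add: s'_def)
    also have "\<dots> = flat A (t \<odot> farr I i)"
      using Comp_assoc[OF ci s f] st Comp_assoc[OF ci li t] lz_cyl[OF i] by simp
    also have "\<dots> = q\<^sub>2 \<odot> (t' \<odot> i)"
      using flat_comp_right[OF t i(2)] Comp_assoc[OF i(2) t'(1) q2] t'(3) by simp
    finally show "q\<^sub>2 \<odot> (gap \<odot> s') = q\<^sub>2 \<odot> (t' \<odot> i)" .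
  qed
  then have "comm_sq E s' i gap t'" by (rule comm_sqI[OF i(2) gap s' t'(1)])
  then have "transposes i s t s' t'"
    unfolding transposes_def
    using sq t' sharp_flat[OF sc o(1)] sharp_flat[OF t o(2)] by (simp add: s'_def)
  then show ?thesis by blast
qed

lemma ex_cotranspose:
  assumes i: "i \<in> S" "i \<in> hom E A B" and sq: "comm_sq E s' i gap t'"
  shows "\<exists>s t. transposes i s t s' t'"
proof -
  have o: "A \<in> Obj E" "B \<in> Obj E" using hom_Objs[OF i(2)] by auto
  have s': "s' \<in> hom E A (fobj G X)" and t': "t' \<in> hom E B Q" and st: "gap \<odot> s' = t' \<odot> i"
    using sq homD[OF i(2)] homD[OF gap] unfolding comm_sq_def by auto
  note ci = cyl_hom[OF i] and bi = base_hom[OF i] and li = lz_hom[OF i]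
  note qt1 = Comp_hom[OF t' q1] and qt2 = Comp_hom[OF t' q2]
  have "sharp X s' \<odot> d A = (q\<^sub>1 \<odot> gap) \<odot> s'"
    unfolding q1_gap by (rule ev_transpose[OF s' X])
  also have "\<dots> = (q\<^sub>1 \<odot> t') \<odot> i"
    using Comp_assoc[OF s' gap q1] st Comp_assoc[OF i(2) t' q1] by simp
  finally obtain s where s: "s \<in> hom E (Cod E (cyl i)) X" "s \<odot> cyl i = sharp X s'" "s \<odot> base i = q\<^sub>1 \<odot> t'"
    using copair_ex1[OF i sharp_hom[OF s' X] qt1] by blast
  define t where "t = sharp Y (q\<^sub>2 \<odot> t')"
  have t: "t \<in> hom E (fobj I B) Y" unfolding t_def by (rule sharp_hom[OF qt2 Y])
  have "f \<odot> s = t \<odot> lz i"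
  proof (rule pushout_eqI[OF pushout[OF i(1)] Comp_hom[OF s(1) f] Comp_hom[OF li t]])
    have "(f \<odot> s) \<odot> cyl i = sharp Y (farr G f \<odot> s')"
      using Comp_assoc[OF ci s(1) f] s(2) sharp_comp_left[OF s' f] by simp
    also have "farr G f \<odot> s' = (q\<^sub>2 \<odot> t') \<odot> i"
      using Comp_assoc[OF s' gap q2] q2_gap st Comp_assoc[OF i(2) t' q2] by simp
    also have "sharp Y ((q\<^sub>2 \<odot> t') \<odot> i) = (t \<odot> lz i) \<odot> cyl i"
      using sharp_comp_right[OF qt2 Y i(2)] Comp_assoc[OF ci li t] lz_cyl[OF i] by (simp add: t_def)
    finally show "(f \<odot> s) \<odot> cyl i = (t \<odot> lz i) \<odot> cyl i" .
    have "(f \<odot> s) \<odot> base i = ev Y \<odot> (q\<^sub>2 \<odot> t')"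
      using Comp_assoc[OF bi s(1) f] s(3) Comp_assoc[OF t' q1 f] Q_comm Comp_assoc[OF t' q2 ev_hom[OF Y]] by simp
    also have "\<dots> = (t \<odot> lz i) \<odot> base i"
      using ev_transpose[OF qt2 Y] Comp_assoc[OF bi li t] lz_base[OF i] by (simp add: t_def)
    finally show "(f \<odot> s) \<odot> base i = (t \<odot> lz i) \<odot> base i" .
  qed
  then have "comm_sq E s (lz i) f t" by (rule comm_sqI[OF li f s(1) t])
  then have "transposes i s t s' t'"
    unfolding transposes_def using sq s by (simp add: t_def)
  then show ?thesis by blast
qed

lemma transpose_unique:
  assumes i: "i \<in> S" "i \<in> hom E A B" and 1: "transposes i s t s' t'" and 2: "transposes i s t s'' t''"
  shows "s' = s'' \<and> t' = t''"
proof
  note h1 = transposes_homs[OF 1 i] and h2 = transposes_homs[OF 2 i]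
  have eq1: "sharp X s' = sharp X s''"
    unfolding transposes_eqs(1)[OF 1, symmetric] transposes_eqs(1)[OF 2, symmetric] ..
  show "s' = s''"
    using arg_cong[OF eq1, of "flat A"] unfolding flat_sharp[OF h1(3) X] flat_sharp[OF h2(3) X] .
  show "t' = t''"
  proof (rule Q_eqI[OF h1(4) h2(4)])
    show "q\<^sub>1 \<odot> t' = q\<^sub>1 \<odot> t''"
      unfolding transposes_eqs(2)[OF 1, symmetric] transposes_eqs(2)[OF 2, symmetric] ..
    have eq2: "sharp Y (q\<^sub>2 \<odot> t') = sharp Y (q\<^sub>2 \<odot> t'')"
      using trans[OF sym[OF transposes_eqs(3)[OF 1]] transposes_eqs(3)[OF 2]] .
    show "q\<^sub>2 \<odot> t' = q\<^sub>2 \<odot> t''"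
      using arg_cong[OF eq2, of "flat B"]
      unfolding flat_sharp[OF Comp_hom[OF h1(4) q2] Y] flat_sharp[OF Comp_hom[OF h2(4) q2] Y] .
  qed
qed

lemma cotranspose_unique:
  assumes i: "i \<in> S" "i \<in> hom E A B" and 1: "transposes i s t s' t'" and 2: "transposes i u v s' t'"
  shows "s = u \<and> t = v"
proof
  show "s = u"
    by (rule pushout_eqI[OF pushout[OF i(1)] transposes_homs(1)[OF 1 i] transposes_homs(1)[OF 2 i]])
      (simp_all add: transposes_eqs(1,2)[OF 1] transposes_eqs(1,2)[OF 2])
  show "t = v" unfolding transposes_eqs(3)[OF 1] transposes_eqs(3)[OF 2] ..
qed

lemma flat_filler:
  assumes i: "i \<in> S" "i \<in> hom E A B" and tr: "transposes i s t s' t'"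
    and h: "h \<in> hom E (fobj I B) X" "h \<odot> lz i = s" "f \<odot> h = t"
  shows "flat B h \<odot> i = s' \<and> gap \<odot> flat B h = t'"
proof
  have o: "A \<in> Obj E" "B \<in> Obj E" using hom_Objs[OF i(2)] by auto
  note hs = transposes_homs[OF tr i]
  note ci = cyl_hom[OF i] and bi = base_hom[OF i] and li = lz_hom[OF i]
  have s': "s' = flat A (s \<odot> cyl i)"
    unfolding transposes_eqs(1)[OF tr] flat_sharp[OF hs(3) X] ..
  show "flat B h \<odot> i = s'"
    unfolding s' flat_comp_right[OF h(1) i(2), symmetric] h(2)[symmetric]
    using Comp_assoc[OF ci li h(1)] lz_cyl[OF i] by simp
  note fh = flat_hom[OF h(1) o(2)]
  show "gap \<odot> flat B h = t'"
  proof (rule Q_eqI[OF Comp_hom[OF fh gap] hs(4)])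
    have "q\<^sub>1 \<odot> (gap \<odot> flat B h) = h \<odot> d B"
      using Comp_assoc[OF fh gap q1] q1_gap ev_flat[OF h(1) o(2)] by simp
    also have "\<dots> = s \<odot> base i"
      using Comp_assoc[OF bi li h(1)] lz_base[OF i] h(2) by simp
    also have "\<dots> = q\<^sub>1 \<odot> t'" by (rule transposes_eqs(2)[OF tr])
    finally show "q\<^sub>1 \<odot> (gap \<odot> flat B h) = q\<^sub>1 \<odot> t'" .
    have "q\<^sub>2 \<odot> (gap \<odot> flat B h) = flat B t"
      using Comp_assoc[OF fh gap q2] q2_gap flat_comp_left[OF h(1) o(2) f] h(3) by simp
    also have "\<dots> = q\<^sub>2 \<odot> t'"
      unfolding transposes_eqs(3)[OF tr] by (rule flat_sharp[OF Comp_hom[OF hs(4) q2] Y])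
    finally show "q\<^sub>2 \<odot> (gap \<odot> flat B h) = q\<^sub>2 \<odot> t'" .
  qed
qed

lemma sharp_filler:
  assumes i: "i \<in> S" "i \<in> hom E A B" and tr: "transposes i s t s' t'"
    and k: "k \<in> hom E B (fobj G X)" "k \<odot> i = s'" "gap \<odot> k = t'"
  shows "sharp X k \<odot> lz i = s \<and> f \<odot> sharp X k = t"
proof
  note hs = transposes_homs[OF tr i]
  note ci = cyl_hom[OF i] and bi = base_hom[OF i] and li = lz_hom[OF i]
  note kh = sharp_hom[OF k(1) X]
  show "sharp X k \<odot> lz i = s"
  proof (rule pushout_eqI[OF pushout[OF i(1)] Comp_hom[OF li kh] hs(1)])
    have "(sharp X k \<odot> lz i) \<odot> cyl i = sharp X s'"
      using Comp_assoc[OF ci li kh] lz_cyl[OF i] sharp_comp_right[OF k(1) X i(2)] k(2) by simp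
    then show "(sharp X k \<odot> lz i) \<odot> cyl i = s \<odot> cyl i"
      using transposes_eqs(1)[OF tr] by simp
    have "(sharp X k \<odot> lz i) \<odot> base i = ev X \<odot> k"
      using Comp_assoc[OF bi li kh] lz_base[OF i] ev_transpose[OF k(1) X] by simp
    also have "\<dots> = q\<^sub>1 \<odot> t'"
      using Comp_assoc[OF k(1) gap q1] q1_gap k(3) by simp
    finally show "(sharp X k \<odot> lz i) \<odot> base i = s \<odot> base i"
      using transposes_eqs(2)[OF tr] by simp
  qed
  have "f \<odot> sharp X k = sharp Y (farr G f \<odot> k)"
    using sharp_comp_left[OF k(1) f] by simp
  also have "farr G f \<odot> k = q\<^sub>2 \<odot> t'"
    using Comp_assoc[OF k(1) gap q2] q2_gap k(3) by simp
  finally show "f \<odot> sharp X k = t" unfolding transposes_eqs(3)[OF tr] .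
qed

lemma transposes_restrict:
  assumes i: "i \<in> S" "i \<in> hom E A B" and j: "j \<in> S" "j \<in> hom E A' B'"
    and a: "a \<in> hom E A A'" and b: "b \<in> hom E B B'" and ab: "j \<odot> a = b \<odot> i"
    and tr: "transposes j s t s' t'"
  shows "transposes i (s \<odot> po_map E I d i j a b) (t \<odot> farr I b) (s' \<odot> a) (t' \<odot> b)"
proof -
  note hs = transposes_homs[OF tr j]
  note m = po_map_hom[OF i j a b ab]
  note ci = cyl_hom[OF i] and bi = base_hom[OF i] and li = lz_hom[OF i]
  note cj = cyl_hom[OF j] and bj = base_hom[OF j] and lj = lz_hom[OF j]
  have "f \<odot> (s \<odot> po_map E I d i j a b) = (t \<odot> farr I b) \<odot> lz i"
    using Comp_assoc[OF m hs(1) f] hs(5) Comp_assoc[OF m lj hs(2)] lz_po_map[OF i j a b ab]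
      Comp_assoc[OF li I_hom[OF b] hs(2)] by simp
  then have 1: "comm_sq E (s \<odot> po_map E I d i j a b) (lz i) f (t \<odot> farr I b)"
    by (rule comm_sqI[OF li f Comp_hom[OF m hs(1)] Comp_hom[OF I_hom[OF b] hs(2)]])
  have "gap \<odot> (s' \<odot> a) = (t' \<odot> b) \<odot> i"
    using Comp_assoc[OF a hs(3) gap] hs(6) Comp_assoc[OF a j(2) hs(4)] ab Comp_assoc[OF i(2) b hs(4)] by simp
  then have 2: "comm_sq E (s' \<odot> a) i gap (t' \<odot> b)"
    by (rule comm_sqI[OF i(2) gap Comp_hom[OF a hs(3)] Comp_hom[OF b hs(4)]])
  have 3: "(s \<odot> po_map E I d i j a b) \<odot> cyl i = sharp X (s' \<odot> a)"
    using Comp_assoc[OF ci m hs(1)] po_map_cyl[OF i j a b ab] Comp_assoc[OF I_hom[OF a] cj hs(1)]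
      transposes_eqs(1)[OF tr] sharp_comp_right[OF hs(3) X a] by simp
  have 4: "(s \<odot> po_map E I d i j a b) \<odot> base i = q\<^sub>1 \<odot> (t' \<odot> b)"
    using Comp_assoc[OF bi m hs(1)] po_map_base[OF i j a b ab] Comp_assoc[OF b bj hs(1)]
      transposes_eqs(2)[OF tr] Comp_assoc[OF b hs(4) q1] by simp
  have 5: "t \<odot> farr I b = sharp Y (q\<^sub>2 \<odot> (t' \<odot> b))"
    unfolding transposes_eqs(3)[OF tr]
    using sharp_comp_right[OF Comp_hom[OF hs(4) q2] Y b] Comp_assoc[OF b hs(4) q2] by simp
  show ?thesis
    unfolding transposes_def using 1 2 3 4 5 by blast
qed

lemma S_hom: "i \<in> S \<Longrightarrow> i \<in> hom E (Dom E i) (Cod E i)"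
  using S_Arr by (simp add: hom_def)

lemma leibniz_rlp_iff:
  assumes i: "i \<in> S"
  shows "has_rlp E (lz i) f \<longleftrightarrow> has_rlp E i gap"
proof -
  note ih = S_hom[OF i]
  have D: "Cod E (lz i) = fobj I (Cod E i)" "Dom E f = X" "Dom E gap = fobj G X"
    using homD[OF lz_hom[OF i ih]] homD[OF f] homD[OF gap] by auto
  have o: "Cod E i \<in> Obj E" using hom_Objs[OF ih] by blast
  show ?thesis
    unfolding has_rlp_def D
  proof (intro iffI allI impI)
    fix s' t'
    assume L: "\<forall>s t. comm_sq E s (lz i) f t \<longrightarrow> (\<exists>h\<in>hom E (fobj I (Cod E i)) X. h \<odot> lz i = s \<and> f \<odot> h = t)"
      and sq: "comm_sq E s' i gap t'"
    obtain s t where tr: "transposes i s t s' t'" using ex_cotranspose[OF i ih sq] by blast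
    then obtain h where h: "h \<in> hom E (fobj I (Cod E i)) X" "h \<odot> lz i = s" "f \<odot> h = t"
      using L unfolding transposes_def by blast
    then show "\<exists>h\<in>hom E (Cod E i) (fobj G X). h \<odot> i = s' \<and> gap \<odot> h = t'"
      using flat_filler[OF i ih tr h] flat_hom[OF h(1) o] by blast
  next
    fix s t
    assume R: "\<forall>s' t'. comm_sq E s' i gap t' \<longrightarrow> (\<exists>h\<in>hom E (Cod E i) (fobj G X). h \<odot> i = s' \<and> gap \<odot> h = t')"
      and sq: "comm_sq E s (lz i) f t"
    obtain s' t' where tr: "transposes i s t s' t'" using ex_transpose[OF i ih sq] by blast
    then obtain k where k: "k \<in> hom E (Cod E i) (fobj G X)" "k \<odot> i = s'" "gap \<odot> k = t'"
      using R unfolding transposes_def by blast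
    then show "\<exists>h\<in>hom E (fobj I (Cod E i)) X. h \<odot> lz i = s \<and> f \<odot> h = t"
      using sharp_filler[OF i ih tr k] sharp_hom[OF k(1) X] by blast
  qed
qed

text \<open>Transpose the given fillers. The transpose of a square is unique, so picking one is harmless, and
  \<open>transposes_restrict\<close> turns uniformity on one side into uniformity on the other.\<close>

lemma leibniz_lifts_iff:
  assumes T: "T \<subseteq> S"
  shows "(\<exists>\<phi>. leibniz_lifts E I d T f \<phi>) \<longleftrightarrow> (\<exists>\<psi>. uniform_lifts E T gap \<psi>)"
proof
  have D: "Cod E (lz i) = fobj I (Cod E i)" if "i \<in> S" for i
    using homD[OF lz_hom[OF that S_hom[OF that]]] by blast
  have Df: "Dom E f = X" "Dom E gap = fobj G X" using homD[OF f] homD[OF gap] by auto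
  have square: "a \<in> hom E (Dom E i) (Dom E j)" "b \<in> hom E (Cod E i) (Cod E j)" "j \<odot> a = b \<odot> i"
    if "is_pullback E a i j b" for i j a b
    using that unfolding is_pullback_def comm_sq_def by auto
  {
    assume "\<exists>\<phi>. leibniz_lifts E I d T f \<phi>"
    then obtain \<phi> where \<phi>: "leibniz_lifts E I d T f \<phi>" ..
    have \<phi>_lift: "\<phi> i s t \<in> hom E (fobj I (Cod E i)) X" "\<phi> i s t \<odot> lz i = s" "f \<odot> \<phi> i s t = t"
      if "i \<in> T" "comm_sq E s (lz i) f t" for i s t
    proof -
      have "\<phi> i s t \<in> hom E (Cod E (lz i)) (Dom E f) \<and> \<phi> i s t \<odot> lz i = s \<and> f \<odot> \<phi> i s t = t"
        using \<phi> that unfolding leibniz_lifts_def by blast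
      moreover have "i \<in> S" using T that(1) by blast
      ultimately show "\<phi> i s t \<in> hom E (fobj I (Cod E i)) X" "\<phi> i s t \<odot> lz i = s" "f \<odot> \<phi> i s t = t"
        using D[of i] Df(1) by auto
    qed
    have \<phi>_uniform: "\<phi> j s t \<odot> farr I b = \<phi> i (s \<odot> po_map E I d i j a b) (t \<odot> farr I b)"
      if "j \<in> T" "i \<in> T" "is_pullback E a i j b" "comm_sq E s (lz j) f t" for j i a b s t
      using \<phi> that unfolding leibniz_lifts_def by blast
    define \<psi> where "\<psi> i s' t' = (let (s, t) = (SOME (s, t). transposes i s t s' t') in flat (Cod E i) (\<phi> i s t))" for i s' t'
    have \<psi>_eq: "\<psi> i s' t' = flat (Cod E i) (\<phi> i s t)" if i: "i \<in> S" and tr: "transposes i s t s' t'" for i s t s' t'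
    proof -
      have "(SOME (s, t). transposes i s t s' t') = (s, t)"
      proof (rule some_equality)
        show "p = (s, t)" if "case p of (u, v) \<Rightarrow> transposes i u v s' t'" for p
          using cotranspose_unique[OF i S_hom[OF i] _ tr] that by (cases p) auto
      qed (use tr in simp)
      then show ?thesis by (simp add: \<psi>_def)
    qed
    have "uniform_lifts E T gap \<psi>"
      unfolding uniform_lifts_def Df
    proof (intro conjI ballI allI impI)
      fix i s' t' assume iT: "i \<in> T" and sq: "comm_sq E s' i gap t'"
      then have i: "i \<in> S" using T by blast
      note ih = S_hom[OF i]
      have o: "Cod E i \<in> Obj E" using hom_Objs[OF ih] by blast
      obtain s t where tr: "transposes i s t s' t'" using ex_cotranspose[OF i ih sq] by blast
      note h = \<phi>_lift[OF iT transposes_sq(1)[OF tr]]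
      show "\<psi> i s' t' \<in> hom E (Cod E i) (fobj G X)" "\<psi> i s' t' \<odot> i = s'" "gap \<odot> \<psi> i s' t' = t'"
        unfolding \<psi>_eq[OF i tr] using flat_filler[OF i ih tr h] flat_hom[OF h(1) o] by auto
    next
      fix j i a b s' t' assume jT: "j \<in> T" and iT: "i \<in> T" and h: "is_pullback E a i j b \<and> comm_sq E s' j gap t'"
      then have i: "i \<in> S" and j: "j \<in> S" using T by auto
      note ih = S_hom[OF i] and jh = S_hom[OF j]
      obtain s t where tr: "transposes j s t s' t'" using ex_cotranspose[OF j jh] h by blast
      have ab: "a \<in> hom E (Dom E i) (Dom E j)" "b \<in> hom E (Cod E i) (Cod E j)" "j \<odot> a = b \<odot> i"
        using square h by auto
      note l = \<phi>_lift(1)[OF jT transposes_sq(1)[OF tr]]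
      show "\<psi> j s' t' \<odot> b = \<psi> i (s' \<odot> a) (t' \<odot> b)"
        unfolding \<psi>_eq[OF j tr] \<psi>_eq[OF i transposes_restrict[OF i ih j jh ab tr]]
        using flat_comp_right[OF l ab(2)] \<phi>_uniform[OF jT iT conjunct1[OF h] transposes_sq(1)[OF tr]] by simp
    qed
    then show "\<exists>\<psi>. uniform_lifts E T gap \<psi>" by blast
  next
    assume "\<exists>\<psi>. uniform_lifts E T gap \<psi>"
    then obtain \<psi> where \<psi>: "uniform_lifts E T gap \<psi>" ..
    have \<psi>_lift: "\<psi> i s' t' \<in> hom E (Cod E i) (fobj G X)" "\<psi> i s' t' \<odot> i = s'" "gap \<odot> \<psi> i s' t' = t'"
      if "i \<in> T" "comm_sq E s' i gap t'" for i s' t'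
      using \<psi> that Df(2) unfolding uniform_lifts_def by auto
    have \<psi>_uniform: "\<psi> j s' t' \<odot> b = \<psi> i (s' \<odot> a) (t' \<odot> b)"
      if "j \<in> T" "i \<in> T" "is_pullback E a i j b" "comm_sq E s' j gap t'" for j i a b s' t'
      using \<psi> that unfolding uniform_lifts_def by blast
    define \<phi> where "\<phi> i s t = (let (s', t') = (SOME (s', t'). transposes i s t s' t') in sharp X (\<psi> i s' t'))" for i s t
    have \<phi>_eq: "\<phi> i s t = sharp X (\<psi> i s' t')" if i: "i \<in> S" and tr: "transposes i s t s' t'" for i s t s' t'
    proof -
      have "(SOME (s', t'). transposes i s t s' t') = (s', t')"
      proof (rule some_equality)
        show "p = (s', t')" if "case p of (u, v) \<Rightarrow> transposes i s t u v" for p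
          using transpose_unique[OF i S_hom[OF i] _ tr] that by (cases p) auto
      qed (use tr in simp)
      then show ?thesis by (simp add: \<phi>_def)
    qed
    have "leibniz_lifts E I d T f \<phi>"
      unfolding leibniz_lifts_def Df
    proof (intro conjI ballI allI impI)
      fix i s t assume iT: "i \<in> T" and sq: "comm_sq E s (lz i) f t"
      then have i: "i \<in> S" using T by blast
      note ih = S_hom[OF i]
      obtain s' t' where tr: "transposes i s t s' t'" using ex_transpose[OF i ih sq] by blast
      note k = \<psi>_lift[OF iT transposes_sq(2)[OF tr]]
      show "\<phi> i s t \<in> hom E (Cod E (lz i)) X" "\<phi> i s t \<odot> lz i = s" "f \<odot> \<phi> i s t = t"
        unfolding \<phi>_eq[OF i tr] D[OF i] using sharp_filler[OF i ih tr k] sharp_hom[OF k(1) X] by auto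
    next
      fix j i a b s t assume jT: "j \<in> T" and iT: "i \<in> T" and h: "is_pullback E a i j b \<and> comm_sq E s (lz j) f t"
      then have i: "i \<in> S" and j: "j \<in> S" using T by auto
      note ih = S_hom[OF i] and jh = S_hom[OF j]
      obtain s' t' where tr: "transposes j s t s' t'" using ex_transpose[OF j jh] h by blast
      have ab: "a \<in> hom E (Dom E i) (Dom E j)" "b \<in> hom E (Cod E i) (Cod E j)" "j \<odot> a = b \<odot> i"
        using square h by auto
      note k = \<psi>_lift(1)[OF jT transposes_sq(2)[OF tr]]
      show "\<phi> j s t \<odot> farr I b = \<phi> i (s \<odot> po_map E I d i j a b) (t \<odot> farr I b)"
        unfolding \<phi>_eq[OF j tr] \<phi>_eq[OF i transposes_restrict[OF i ih j jh ab tr]]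
        using sharp_comp_right[OF k X ab(2)] \<psi>_uniform[OF jT iT conjunct1[OF h] transposes_sq(2)[OF tr]] by simp
    qed
    then show "\<exists>\<phi>. leibniz_lifts E I d T f \<phi>" by blast
  }
qed

end


section \<open>Fibrations\<close>

text \<open>Preserving pullbacks, \<open>I\<close> preserves monomorphisms, and \<open>d\<close> is a split monomorphism. As the
  naturality square of \<open>d\<close> at \<open>i\<close> is a pullback, \<open>A\<close> is the intersection of the subobjects \<open>I A\<close> and
  \<open>B\<close> of \<open>I B\<close>, and the pushout is their union.\<close>

lemma (in presheaf_category) ex_leibniz_pushout:
  assumes I: "preserves_pullbacks E E I" and d: "cartesian_nat_trans E E id_functor I d"
    and retract: "\<And>X. X \<in> Obj E \<Longrightarrow> \<epsilon> X \<in> hom E (fobj I X) X \<and> \<epsilon> X \<odot> d X = Id E X"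
    and i: "i \<in> hom E A B" and inj: "injective i"
  shows "\<exists>p q. is_pushout E (d A) i p q"
proof (rule ex_pushout_union)
  have o: "A \<in> Obj E" "B \<in> Obj E" using hom_Obj[OF i] by auto
  have nt: "nat_trans E E id_functor I d" using d unfolding cartesian_nat_trans_def by blast
  then have If: "is_functor E E I" unfolding nat_trans_def by blast
  show "is_pullback E (d A) i (farr I i) (d B)"
    using d homD[OF i] unfolding cartesian_nat_trans_def id_functor_def by auto
  have "is_pullback E (Id E A) (Id E A) i i"
    using injective_pullback_iff[OF i] inj by blast
  then have "is_pullback E (farr I (Id E A)) (farr I (Id E A)) (farr I i) (farr I i)"
    using I unfolding preserves_pullbacks_def by blast
  moreover have "farr I (Id E A) = Id E (fobj I A)"
    using If o unfolding is_functor_def by blast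
  ultimately show "injective (farr I i)"
    using injective_pullback_iff[OF is_functor_hom[OF If i]] by simp
  have dB: "d B \<in> hom E B (fobj I B)"
    using nt o unfolding nat_trans_def by (simp add: id_functor_def)
  show "injective (d B)"
    unfolding injective_def
  proof (intro ballI inj_onI)
    fix c x y assume c: "c \<in> Obj C" and "x \<in> fobj (Dom E (d B)) c" "y \<in> fobj (Dom E (d B)) c"
      and eq: "app (d B) c x = app (d B) c y"
    then have xy: "x \<in> fobj B c" "y \<in> fobj B c" using homD[OF dB] by auto
    have "app (\<epsilon> B) c (app (d B) c z) = z" if "z \<in> fobj B c" for z
      using app_comp[OF dB conjunct1[OF retract[OF o(2)]] c that] retract[OF o(2)] app_Id[OF c that] by simp
    then show "x = y" using xy eq by metis
  qed
qed

text \<open>Transposition turns lifting against Leibniz products, plain or uniform, into lifting of the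
  Leibniz exponential of \<open>f\<close> against \<open>M\<close> itself.\<close>

lemma (in cofibrations) leibniz_rlp_iff_uniform:
  assumes adj: "has_right_adjoint E E I" and d: "nat_trans E E id_functor I d"
    and po: "\<And>i. i \<in> M \<Longrightarrow> \<exists>p q. is_pushout E (d (Dom E i)) i p q" and f: "f \<in> Arr E"
  shows "(\<forall>i\<in>M. has_rlp E (leibniz E I d i) f) \<longleftrightarrow>
    (\<exists>\<phi>. leibniz_lifts E I d {m \<in> M. representable C (Cod E m)} f \<phi>)"
proof -
  obtain G \<eta> \<zeta> where adj: "nat_trans E E id_functor (fun_comp G I) \<eta>"
    "nat_trans E E (fun_comp I G) id_functor \<zeta>" "is_functor E E G"
    "\<And>x. x \<in> Obj E \<Longrightarrow> \<zeta> (fobj I x) \<odot> farr I (\<eta> x) = Id E (fobj I x)"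
    "\<And>x. x \<in> Obj E \<Longrightarrow> farr G (\<zeta> x) \<odot> \<eta> (fobj G x) = Id E (fobj G x)"
    using adj unfolding has_right_adjoint_def by blast
  interpret adjoint_cylinder E I G d \<eta> \<zeta>
    by unfold_locales (use d adj in auto)
  define X Y where "X = Dom E f" and "Y = Cod E f"
  have fh: "f \<in> hom E X Y" using f by (simp add: X_def Y_def hom_def)
  have Y: "Y \<in> Obj E" using hom_Objs[OF fh] by blast
  obtain Q q1 q2 where q: "q1 \<in> hom E Q X" "q2 \<in> hom E Q (fobj G Y)" "is_pullback E q1 q2 f (ev Y)"
    using ex_pullback[OF fh ev_hom[OF Y]] by blast
  interpret leibniz_exponential E I G d \<eta> \<zeta> M f q1 q2 X Y Q
    by unfold_locales (use M_Arr po fh q in auto)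
  have gap_Arr: "gap \<in> Arr E" using homD[OF gap] by blast
  have "(\<forall>i\<in>M. has_rlp E (leibniz E I d i) f) \<longleftrightarrow> (\<forall>i\<in>M. has_rlp E i gap)"
    using leibniz_rlp_iff by blast
  also have "\<dots> \<longleftrightarrow> (\<exists>\<psi>. uniform_lifts E {m \<in> M. representable C (Cod E m)} gap \<psi>)"
    by (rule rlp_iff_uniform_lifts(2)[OF gap_Arr])
  also have "\<dots> \<longleftrightarrow> (\<exists>\<phi>. leibniz_lifts E I d {m \<in> M. representable C (Cod E m)} f \<phi>)"
    by (rule leibniz_lifts_iff[symmetric]) blast
  finally show ?thesis .
qed

lemma (in cofibrations) uniform_fibration_iff:
  assumes f: "f \<in> Arr E"
  shows "uniform_fibration C I \<delta> M f \<longleftrightarrow>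
    (\<forall>k\<in>{0, 1}. \<exists>\<phi>. leibniz_lifts E I (\<delta> k) {m \<in> M. representable C (Cod E m)} f \<phi>)"
proof -
  let ?S = "{m \<in> M. representable C (Cod E m)}"
  have eq: "right_map_structure E (sum_cat (rep_cat C M) (rep_cat C M))
      (copair (fun_comp (leibniz_functor E I (\<delta> 0)) id_functor)
              (fun_comp (leibniz_functor E I (\<delta> 1)) id_functor)) f \<phi> \<longleftrightarrow>
    leibniz_lifts E I (\<delta> 0) ?S f (\<lambda>i. \<phi> (Inl i)) \<and> leibniz_lifts E I (\<delta> 1) ?S f (\<lambda>i. \<phi> (Inr i))" for \<phi>
    by (rule right_map_structure_copair)
      (use M_Arr in \<open>auto simp: rep_cat_def full_sub_def cart_arrow_cat_def arrow_cat_def E_Psh[symmetric]\<close>)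
  have "uniform_fibration C I \<delta> M f \<longleftrightarrow>
      (\<exists>\<phi>. leibniz_lifts E I (\<delta> 0) ?S f (\<lambda>i. \<phi> (Inl i)) \<and> leibniz_lifts E I (\<delta> 1) ?S f (\<lambda>i. \<phi> (Inr i)))"
    unfolding uniform_fibration_def right_map_def E_Psh[symmetric] eq using f by blast
  also have "\<dots> \<longleftrightarrow> (\<exists>\<phi>. leibniz_lifts E I (\<delta> 0) ?S f \<phi>) \<and> (\<exists>\<phi>. leibniz_lifts E I (\<delta> 1) ?S f \<phi>)"
    (is "?L \<longleftrightarrow> ?R")
  proof
    assume ?R
    then obtain \<phi> \<psi> where "leibniz_lifts E I (\<delta> 0) ?S f \<phi>" "leibniz_lifts E I (\<delta> 1) ?S f \<psi>" by blast
    then show ?L by (intro exI[of _ "case_sum \<phi> \<psi>"]) simp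
  qed blast
  finally show ?thesis by simp
qed

theorem theorem8p9:
  fixes C :: "('o, 'm) cat"
    and E :: "(('o, 'm, 'v) psh, ('o, 'm, 'v) psh_map) cat"
    and I :: "(('o, 'm, 'v) psh, ('o, 'm, 'v) psh_map, ('o, 'm, 'v) psh, ('o, 'm, 'v) psh_map) fctr"
    and \<delta> :: "nat \<Rightarrow> ('o, 'm, 'v) psh \<Rightarrow> ('o, 'm, 'v) psh_map"
    and \<epsilon> :: "('o, 'm, 'v) psh \<Rightarrow> ('o, 'm, 'v) psh_map"
    and c :: "nat \<Rightarrow> ('o, 'm, 'v) psh \<Rightarrow> ('o, 'm, 'v) psh_map"
    and M :: "('o, 'm, 'v) psh_map set"
  assumes universe: "is_universe TYPE('v)"
    and C: "small_category TYPE('v) C"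
    and E: "E = Psh C"
    and cylinder: "functorial_cylinder E I \<delta>"
    and contractions: "contractions E I \<delta> \<epsilon>"
    and connections: "connections E I \<delta> \<epsilon> c"
    and adjoint: "has_right_adjoint E E I"
    and C1: "preserves_pullbacks E E I"
    and C2: "\<And>k. k \<in> {0, 1} \<Longrightarrow> cartesian_nat_trans E E id_functor I (\<delta> k)"
    and M: "M \<subseteq> Obj (cart_arrow_cat E)"
    and M1: "\<And>m. m \<in> M \<Longrightarrow> mono_arr E m"
    and M2: "\<And>Z X m. \<lbrakk>initial_obj E Z; X \<in> Obj E; m \<in> hom E Z X\<rbrakk> \<Longrightarrow> m \<in> M"
    and M3: "\<And>a m n b. \<lbrakk>n \<in> M; is_pullback E a m n b\<rbrakk> \<Longrightarrow> m \<in> M"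
    and M4: "\<And>k i. \<lbrakk>k \<in> {0, 1}; i \<in> M\<rbrakk> \<Longrightarrow> leibniz E I (\<delta> k) i \<in> M"
    and M5_colimits: "has_colimits TYPE('v) (full_sub (cart_arrow_cat E) M)"
    and M5_preserved:
      "preserves_colimits TYPE('v) (full_sub (cart_arrow_cat E) M) (cart_arrow_cat E) id_functor"
  shows "(\<forall>f\<in>Arr E. uniform_trivial_fibration E M f \<longleftrightarrow> trivial_fibration E M f) \<and>
         (\<forall>f\<in>Arr E. uniform_fibration C I \<delta> M f \<longleftrightarrow> fibration E I \<delta> M f)"
proof -
  interpret presheaf_category C E
    by unfold_locales (fact universe C E)+
  interpret cofibrations C E M
  proof unfold_locales
    show "m \<in> Arr E" if "m \<in> M" for m
      using M that by (auto simp: cart_arrow_cat_def arrow_cat_def)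
    show "injective m" if "m \<in> M" for m
      using mono_injective[OF M1[OF that]] .
    show "m \<in> M" if "n \<in> M" "is_pullback E a m n b" for a m n b
      using M3[OF that] .
  qed (fact M5_colimits)
  have po: "\<exists>p q. is_pushout E (\<delta> k (Dom E i)) i p q" if k: "k \<in> {0, 1}" and i: "i \<in> M" for k i
  proof (rule ex_leibniz_pushout[OF C1 C2[OF k] _ M_hom[OF i] M_inj[OF i]])
    show "\<epsilon> X \<in> hom E (fobj I X) X \<and> \<epsilon> X \<cdot>\<^bsub>E\<^esub> \<delta> k X = Id E X" if "X \<in> Obj E" for X
      using contractions k that unfolding contractions_def nat_trans_def by (auto simp: id_functor_def)
  qed
  have nt: "nat_trans E E id_functor I (\<delta> k)" if "k \<in> {0, 1}" for k
    using cylinder that unfolding functorial_cylinder_def by blast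
  show ?thesis
  proof (intro conjI ballI)
    fix f assume f: "f \<in> Arr E"
    show "uniform_trivial_fibration E M f \<longleftrightarrow> trivial_fibration E M f"
      unfolding uniform_trivial_fibration_iff[OF f] trivial_fibration_def rlp_iff_uniform_lifts(1)[OF f]
      using f by simp
    show "uniform_fibration C I \<delta> M f \<longleftrightarrow> fibration E I \<delta> M f"
      unfolding uniform_fibration_iff[OF f] fibration_def
      using leibniz_rlp_iff_uniform[OF adjoint nt po f] f by blast
  qed
qed

end
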